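(* Let $k\to A$ be a homomorphism of commutative rings, $L_0\to L$ a morphism of $(k,A)$-Lie algebras, and $U_0=\mathrm{U}(L_0)\to U=\mathrm{U}(L)$ the induced morphism of enveloping algebras. Let $M$ be a right $U$-module and $N$ a left $U_0$-module. Then the morphism of right $U$-modules $$\lambda:\ [M\otimes_A N]\otimes_{U_0}U\longrightarrow M\otimes_A[U\otimes_{U_0}N]$$ induced by the right $U_0$-linear map $\sigma:M\otimes_A N\to M\otimes_A[U\otimes_{U_0}N]$, $\sigma(m\otimes n)=m\otimes[1\otimes n]$, is an isomorphism of right $U$-modules.
   Context: A $(k,A)$-Lie algebra (Lie–Rinehart algebra) is an $A$-module $L$ with a $k$-Lie algebra structure and an $A$-linear morphism of $k$-Lie algebras $L\to\mathrm{Der}_k(A)$, $\lambda\mapsto(a\mapsto\lambda(a))$, such that $[\lambda,a\mu]=a[\lambda,\mu]+\lambda(a)\mu$. Its enveloping algebra $\mathrm{U}(L)$ is the quotient of the tensor algebra $\mathrm{T}^\bullet_k(A\oplus L)$ by the two-sided ideal generated by the elements $c\cdot 1-i(c)$ ($c\in k$), $i(a)\otimes i(b)-i(ab)$, $i(\lambda)\otimes i(a)-i(a)\otimes i(\lambda)-i(\lambda(a))$, $i(\lambda)\otimes i(\mu)-i(\mu)\otimes i(\lambda)-i([\lambda,\mu])$, $i(a\lambda)-i(a)\otimes i(\lambda)$ ($a,b\in A$, $\lambda,\mu\in L$), where $i:A\oplus L\to\mathrm{T}^\bullet_k(A\oplus L)$ is the inclusion. If $M$ is a right and $N$ a left $\mathrm{U}(L)$-module,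 $M\otimes_A N$ is a right $\mathrm{U}(L)$-module via $(m\otimes n)a=ma\otimes n$ and $(m\otimes n)\lambda=(m\lambda)\otimes n-m\otimes(\lambda n)$ for $a\in A$, $\lambda\in L$ (similarly for $L_0$). $M$ is regarded as a right $U_0$-module by restriction of scalars, so $M\otimes_A N$ is a right $U_0$-module; $U\otimes_{U_0}N$ is a left $U$-module, so $M\otimes_A[U\otimes_{U_0}N]$ is a right $U$-module. *)

theory Defs
  imports "HOL-Algebra.QuotRing" "HOL-Algebra.Module" "HOL-Algebra.Free_Abelian_Groups"
begin

section \<open>Modules over a not necessarily commutative ring\<close>

locale left_module = R?: ring R + M?: abelian_group M for R (structure) and M (structure) +
  assumes lsmult_closed:
      "\<lbrakk>r \<in> carrier R; x \<in> carrier M\<rbrakk> \<Longrightarrow> r \<odot>\<^bsub>M\<^esub> x \<in> carrier M"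
    and lsmult_add_left:
      "\<lbrakk>r \<in> carrier R; s \<in> carrier R; x \<in> carrier M\<rbrakk> \<Longrightarrow>
        (r \<oplus>\<^bsub>R\<^esub> s) \<odot>\<^bsub>M\<^esub> x = r \<odot>\<^bsub>M\<^esub> x \<oplus>\<^bsub>M\<^esub> s \<odot>\<^bsub>M\<^esub> x"
    and lsmult_add_right:
      "\<lbrakk>r \<in> carrier R; x \<in> carrier M; y \<in> carrier M\<rbrakk> \<Longrightarrow>
        r \<odot>\<^bsub>M\<^esub> (x \<oplus>\<^bsub>M\<^esub> y) = r \<odot>\<^bsub>M\<^esub> x \<oplus>\<^bsub>M\<^esub> r \<odot>\<^bsub>M\<^esub> y"
    and lsmult_assoc:
      "\<lbrakk>r \<in> carrier R; s \<in> carrier R; x \<in> carrier M\<rbrakk> \<Longrightarrow>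
        (r \<otimes>\<^bsub>R\<^esub> s) \<odot>\<^bsub>M\<^esub> x = r \<odot>\<^bsub>M\<^esub> (s \<odot>\<^bsub>M\<^esub> x)"
    and lsmult_one: "x \<in> carrier M \<Longrightarrow> \<one>\<^bsub>R\<^esub> \<odot>\<^bsub>M\<^esub> x = x"

record ('r, 'm) rmodule = "'m ring" +
  rsmult :: "['m, 'r] \<Rightarrow> 'm" (infixl \<open>\<bullet>\<index>\<close> 70)

locale right_module = R?: ring R + M?: abelian_group M for R (structure) and M (structure) +
  assumes rsmult_closed:
      "\<lbrakk>r \<in> carrier R; x \<in> carrier M\<rbrakk> \<Longrightarrow> x \<bullet>\<^bsub>M\<^esub> r \<in> carrier M"
    and rsmult_add_right:
      "\<lbrakk>r \<in> carrier R; s \<in> carrier R; x \<in> carrier M\<rbrakk> \<Longrightarrow>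
        x \<bullet>\<^bsub>M\<^esub> (r \<oplus>\<^bsub>R\<^esub> s) = x \<bullet>\<^bsub>M\<^esub> r \<oplus>\<^bsub>M\<^esub> x \<bullet>\<^bsub>M\<^esub> s"
    and rsmult_add_left:
      "\<lbrakk>r \<in> carrier R; x \<in> carrier M; y \<in> carrier M\<rbrakk> \<Longrightarrow>
        (x \<oplus>\<^bsub>M\<^esub> y) \<bullet>\<^bsub>M\<^esub> r = x \<bullet>\<^bsub>M\<^esub> r \<oplus>\<^bsub>M\<^esub> y \<bullet>\<^bsub>M\<^esub> r"
    and rsmult_assoc:
      "\<lbrakk>r \<in> carrier R; s \<in> carrier R; x \<in> carrier M\<rbrakk> \<Longrightarrow>
        x \<bullet>\<^bsub>M\<^esub> (r \<otimes>\<^bsub>R\<^esub> s) = (x \<bullet>\<^bsub>M\<^esub> r) \<bullet>\<^bsub>M\<^esub> s"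
    and rsmult_one: "x \<in> carrier M \<Longrightarrow> x \<bullet>\<^bsub>M\<^esub> \<one>\<^bsub>R\<^esub> = x"

definition right_module_hom ::
    "[('r, 'b) ring_scheme, ('r, 'm, 'c) rmodule_scheme, ('r, 'n, 'd) rmodule_scheme] \<Rightarrow> ('m \<Rightarrow> 'n) set"
  where "right_module_hom R M N =
    {g \<in> carrier M \<rightarrow> carrier N.
      (\<forall>x\<in>carrier M. \<forall>y\<in>carrier M. g (x \<oplus>\<^bsub>M\<^esub> y) = g x \<oplus>\<^bsub>N\<^esub> g y) \<and>
      (\<forall>x\<in>carrier M. \<forall>r\<in>carrier R. g (x \<bullet>\<^bsub>M\<^esub> r) = g x \<bullet>\<^bsub>N\<^esub> r)}"

definition right_module_iso ::
    "[('r, 'b) ring_scheme, ('r, 'm, 'c) rmodule_scheme, ('r, 'n, 'd) rmodule_scheme] \<Rightarrow> ('m \<Rightarrow> 'n) set"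
  where "right_module_iso R M N =
    {g \<in> right_module_hom R M N. bij_betw g (carrier M) (carrier N)}"

definition left_mod :: "[('m, 'b) ring_scheme, 'r \<Rightarrow> 'm \<Rightarrow> 'm] \<Rightarrow> ('r, 'm) module"
  where "left_mod G act =
    \<lparr>carrier = carrier G, mult = mult G, one = one G, ring.zero = \<zero>\<^bsub>G\<^esub>, add = add G, smult = act\<rparr>"

definition right_mod :: "[('m, 'b) ring_scheme, 'm \<Rightarrow> 'r \<Rightarrow> 'm] \<Rightarrow> ('r, 'm) rmodule"
  where "right_mod G act =
    \<lparr>carrier = carrier G, mult = mult G, one = one G, ring.zero = \<zero>\<^bsub>G\<^esub>, add = add G, rsmult = act\<rparr>"

definition restrict_left :: "['r \<Rightarrow> 's, ('s, 'm) module] \<Rightarrow> ('r, 'm) module"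
  where "restrict_left h N = left_mod N (\<lambda>r x. h r \<odot>\<^bsub>N\<^esub> x)"

definition restrict_right :: "['r \<Rightarrow> 's, ('s, 'm) rmodule] \<Rightarrow> ('r, 'm) rmodule"
  where "restrict_right h M = right_mod M (\<lambda>x r. x \<bullet>\<^bsub>M\<^esub> h r)"


section \<open>Tensor products over a not necessarily commutative ring\<close>

type_synonym ('m, 'n) tensor = "(('m \<times> 'n) \<Rightarrow>\<^sub>0 int) set"

definition tensor_rels ::
    "['r ring, ('r, 'm) rmodule, ('r, 'n) module] \<Rightarrow> (('m \<times> 'n) \<Rightarrow>\<^sub>0 int) set"
  where "tensor_rels R M N =
    {frag_of (x \<oplus>\<^bsub>M\<^esub> x', y) - frag_of (x, y) - frag_of (x', y) | x x' y.
        x \<in> carrier M \<and> x' \<in> carrier M \<and> y \<in> carrier N} \<union>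
    {frag_of (x, y \<oplus>\<^bsub>N\<^esub> y') - frag_of (x, y) - frag_of (x, y') | x y y'.
        x \<in> carrier M \<and> y \<in> carrier N \<and> y' \<in> carrier N} \<union>
    {frag_of (x \<bullet>\<^bsub>M\<^esub> r, y) - frag_of (x, r \<odot>\<^bsub>N\<^esub> y) | x r y.
        x \<in> carrier M \<and> r \<in> carrier R \<and> y \<in> carrier N}"

abbreviation tensor_free ::
    "[('r, 'm) rmodule, ('r, 'n) module] \<Rightarrow> (('m \<times> 'n) \<Rightarrow>\<^sub>0 int) Group.monoid"
  where "tensor_free M N \<equiv> free_Abelian_group (carrier M \<times> carrier N)"

definition tensor_null ::
    "['r ring, ('r, 'm) rmodule, ('r, 'n) module] \<Rightarrow> (('m \<times> 'n) \<Rightarrow>\<^sub>0 int) set"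
  where "tensor_null R M N = generate (tensor_free M N) (tensor_rels R M N)"

text \<open>The abelian group \<open>M \<otimes>\<^sub>R N\<close>, written additively; as usual for modules,
  the fields \<open>mult\<close> and \<open>one\<close> of the record carry no information.\<close>

definition tensor_group ::
    "['r ring, ('r, 'm) rmodule, ('r, 'n) module] \<Rightarrow> ('m, 'n) tensor ring"
  where "tensor_group R M N =
    (let Q = tensor_free M N Mod tensor_null R M N in
     \<lparr>carrier = carrier Q, mult = undefined, one = undefined, ring.zero = one Q, add = mult Q\<rparr>)"

definition tensor_elem ::
    "['r ring, ('r, 'm) rmodule, ('r, 'n) module, 'm, 'n] \<Rightarrow> ('m, 'n) tensor"
  where "tensor_elem R M N x y = tensor_null R M N #>\<^bsub>tensor_free M N\<^esub> frag_of (x, y)"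

text \<open>The additive map with \<open>x \<otimes> y \<mapsto> b x y\<close>; independent of the chosen representative
  of the coset whenever \<open>b\<close> is biadditive and balanced.\<close>

definition tensor_lift :: "[('g, 'b) ring_scheme, 'm \<Rightarrow> 'n \<Rightarrow> 'g, ('m, 'n) tensor] \<Rightarrow> 'g"
  where "tensor_lift G b X =
    (let c = (SOME c. c \<in> X) in
     \<Oplus>\<^bsub>G\<^esub>p\<in>Poly_Mapping.keys c. [Poly_Mapping.lookup c p] \<cdot>\<^bsub>G\<^esub> b (fst p) (snd p))"


section \<open>Extension of scalars along a ring homomorphism \<open>h : R \<rightarrow> S\<close>\<close>

text \<open>The left \<open>S\<close>-module \<open>S \<otimes>\<^sub>R N\<close>, and its elements \<open>s \<otimes> x\<close>.\<close>

definition ind_left_elem ::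
    "['r ring, 'r \<Rightarrow> 's, 's ring, ('r, 'n) module, 's, 'n] \<Rightarrow> ('s, 'n) tensor"
  where "ind_left_elem R h S N = tensor_elem R (right_mod S (\<lambda>s r. s \<otimes>\<^bsub>S\<^esub> h r)) N"

definition ind_left ::
    "['r ring, 'r \<Rightarrow> 's, 's ring, ('r, 'n) module] \<Rightarrow> ('s, ('s, 'n) tensor) module"
  where "ind_left R h S N =
    (let T = tensor_group R (right_mod S (\<lambda>s r. s \<otimes>\<^bsub>S\<^esub> h r)) N in
     left_mod T (\<lambda>s'. tensor_lift T (\<lambda>s x. ind_left_elem R h S N (s' \<otimes>\<^bsub>S\<^esub> s) x)))"

text \<open>The right \<open>S\<close>-module \<open>M \<otimes>\<^sub>R S\<close>, and its elements \<open>x \<otimes> s\<close>.\<close>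

definition ind_right_elem ::
    "['r ring, 'r \<Rightarrow> 's, 's ring, ('r, 'm) rmodule, 'm, 's] \<Rightarrow> ('m, 's) tensor"
  where "ind_right_elem R h S M = tensor_elem R M (left_mod S (\<lambda>r s. h r \<otimes>\<^bsub>S\<^esub> s))"

definition ind_right ::
    "['r ring, 'r \<Rightarrow> 's, 's ring, ('r, 'm) rmodule] \<Rightarrow> ('s, ('m, 's) tensor) rmodule"
  where "ind_right R h S M =
    (let T = tensor_group R M (left_mod S (\<lambda>r s. h r \<otimes>\<^bsub>S\<^esub> s)) in
     right_mod T (\<lambda>X s'. tensor_lift T (\<lambda>x s. ind_right_elem R h S M x (s \<otimes>\<^bsub>S\<^esub> s')) X))"


section \<open>Lie--Rinehart algebras\<close>

definition derivations :: "['k ring, 'a ring, 'k \<Rightarrow> 'a] \<Rightarrow> ('a \<Rightarrow> 'a) set"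
  where "derivations k A \<phi> =
    {D \<in> carrier A \<rightarrow> carrier A.
      (\<forall>a\<in>carrier A. \<forall>b\<in>carrier A. D (a \<oplus>\<^bsub>A\<^esub> b) = D a \<oplus>\<^bsub>A\<^esub> D b) \<and>
      (\<forall>c\<in>carrier k. \<forall>a\<in>carrier A. D (\<phi> c \<otimes>\<^bsub>A\<^esub> a) = \<phi> c \<otimes>\<^bsub>A\<^esub> D a) \<and>
      (\<forall>a\<in>carrier A. \<forall>b\<in>carrier A. D (a \<otimes>\<^bsub>A\<^esub> b) = a \<otimes>\<^bsub>A\<^esub> D b \<oplus>\<^bsub>A\<^esub> D a \<otimes>\<^bsub>A\<^esub> b)}"

record ('a, 'l) lie_rinehart = "('a, 'l) module" +
  bracket :: "'l \<Rightarrow> 'l \<Rightarrow> 'l"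
  anchor :: "'l \<Rightarrow> 'a \<Rightarrow> 'a"

locale lie_rinehart = phi?: ring_hom_cring k A \<phi> + module A L
  for k :: "'k ring" and A :: "'a ring" and \<phi> :: "'k \<Rightarrow> 'a" and L :: "('a, 'l) lie_rinehart" +
  assumes bracket_closed:
      "\<lbrakk>x \<in> carrier L; y \<in> carrier L\<rbrakk> \<Longrightarrow> bracket L x y \<in> carrier L"
    and bracket_add_left:
      "\<lbrakk>x \<in> carrier L; y \<in> carrier L; z \<in> carrier L\<rbrakk> \<Longrightarrow>
        bracket L (x \<oplus>\<^bsub>L\<^esub> y) z = bracket L x z \<oplus>\<^bsub>L\<^esub> bracket L y z"
    and bracket_add_right:
      "\<lbrakk>x \<in> carrier L; y \<in> carrier L; z \<in> carrier L\<rbrakk> \<Longrightarrow>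
        bracket L x (y \<oplus>\<^bsub>L\<^esub> z) = bracket L x y \<oplus>\<^bsub>L\<^esub> bracket L x z"
    and bracket_smult_left:
      "\<lbrakk>c \<in> carrier k; x \<in> carrier L; y \<in> carrier L\<rbrakk> \<Longrightarrow>
        bracket L (\<phi> c \<odot>\<^bsub>L\<^esub> x) y = \<phi> c \<odot>\<^bsub>L\<^esub> bracket L x y"
    and bracket_smult_right:
      "\<lbrakk>c \<in> carrier k; x \<in> carrier L; y \<in> carrier L\<rbrakk> \<Longrightarrow>
        bracket L x (\<phi> c \<odot>\<^bsub>L\<^esub> y) = \<phi> c \<odot>\<^bsub>L\<^esub> bracket L x y"
    and bracket_alternating: "x \<in> carrier L \<Longrightarrow> bracket L x x = \<zero>\<^bsub>L\<^esub>"
    and jacobi: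
      "\<lbrakk>x \<in> carrier L; y \<in> carrier L; z \<in> carrier L\<rbrakk> \<Longrightarrow>
        bracket L x (bracket L y z) \<oplus>\<^bsub>L\<^esub> bracket L y (bracket L z x)
          \<oplus>\<^bsub>L\<^esub> bracket L z (bracket L x y) = \<zero>\<^bsub>L\<^esub>"
    and anchor_derivation: "x \<in> carrier L \<Longrightarrow> anchor L x \<in> derivations k A \<phi>"
    and anchor_add:
      "\<lbrakk>x \<in> carrier L; y \<in> carrier L; a \<in> carrier A\<rbrakk> \<Longrightarrow>
        anchor L (x \<oplus>\<^bsub>L\<^esub> y) a = anchor L x a \<oplus>\<^bsub>A\<^esub> anchor L y a"
    and anchor_smult:
      "\<lbrakk>b \<in> carrier A; x \<in> carrier L; a \<in> carrier A\<rbrakk> \<Longrightarrow>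
        anchor L (b \<odot>\<^bsub>L\<^esub> x) a = b \<otimes>\<^bsub>A\<^esub> anchor L x a"
    and anchor_bracket:
      "\<lbrakk>x \<in> carrier L; y \<in> carrier L; a \<in> carrier A\<rbrakk> \<Longrightarrow>
        anchor L (bracket L x y) a =
          anchor L x (anchor L y a) \<ominus>\<^bsub>A\<^esub> anchor L y (anchor L x a)"
    and leibniz:
      "\<lbrakk>x \<in> carrier L; a \<in> carrier A; y \<in> carrier L\<rbrakk> \<Longrightarrow>
        bracket L x (a \<odot>\<^bsub>L\<^esub> y) = a \<odot>\<^bsub>L\<^esub> bracket L x y \<oplus>\<^bsub>L\<^esub> anchor L x a \<odot>\<^bsub>L\<^esub> y"

definition lie_rinehart_hom ::
    "['a ring, ('a, 'l) lie_rinehart, ('a, 'l') lie_rinehart] \<Rightarrow> ('l \<Rightarrow> 'l') set"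
  where "lie_rinehart_hom A L L' =
    {f \<in> carrier L \<rightarrow> carrier L'.
      (\<forall>x\<in>carrier L. \<forall>y\<in>carrier L. f (x \<oplus>\<^bsub>L\<^esub> y) = f x \<oplus>\<^bsub>L'\<^esub> f y) \<and>
      (\<forall>a\<in>carrier A. \<forall>x\<in>carrier L. f (a \<odot>\<^bsub>L\<^esub> x) = a \<odot>\<^bsub>L'\<^esub> f x) \<and>
      (\<forall>x\<in>carrier L. \<forall>y\<in>carrier L. f (bracket L x y) = bracket L' (f x) (f y)) \<and>
      (\<forall>x\<in>carrier L. \<forall>a\<in>carrier A. anchor L' (f x) a = anchor L x a)}"


section \<open>The tensor algebra of a module over a commutative ring\<close>

text \<open>The free associative unital \<open>k\<close>-algebra on a set \<open>V\<close>: finitely supported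
  \<open>k\<close>-valued functions on the words over \<open>V\<close>, with the convolution product for
  concatenation.\<close>

definition free_algebra :: "['k ring, 'v set] \<Rightarrow> ('v list \<Rightarrow> 'k) ring"
  where "free_algebra k V =
    \<lparr>carrier = {x. (\<forall>w. x w \<in> carrier k) \<and> finite {w. x w \<noteq> \<zero>\<^bsub>k\<^esub>} \<and>
                   {w. x w \<noteq> \<zero>\<^bsub>k\<^esub>} \<subseteq> lists V},
     mult = (\<lambda>x y w. \<Oplus>\<^bsub>k\<^esub>i\<in>{..length w}. x (take i w) \<otimes>\<^bsub>k\<^esub> y (drop i w)),
     one = (\<lambda>w. if w = [] then \<one>\<^bsub>k\<^esub> else \<zero>\<^bsub>k\<^esub>),
     ring.zero = (\<lambda>w. \<zero>\<^bsub>k\<^esub>),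
     add = (\<lambda>x y w. x w \<oplus>\<^bsub>k\<^esub> y w)\<rparr>"

definition monomial :: "['k ring, 'k, 'v list] \<Rightarrow> 'v list \<Rightarrow> 'k"
  where "monomial k c w = (\<lambda>w'. if w' = w then c else \<zero>\<^bsub>k\<^esub>)"

text \<open>Modulo the two-sided ideal generated by the linearity relations on letters, the words
  of length \<open>n\<close> span the \<open>n\<close>-th tensor power of the \<open>k\<close>-module \<open>V\<close>, since multiplying these
  relations by words on both sides yields all multilinearity relations.\<close>

definition linearity_ideal :: "['k ring, ('k, 'v) module] \<Rightarrow> ('v list \<Rightarrow> 'k) set"
  where "linearity_ideal k V =
    (let F = free_algebra k (carrier V) in
     Idl\<^bsub>F\<^esub> ({monomial k \<one>\<^bsub>k\<^esub> [v \<oplus>\<^bsub>V\<^esub> w] \<ominus>\<^bsub>F\<^esub> monomial k \<one>\<^bsub>k\<^esub> [v] \<ominus>\<^bsub>F\<^esub> monomial k \<one>\<^bsub>k\<^esub> [w] | v w.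
              v \<in> carrier V \<and> w \<in> carrier V} \<union>
            {monomial k \<one>\<^bsub>k\<^esub> [c \<odot>\<^bsub>V\<^esub> v] \<ominus>\<^bsub>F\<^esub> monomial k c [v] | c v.
              c \<in> carrier k \<and> v \<in> carrier V}))"

definition tensor_algebra :: "['k ring, ('k, 'v) module] \<Rightarrow> ('v list \<Rightarrow> 'k) set ring"
  where "tensor_algebra k V = free_algebra k (carrier V) Quot linearity_ideal k V"

definition tensor_algebra_incl :: "['k ring, ('k, 'v) module, 'v] \<Rightarrow> ('v list \<Rightarrow> 'k) set"
  where "tensor_algebra_incl k V v =
    linearity_ideal k V +>\<^bsub>free_algebra k (carrier V)\<^esub> monomial k \<one>\<^bsub>k\<^esub> [v]"

text \<open>The element \<open>c \<cdot> 1\<close> of the tensor algebra, for a scalar \<open>c\<close>.\<close>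

definition tensor_algebra_scalar :: "['k ring, ('k, 'v) module, 'k] \<Rightarrow> ('v list \<Rightarrow> 'k) set"
  where "tensor_algebra_scalar k V c =
    linearity_ideal k V +>\<^bsub>free_algebra k (carrier V)\<^esub> monomial k c []"


section \<open>The enveloping algebra of a Lie--Rinehart algebra\<close>

definition direct_sum ::
    "['a ring, 'k \<Rightarrow> 'a, ('a, 'l) lie_rinehart] \<Rightarrow> ('k, 'a \<times> 'l) module"
  where "direct_sum A \<phi> L =
    \<lparr>carrier = carrier A \<times> carrier L, mult = undefined, one = undefined,
     ring.zero = (\<zero>\<^bsub>A\<^esub>, \<zero>\<^bsub>L\<^esub>),
     add = (\<lambda>v w. (fst v \<oplus>\<^bsub>A\<^esub> fst w, snd v \<oplus>\<^bsub>L\<^esub> snd w)),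
     smult = (\<lambda>c v. (\<phi> c \<otimes>\<^bsub>A\<^esub> fst v, \<phi> c \<odot>\<^bsub>L\<^esub> snd v))\<rparr>"

type_synonym ('k, 'a, 'l) env = "(('a \<times> 'l) list \<Rightarrow> 'k) set set"

definition env_ideal ::
    "['k ring, 'a ring, 'k \<Rightarrow> 'a, ('a, 'l) lie_rinehart] \<Rightarrow> (('a \<times> 'l) list \<Rightarrow> 'k) set set"
  where "env_ideal k A \<phi> L =
    (let V = direct_sum A \<phi> L; T = tensor_algebra k V;
         s = tensor_algebra_scalar k V;
         i = (\<lambda>a. tensor_algebra_incl k V (a, \<zero>\<^bsub>L\<^esub>));
         j = (\<lambda>x. tensor_algebra_incl k V (\<zero>\<^bsub>A\<^esub>, x))
     in Idl\<^bsub>T\<^esub>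
      ({s c \<ominus>\<^bsub>T\<^esub> i (\<phi> c) | c. c \<in> carrier k} \<union>
       {i a \<otimes>\<^bsub>T\<^esub> i b \<ominus>\<^bsub>T\<^esub> i (a \<otimes>\<^bsub>A\<^esub> b) | a b. a \<in> carrier A \<and> b \<in> carrier A} \<union>
       {j x \<otimes>\<^bsub>T\<^esub> i a \<ominus>\<^bsub>T\<^esub> i a \<otimes>\<^bsub>T\<^esub> j x \<ominus>\<^bsub>T\<^esub> i (anchor L x a) | x a.
          x \<in> carrier L \<and> a \<in> carrier A} \<union>
       {j x \<otimes>\<^bsub>T\<^esub> j y \<ominus>\<^bsub>T\<^esub> j y \<otimes>\<^bsub>T\<^esub> j x \<ominus>\<^bsub>T\<^esub> j (bracket L x y) | x y.
          x \<in> carrier L \<and> y \<in> carrier L} \<union>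
       {j (a \<odot>\<^bsub>L\<^esub> x) \<ominus>\<^bsub>T\<^esub> i a \<otimes>\<^bsub>T\<^esub> j x | a x. a \<in> carrier A \<and> x \<in> carrier L}))"

definition env ::
    "['k ring, 'a ring, 'k \<Rightarrow> 'a, ('a, 'l) lie_rinehart] \<Rightarrow> ('k, 'a, 'l) env ring"
  where "env k A \<phi> L = tensor_algebra k (direct_sum A \<phi> L) Quot env_ideal k A \<phi> L"

definition env_incl ::
    "['k ring, 'a ring, 'k \<Rightarrow> 'a, ('a, 'l) lie_rinehart, 'a \<times> 'l] \<Rightarrow> ('k, 'a, 'l) env"
  where "env_incl k A \<phi> L v =
    env_ideal k A \<phi> L +>\<^bsub>tensor_algebra k (direct_sum A \<phi> L)\<^esub>
      tensor_algebra_incl k (direct_sum A \<phi> L) v"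

definition env_A ::
    "['k ring, 'a ring, 'k \<Rightarrow> 'a, ('a, 'l) lie_rinehart, 'a] \<Rightarrow> ('k, 'a, 'l) env"
  where "env_A k A \<phi> L a = env_incl k A \<phi> L (a, \<zero>\<^bsub>L\<^esub>)"

definition env_L ::
    "['k ring, 'a ring, 'k \<Rightarrow> 'a, ('a, 'l) lie_rinehart, 'l] \<Rightarrow> ('k, 'a, 'l) env"
  where "env_L k A \<phi> L x = env_incl k A \<phi> L (\<zero>\<^bsub>A\<^esub>, x)"

text \<open>In the next two definitions the choice is unique on the relevant carriers, because the
  images of \<open>A\<close> and \<open>L\<close> generate the enveloping algebra as a ring.\<close>

definition env_map ::
    "['k ring, 'a ring, 'k \<Rightarrow> 'a, ('a, 'l) lie_rinehart, ('a, 'l') lie_rinehart, 'l \<Rightarrow> 'l'] \<Rightarrow>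
      ('k, 'a, 'l) env \<Rightarrow> ('k, 'a, 'l') env"
  where "env_map k A \<phi> L L' f =
    (SOME h. h \<in> ring_hom (env k A \<phi> L) (env k A \<phi> L') \<and>
       (\<forall>a\<in>carrier A. h (env_A k A \<phi> L a) = env_A k A \<phi> L' a) \<and>
       (\<forall>x\<in>carrier L. h (env_L k A \<phi> L x) = env_L k A \<phi> L' (f x)))"


section \<open>The right module \<open>M \<otimes>\<^sub>A N\<close> for a right and a left module over the enveloping algebra\<close>

definition lr_tensor_group ::
    "['k ring, 'a ring, 'k \<Rightarrow> 'a, ('a, 'l) lie_rinehart,
      (('k, 'a, 'l) env, 'm) rmodule, (('k, 'a, 'l) env, 'n) module] \<Rightarrow> ('m, 'n) tensor ring"
  where "lr_tensor_group k A \<phi> L M N =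
    tensor_group A (restrict_right (env_A k A \<phi> L) M) (restrict_left (env_A k A \<phi> L) N)"

definition lr_tensor_elem ::
    "['k ring, 'a ring, 'k \<Rightarrow> 'a, ('a, 'l) lie_rinehart,
      (('k, 'a, 'l) env, 'm) rmodule, (('k, 'a, 'l) env, 'n) module, 'm, 'n] \<Rightarrow> ('m, 'n) tensor"
  where "lr_tensor_elem k A \<phi> L M N =
    tensor_elem A (restrict_right (env_A k A \<phi> L) M) (restrict_left (env_A k A \<phi> L) N)"

definition lr_tensor ::
    "['k ring, 'a ring, 'k \<Rightarrow> 'a, ('a, 'l) lie_rinehart,
      (('k, 'a, 'l) env, 'm) rmodule, (('k, 'a, 'l) env, 'n) module] \<Rightarrow>
      (('k, 'a, 'l) env, ('m, 'n) tensor) rmodule"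
  where "lr_tensor k A \<phi> L M N =
    (let T = lr_tensor_group k A \<phi> L M N; t = lr_tensor_elem k A \<phi> L M N;
         i = env_A k A \<phi> L; j = env_L k A \<phi> L
     in right_mod T
       (SOME act. right_module (env k A \<phi> L) (right_mod T act) \<and>
         (\<forall>m\<in>carrier M. \<forall>n\<in>carrier N.
           (\<forall>a\<in>carrier A. act (t m n) (i a) = t (m \<bullet>\<^bsub>M\<^esub> i a) n) \<and>
           (\<forall>x\<in>carrier L. act (t m n) (j x) =
              t (m \<bullet>\<^bsub>M\<^esub> j x) n \<ominus>\<^bsub>T\<^esub> t m (j x \<odot>\<^bsub>N\<^esub> n)))))"

end

theory Submission
  imports Defs
begin

text \<open>
  For right \<open>U\<close>-modules \<open>M\<close> and \<open>S\<close>, the group \<open>Hom\<^sub>A(M, S)\<close> of right \<open>A\<close>-linear maps is a left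
  \<open>U\<close>-module via \<open>(a g)(m) = g(m a)\<close> and \<open>(x g)(m) = g(m x) - g(m) x\<close>. With
  \<open>S = (M \<otimes>\<^sub>A N) \<otimes>\<^bsub>U\<^sub>0\<^esub> U\<close>, the map \<open>n \<mapsto> (m \<mapsto> (m \<otimes> n) \<otimes> 1)\<close> from \<open>N\<close> to \<open>Hom\<^sub>A(M, S)\<close> is
  \<open>U\<^sub>0\<close>-linear, so it extends to a \<open>U\<close>-linear map on \<open>U \<otimes>\<^bsub>U\<^sub>0\<^esub> N\<close>, which in turn induces a
  \<open>U\<close>-linear map \<open>\<mu>\<close> from \<open>M \<otimes>\<^sub>A (U \<otimes>\<^bsub>U\<^sub>0\<^esub> N)\<close> to \<open>S\<close>. It is inverse to \<open>\<lambda>\<close>: the composite on \<open>S\<close>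
  is checked on the generators \<open>(m \<otimes> n) \<otimes> 1\<close>, the other one on \<open>m \<otimes> (u \<otimes> n)\<close> by induction on
  \<open>u\<close> along the generators of \<open>U\<close>.

  The module structures come from the universal property of \<open>U\<close>, applied to the endomorphism ring
  of an abelian group or, for right modules, to its opposite ring.
\<close>

section \<open>Additive maps and rings of endomorphisms\<close>

text \<open>The values of the inverse of \<lambda> are forced: solving (m \<otimes> y) x = mx
  \<otimes> y - m \<otimes> xy for the last term shows that m \<otimes> (x \<otimes> n) must go to
  (mx \<otimes> n) \<otimes> 1 - ((m \<otimes> n) \<otimes> 1) x. Iterating this along a product of
  generators gives a value for every u, but one that may depend on how u is written. Read as an
  operator on functions of m, a single step is the action of x on Hom, so independence of the
  expression becomes the statement that these operators satisfy the relations of U.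

  A second constraint is that the map from U0 to U and the right actions on the tensor products over
  A are given by a choice operator. Beyond the ring and module laws, only their values on generators
  are known. Existence therefore has to be proved first, and linearity claims about these actions
  are reduced to generators by induction over U.\<close>

definition add_hom :: "[('a, 'b) ring_scheme, ('c, 'd) ring_scheme] \<Rightarrow> ('a \<Rightarrow> 'c) set"
  where "add_hom G H = {f \<in> carrier G \<rightarrow> carrier H.
    \<forall>x\<in>carrier G. \<forall>y\<in>carrier G. f (x \<oplus>\<^bsub>G\<^esub> y) = f x \<oplus>\<^bsub>H\<^esub> f y}"

lemma add_homI:
  assumes "\<And>x. x \<in> carrier G \<Longrightarrow> f x \<in> carrier H"
    and "\<And>x y. \<lbrakk>x \<in> carrier G; y \<in> carrier G\<rbrakk> \<Longrightarrow> f (x \<oplus>\<^bsub>G\<^esub> y) = f x \<oplus>\<^bsub>H\<^esub> f y"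
  shows "f \<in> add_hom G H"
  using assms by (auto simp: add_hom_def)

lemma add_hom_closed: "\<lbrakk>f \<in> add_hom G H; x \<in> carrier G\<rbrakk> \<Longrightarrow> f x \<in> carrier H"
  by (auto simp: add_hom_def)

lemma add_hom_add:
  "\<lbrakk>f \<in> add_hom G H; x \<in> carrier G; y \<in> carrier G\<rbrakk> \<Longrightarrow> f (x \<oplus>\<^bsub>G\<^esub> y) = f x \<oplus>\<^bsub>H\<^esub> f y"
  by (auto simp: add_hom_def)

lemma add_hom_zero:
  assumes "abelian_group G" "abelian_group H" "f \<in> add_hom G H"
  shows "f \<zero>\<^bsub>G\<^esub> = \<zero>\<^bsub>H\<^esub>"
proof -
  interpret G: abelian_group G by fact
  interpret H: abelian_group H by fact
  show ?thesis
    using add_hom_add[OF assms(3), of "\<zero>\<^bsub>G\<^esub>" "\<zero>\<^bsub>G\<^esub>"]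
      add_hom_closed[OF assms(3) G.zero_closed] by simp
qed

lemma add_hom_minus:
  assumes "abelian_group G" "abelian_group H" "f \<in> add_hom G H" "x \<in> carrier G"
  shows "f (\<ominus>\<^bsub>G\<^esub> x) = \<ominus>\<^bsub>H\<^esub> f x"
proof -
  interpret G: abelian_group G by fact
  interpret H: abelian_group H by fact
  have "f (\<ominus>\<^bsub>G\<^esub> x) \<oplus>\<^bsub>H\<^esub> f x = \<zero>\<^bsub>H\<^esub>"
    using add_hom_add[OF assms(3), of "\<ominus>\<^bsub>G\<^esub> x" x] add_hom_zero[OF assms(1-3)] assms(4)
    by (simp add: G.l_neg)
  then show ?thesis
    using add_hom_closed[OF assms(3)] assms(4) by (metis G.a_inv_closed H.minus_equality)
qed

lemma add_hom_diff:
  assumes "abelian_group G" "abelian_group H" "f \<in> add_hom G H" "x \<in> carrier G" "y \<in> carrier G"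
  shows "f (x \<ominus>\<^bsub>G\<^esub> y) = f x \<ominus>\<^bsub>H\<^esub> f y"
  using assms add_hom_minus[OF assms(1-3,5)] add_hom_add[OF assms(3)]
  by (simp add: a_minus_def abelian_group.a_inv_closed)

lemma ring_hom_add_hom: "h \<in> ring_hom R S \<Longrightarrow> h \<in> add_hom R S"
  by (auto simp: add_hom_def ring_hom_def)

lemma abelian_group_inverseI:
  fixes G (structure)
  assumes "\<And>x y. \<lbrakk>x \<in> carrier G; y \<in> carrier G\<rbrakk> \<Longrightarrow> x \<oplus> y \<in> carrier G"
    and "\<zero> \<in> carrier G"
    and "\<And>x y z. \<lbrakk>x \<in> carrier G; y \<in> carrier G; z \<in> carrier G\<rbrakk> \<Longrightarrow> (x \<oplus> y) \<oplus> z = x \<oplus> (y \<oplus> z)"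
    and "\<And>x y. \<lbrakk>x \<in> carrier G; y \<in> carrier G\<rbrakk> \<Longrightarrow> x \<oplus> y = y \<oplus> x"
    and "\<And>x. x \<in> carrier G \<Longrightarrow> \<zero> \<oplus> x = x"
    and "\<And>x. x \<in> carrier G \<Longrightarrow> m x \<in> carrier G"
    and "\<And>x. x \<in> carrier G \<Longrightarrow> m x \<oplus> x = \<zero>"
  shows "abelian_group G"
  by (rule abelian_groupI) (use assms in \<open>auto intro!: bexI[of _ "m _"]\<close>)

lemma abelian_group_cong:
  assumes "abelian_group G" "carrier H = carrier G" "add H = add G" "\<zero>\<^bsub>H\<^esub> = \<zero>\<^bsub>G\<^esub>"
  shows "abelian_group H"
  by (rule abelian_groupI) (use abelian_groupE[OF assms(1)] in \<open>simp_all add: assms(2-)\<close>)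

text \<open>Elements are extensional and every operation restricts to \<open>carrier G\<close>,
  because HOL functions also have values outside the carrier and the ring laws are equations between
  functions.\<close>

definition end_ring :: "('g, 'b) ring_scheme \<Rightarrow> ('g \<Rightarrow> 'g) ring"
  where "end_ring G =
    \<lparr>carrier = add_hom G G \<inter> extensional (carrier G),
     mult = (\<lambda>f g. \<lambda>x\<in>carrier G. f (g x)),
     one = (\<lambda>x\<in>carrier G. x),
     ring.zero = (\<lambda>x\<in>carrier G. \<zero>\<^bsub>G\<^esub>),
     add = (\<lambda>f g. \<lambda>x\<in>carrier G. f x \<oplus>\<^bsub>G\<^esub> g x)\<rparr>"

lemma end_ring_closed:
  assumes "f \<in> carrier (end_ring G)"
  shows "f \<in> add_hom G G" "x \<in> carrier G \<Longrightarrow> f x \<in> carrier G"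
    "\<lbrakk>x \<in> carrier G; y \<in> carrier G\<rbrakk> \<Longrightarrow> f (x \<oplus>\<^bsub>G\<^esub> y) = f x \<oplus>\<^bsub>G\<^esub> f y"
  using assms by (auto simp: end_ring_def add_hom_def)

lemma end_ring_eqI:
  assumes "f \<in> carrier (end_ring G)" "g \<in> carrier (end_ring G)"
    and "\<And>x. x \<in> carrier G \<Longrightarrow> f x = g x"
  shows "f = g"
  using assms by (auto simp: end_ring_def intro: extensionalityI)

lemma end_ring_apply:
  assumes "x \<in> carrier G"
  shows "(f \<otimes>\<^bsub>end_ring G\<^esub> g) x = f (g x)" "(f \<oplus>\<^bsub>end_ring G\<^esub> g) x = f x \<oplus>\<^bsub>G\<^esub> g x"
    "\<one>\<^bsub>end_ring G\<^esub> x = x" "\<zero>\<^bsub>end_ring G\<^esub> x = \<zero>\<^bsub>G\<^esub>"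
  using assms by (simp_all add: end_ring_def)

lemma restrict_end_ring:
  assumes "abelian_group G" "f \<in> add_hom G G"
  shows "restrict f (carrier G) \<in> carrier (end_ring G)"
  using abelian_groupE(1)[OF assms(1)] assms(2) by (auto simp: end_ring_def add_hom_def)

lemma end_ring_ring:
  assumes "abelian_group G"
  shows "ring (end_ring G)"
proof -
  interpret G: abelian_group G by fact
  note [simp] = end_ring_closed(2,3) end_ring_apply
  have c [simp]: "f \<otimes>\<^bsub>end_ring G\<^esub> g \<in> carrier (end_ring G)" "f \<oplus>\<^bsub>end_ring G\<^esub> g \<in> carrier (end_ring G)"
    if "f \<in> carrier (end_ring G)" "g \<in> carrier (end_ring G)" for f g
    using restrict_end_ring[OF assms, of "\<lambda>x. f (g x)"]
      restrict_end_ring[OF assms, of "\<lambda>x. f x \<oplus>\<^bsub>G\<^esub> g x"] that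
    by (simp_all add: add_hom_def Pi_iff G.a_ac) (simp_all add: end_ring_def)
  have c0 [simp]: "\<one>\<^bsub>end_ring G\<^esub> \<in> carrier (end_ring G)" "\<zero>\<^bsub>end_ring G\<^esub> \<in> carrier (end_ring G)"
    using restrict_end_ring[OF assms, of "\<lambda>x. x"] restrict_end_ring[OF assms, of "\<lambda>x. \<zero>\<^bsub>G\<^esub>"]
    by (simp_all add: add_hom_def) (simp_all add: end_ring_def)
  have m: "(\<lambda>x\<in>carrier G. \<ominus>\<^bsub>G\<^esub> f x) \<in> carrier (end_ring G)" if "f \<in> carrier (end_ring G)" for f
    by (rule restrict_end_ring[OF assms]) (use that in \<open>simp add: add_hom_def G.minus_add\<close>)
  show ?thesis
  proof (rule ringI)
    show "abelian_group (end_ring G)"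
    proof (rule abelian_group_inverseI[where m = "\<lambda>f. \<lambda>x\<in>carrier G. \<ominus>\<^bsub>G\<^esub> f x"])
      fix f assume "f \<in> carrier (end_ring G)"
      then show "(\<lambda>x\<in>carrier G. \<ominus>\<^bsub>G\<^esub> f x) \<oplus>\<^bsub>end_ring G\<^esub> f = \<zero>\<^bsub>end_ring G\<^esub>"
        by (intro end_ring_eqI[of _ G]) (simp_all add: m G.l_neg)
    qed (simp_all add: m, (rule end_ring_eqI[of _ G]; simp add: G.a_ac)+)
    show "Group.monoid (end_ring G)"
      by (rule monoidI) (simp, simp, (rule end_ring_eqI[of _ G]; simp)+)
  qed (rule end_ring_eqI[of _ G]; simp)+
qed

text \<open>A right action satisfies x(rs) = (xr)s, so sending r to the operator of acting by r
  reverses products: it is a ring homomorphism into the opposite of the endomorphism ring.\<close>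

definition opp_ring :: "('r, 'b) ring_scheme \<Rightarrow> 'r ring"
  where "opp_ring R =
    \<lparr>carrier = carrier R, mult = (\<lambda>x y. y \<otimes>\<^bsub>R\<^esub> x), one = \<one>\<^bsub>R\<^esub>,
     ring.zero = \<zero>\<^bsub>R\<^esub>, add = add R\<rparr>"

lemma opp_ring_sel [simp]:
  "carrier (opp_ring R) = carrier R" "x \<otimes>\<^bsub>opp_ring R\<^esub> y = y \<otimes>\<^bsub>R\<^esub> x" "\<one>\<^bsub>opp_ring R\<^esub> = \<one>\<^bsub>R\<^esub>"
  "\<zero>\<^bsub>opp_ring R\<^esub> = \<zero>\<^bsub>R\<^esub>" "x \<oplus>\<^bsub>opp_ring R\<^esub> y = x \<oplus>\<^bsub>R\<^esub> y"
  by (simp_all add: opp_ring_def)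

lemma opp_ring_ring:
  assumes "ring R"
  shows "ring (opp_ring R)"
proof -
  interpret R: ring R by fact
  show ?thesis
  proof (rule ringI)
    show "abelian_group (opp_ring R)"
      by (rule abelian_group_cong[OF R.is_abelian_group]) (simp_all add: opp_ring_def)
    show "Group.monoid (opp_ring R)"
      by (rule monoidI) (auto simp: opp_ring_def R.m_assoc)
  qed (auto simp: opp_ring_def R.l_distr R.r_distr)
qed

section \<open>Module records and restriction of scalars\<close>

lemma left_mod_sel [simp]:
  "carrier (left_mod G act) = carrier G" "add (left_mod G act) = add G"
  "\<zero>\<^bsub>left_mod G act\<^esub> = \<zero>\<^bsub>G\<^esub>" "r \<odot>\<^bsub>left_mod G act\<^esub> x = act r x"
  by (auto simp: left_mod_def)

lemma right_mod_sel [simp]: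
  "carrier (right_mod G act) = carrier G" "add (right_mod G act) = add G"
  "\<zero>\<^bsub>right_mod G act\<^esub> = \<zero>\<^bsub>G\<^esub>" "x \<bullet>\<^bsub>right_mod G act\<^esub> r = act x r"
  by (auto simp: right_mod_def)

lemma abelian_group_mod [simp]:
  "abelian_group (left_mod G act) \<longleftrightarrow> abelian_group G"
  "abelian_group (right_mod G act') \<longleftrightarrow> abelian_group G"
  by (auto intro: abelian_group_cong)

lemma add_hom_mod [simp]:
  "add_hom (left_mod G act) H = add_hom G H" "add_hom H (left_mod G act) = add_hom H G"
  "add_hom (right_mod G act') H = add_hom G H" "add_hom H (right_mod G act') = add_hom H G"
  by (simp_all add: add_hom_def)

lemma left_module_of_end_hom:
  assumes "ring R" "abelian_group G" "h \<in> ring_hom R (end_ring G)"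
  shows "left_module R (left_mod G (\<lambda>r x. h r x))"
proof -
  interpret R: ring R by fact
  have h: "h r \<in> add_hom G G" if "r \<in> carrier R" for r
    using ring_hom_closed[OF assms(3) that] by (simp add: end_ring_def)
  show ?thesis
    unfolding left_module_def left_module_axioms_def
    using assms(1,2) ring_hom_add[OF assms(3)] ring_hom_mult[OF assms(3)] ring_hom_one[OF assms(3)]
    by (auto simp: add_hom_closed[OF h] add_hom_add[OF h]) (auto simp: end_ring_def)
qed

lemma right_module_of_end_hom:
  assumes "ring R" "abelian_group G" "h \<in> ring_hom R (opp_ring (end_ring G))"
  shows "right_module R (right_mod G (\<lambda>x r. h r x))"
proof -
  interpret R: ring R by fact
  have h: "h r \<in> add_hom G G" if "r \<in> carrier R" for r
    using ring_hom_closed[OF assms(3) that] by (simp add: end_ring_def opp_ring_def)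
  show ?thesis
    unfolding right_module_def right_module_axioms_def
    using assms(1,2) ring_hom_add[OF assms(3)] ring_hom_mult[OF assms(3)] ring_hom_one[OF assms(3)]
    by (auto simp: add_hom_closed[OF h] add_hom_add[OF h]) (auto simp: end_ring_def opp_ring_def)
qed

lemma restrict_right_sel [simp]:
  "carrier (restrict_right h M) = carrier M" "add (restrict_right h M) = add M"
  "x \<bullet>\<^bsub>restrict_right h M\<^esub> r = x \<bullet>\<^bsub>M\<^esub> h r"
  "add_hom (restrict_right h M) G = add_hom M G" "add_hom G' (restrict_right h M) = add_hom G' M"
  by (simp_all add: restrict_right_def)

lemma restrict_left_sel [simp]:
  "carrier (restrict_left h N) = carrier N" "add (restrict_left h N) = add N"
  "r \<odot>\<^bsub>restrict_left h N\<^esub> x = h r \<odot>\<^bsub>N\<^esub> x"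
  "add_hom (restrict_left h N) G = add_hom N G" "add_hom G' (restrict_left h N) = add_hom G' N"
  by (simp_all add: restrict_left_def)

lemma restrict_right_module:
  assumes "ring R" "right_module S M" "h \<in> ring_hom R S"
  shows "right_module R (restrict_right h M)"
proof -
  interpret R: ring R by fact
  interpret M: right_module S M by fact
  note h = ring_hom_closed[OF assms(3)] ring_hom_add[OF assms(3)] ring_hom_mult[OF assms(3)]
    ring_hom_one[OF assms(3)]
  show ?thesis
    unfolding right_module_def right_module_axioms_def restrict_right_def
    by (simp add: R.ring_axioms M.abelian_group_axioms h M.rsmult_closed M.rsmult_add_right
        M.rsmult_add_left M.rsmult_assoc M.rsmult_one)
qed

lemma restrict_left_module:
  assumes "ring R" "left_module S M" "h \<in> ring_hom R S"
  shows "left_module R (restrict_left h M)"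
proof -
  interpret R: ring R by fact
  interpret M: left_module S M by fact
  note h = ring_hom_closed[OF assms(3)] ring_hom_add[OF assms(3)] ring_hom_mult[OF assms(3)]
    ring_hom_one[OF assms(3)]
  show ?thesis
    unfolding left_module_def left_module_axioms_def restrict_left_def
    by (simp add: R.ring_axioms M.abelian_group_axioms h M.lsmult_closed M.lsmult_add_right
        M.lsmult_add_left M.lsmult_assoc M.lsmult_one)
qed

lemma (in right_module) act_add_hom: "r \<in> carrier R \<Longrightarrow> (\<lambda>x. x \<bullet>\<^bsub>M\<^esub> r) \<in> add_hom M M"
  by (rule add_homI) (simp_all add: rsmult_closed rsmult_add_left)

lemma (in left_module) act_add_hom: "r \<in> carrier R \<Longrightarrow> (\<lambda>x. r \<odot>\<^bsub>M\<^esub> x) \<in> add_hom M M"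
  by (rule add_homI) (simp_all add: lsmult_closed lsmult_add_right)

section \<open>Quotient rings\<close>

lemma quotient_hom:
  assumes "ring R" "ring S" "ideal I R" "h \<in> ring_hom R S" "\<And>x. x \<in> I \<Longrightarrow> h x = \<zero>\<^bsub>S\<^esub>"
  shows "\<exists>g \<in> ring_hom (R Quot I) S. \<forall>x\<in>carrier R. g (I +>\<^bsub>R\<^esub> x) = h x"
proof -
  interpret R: ring R by fact
  interpret S: ring S by fact
  interpret I: ideal I R by fact
  interpret h: ring_hom_ring R S h
    by (rule ring_hom_ringI2) (use assms in auto)
  \<comment> \<open>Any representative gives the same value: two of them differ by an element of
    \<open>I\<close>, which \<open>h\<close> kills.\<close>
  define g where "g X = h (SOME x. x \<in> X)" for X
  have g: "g (I +>\<^bsub>R\<^esub> x) = h x" if "x \<in> carrier R" for x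
  proof -
    have "x \<in> I +>\<^bsub>R\<^esub> x" using that by (rule I.a_rcos_self)
    then have "(SOME y. y \<in> I +>\<^bsub>R\<^esub> x) \<in> I +>\<^bsub>R\<^esub> x" by (rule someI)
    then obtain i where "i \<in> I" "(SOME y. y \<in> I +>\<^bsub>R\<^esub> x) = i \<oplus>\<^bsub>R\<^esub> x"
      by (auto simp: a_r_coset_def')
    then show ?thesis
      using that assms(5) by (simp add: g_def I.a_Hcarr)
  qed
  have "g \<in> ring_hom (R Quot I) S"
  proof (rule ring_hom_memI)
    fix X assume "X \<in> carrier (R Quot I)"
    then obtain x where x: "x \<in> carrier R" "X = I +>\<^bsub>R\<^esub> x" by (auto simp: FactRing_simps)
    then show "g X \<in> carrier S" by (simp add: g)
    fix Y assume "Y \<in> carrier (R Quot I)"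
    then obtain y where y: "y \<in> carrier R" "Y = I +>\<^bsub>R\<^esub> y" by (auto simp: FactRing_simps)
    show "g (X \<otimes>\<^bsub>R Quot I\<^esub> Y) = g X \<otimes>\<^bsub>S\<^esub> g Y"
      using x y by (simp add: FactRing_def I.rcoset_mult_add g)
    show "g (X \<oplus>\<^bsub>R Quot I\<^esub> Y) = g X \<oplus>\<^bsub>S\<^esub> g Y"
      using x y by (simp add: FactRing_def I.a_rcos_sum g)
  next
    show "g \<one>\<^bsub>R Quot I\<^esub> = \<one>\<^bsub>S\<^esub>"
      by (simp add: FactRing_def g)
  qed
  with g show ?thesis by blast
qed

text \<open>The kernel of \<open>h\<close> is an ideal, so it contains the ideal generated by any
  subset of it. This reduces both quotients in the construction of the enveloping algebra to a check
  on generators.\<close>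

lemma genideal_vanish:
  assumes "ring R" "ring S" "h \<in> ring_hom R S" "G \<subseteq> carrier R" "\<And>x. x \<in> G \<Longrightarrow> h x = \<zero>\<^bsub>S\<^esub>"
    and "x \<in> Idl\<^bsub>R\<^esub> G"
  shows "h x = \<zero>\<^bsub>S\<^esub>"
proof -
  interpret h: ring_hom_ring R S h
    using assms(1-3) by (rule ring_hom_ringI2)
  have "G \<subseteq> a_kernel R S h"
    unfolding a_kernel_def' using assms(4,5) by blast
  then have "Idl\<^bsub>R\<^esub> G \<subseteq> a_kernel R S h"
    by (rule h.R.genideal_minimal[OF h.kernel_is_ideal])
  then show ?thesis
    using assms(6) unfolding a_kernel_def' by blast
qed

section \<open>The free algebra on a set\<close>

lemma free_algebra_sel:
  "x \<in> carrier (free_algebra k V) \<longleftrightarrow>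
     (\<forall>w. x w \<in> carrier k) \<and> finite {w. x w \<noteq> \<zero>\<^bsub>k\<^esub>} \<and> {w. x w \<noteq> \<zero>\<^bsub>k\<^esub>} \<subseteq> lists V"
  "(x \<oplus>\<^bsub>free_algebra k V\<^esub> y) w = x w \<oplus>\<^bsub>k\<^esub> y w"
  "\<zero>\<^bsub>free_algebra k V\<^esub> w = \<zero>\<^bsub>k\<^esub>"
  "(x \<otimes>\<^bsub>free_algebra k V\<^esub> y) w = (\<Oplus>\<^bsub>k\<^esub>i\<in>{..length w}. x (take i w) \<otimes>\<^bsub>k\<^esub> y (drop i w))"
  by (simp_all add: free_algebra_def)

lemma free_algebra_one: "\<one>\<^bsub>free_algebra k V\<^esub> = monomial k \<one>\<^bsub>k\<^esub> []"
  by (simp add: free_algebra_def monomial_def fun_eq_iff)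

locale free_alg = cring k for k :: "'k ring" (structure) +
  fixes V :: "'v set"
begin

abbreviation "F \<equiv> free_algebra k V"
abbreviation "mnm \<equiv> monomial k"

lemma F_coeff [simp]: "x \<in> carrier F \<Longrightarrow> x w \<in> carrier k"
  by (simp add: free_algebra_sel)

lemma F_outside: "\<lbrakk>x \<in> carrier F; w \<notin> lists V\<rbrakk> \<Longrightarrow> x w = \<zero>"
  by (auto simp: free_algebra_sel)

lemma F_support_mono:
  assumes "\<And>w. x w \<in> carrier k" "{w. x w \<noteq> \<zero>} \<subseteq> S" "finite S" "S \<subseteq> lists V"
  shows "x \<in> carrier F"
  using assms by (auto simp: free_algebra_sel intro: finite_subset)

lemma F_support:
  assumes "x \<in> carrier F"
  shows "finite {w. x w \<noteq> \<zero>}" "{w. x w \<noteq> \<zero>} \<subseteq> lists V"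
  using assms by (simp_all add: free_algebra_sel)

lemma mnm_closed [simp]: "\<lbrakk>c \<in> carrier k; w \<in> lists V\<rbrakk> \<Longrightarrow> mnm c w \<in> carrier F"
  by (rule F_support_mono[of _ "{w}"]) (auto simp: monomial_def)

lemma F_add_closed:
  assumes "x \<in> carrier F" "y \<in> carrier F"
  shows "x \<oplus>\<^bsub>F\<^esub> y \<in> carrier F"
proof (rule F_support_mono)
  show "{w. (x \<oplus>\<^bsub>F\<^esub> y) w \<noteq> \<zero>} \<subseteq> {w. x w \<noteq> \<zero>} \<union> {w. y w \<noteq> \<zero>}"
    by (auto simp: free_algebra_sel(2))
qed (use assms F_support[OF assms(1)] F_support[OF assms(2)] in \<open>auto simp: free_algebra_sel(2)\<close>)

lemma F_mult_closed:
  assumes "x \<in> carrier F" "y \<in> carrier F"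
  shows "x \<otimes>\<^bsub>F\<^esub> y \<in> carrier F"
proof (rule F_support_mono)
  let ?S = "(\<lambda>(u, v). u @ v) ` ({w. x w \<noteq> \<zero>} \<times> {w. y w \<noteq> \<zero>})"
  show "(x \<otimes>\<^bsub>F\<^esub> y) w \<in> carrier k" for w
    using assms by (auto simp: free_algebra_sel(4) intro!: finsum_closed)
  show "{w. (x \<otimes>\<^bsub>F\<^esub> y) w \<noteq> \<zero>} \<subseteq> ?S"
  proof clarify
    fix w assume nz: "(x \<otimes>\<^bsub>F\<^esub> y) w \<noteq> \<zero>"
    \<comment> \<open>The coefficient of the product at \<open>w\<close> is a sum over the cuts of
      \<open>w\<close>; if it is nonzero, some cut has both halves in the respective
      supports.\<close>
    have "\<exists>i. x (take i w) \<noteq> \<zero> \<and> y (drop i w) \<noteq> \<zero>"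
    proof (rule ccontr)
      assume "\<not> ?thesis"
      then have "(x \<otimes>\<^bsub>F\<^esub> y) w = \<zero>"
        unfolding free_algebra_sel(4)
        by (intro add.finprod_one_eqI) (use assms in \<open>metis F_coeff l_null r_null\<close>)
      with nz show False ..
    qed
    then obtain i where "x (take i w) \<noteq> \<zero>" "y (drop i w) \<noteq> \<zero>" by blast
    then show "w \<in> ?S"
      by (auto intro!: image_eqI[of _ _ "(take i w, drop i w)"])
  qed
qed (use F_support[OF assms(1)] F_support[OF assms(2)] in \<open>auto simp: lists_eq_set subset_iff\<close>)

lemma F_abelian_group: "abelian_group F"
proof (rule abelian_group_inverseI[where m = "\<lambda>x w. \<ominus> x w"])
  fix x assume x: "x \<in> carrier F"
  show "(\<lambda>w. \<ominus> x w) \<in> carrier F"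
    by (rule F_support_mono[OF _ _ F_support[OF x]]) (use x in auto)
qed (auto simp: F_add_closed fun_eq_iff free_algebra_sel(2,3) a_ac r_neg
       intro!: F_support_mono[of _ "{}"])

lemma F_l_distr:
  assumes "x \<in> carrier F" "y \<in> carrier F" "z \<in> carrier F"
  shows "(x \<oplus>\<^bsub>F\<^esub> y) \<otimes>\<^bsub>F\<^esub> z = x \<otimes>\<^bsub>F\<^esub> z \<oplus>\<^bsub>F\<^esub> y \<otimes>\<^bsub>F\<^esub> z"
proof
  fix w
  show "((x \<oplus>\<^bsub>F\<^esub> y) \<otimes>\<^bsub>F\<^esub> z) w = (x \<otimes>\<^bsub>F\<^esub> z \<oplus>\<^bsub>F\<^esub> y \<otimes>\<^bsub>F\<^esub> z) w"
    using assms
    by (simp add: free_algebra_sel(2,4) l_distr Pi_def finsum_addf[symmetric] del: finsum_addf)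
qed

lemma F_r_distr:
  assumes "x \<in> carrier F" "y \<in> carrier F" "z \<in> carrier F"
  shows "z \<otimes>\<^bsub>F\<^esub> (x \<oplus>\<^bsub>F\<^esub> y) = z \<otimes>\<^bsub>F\<^esub> x \<oplus>\<^bsub>F\<^esub> z \<otimes>\<^bsub>F\<^esub> y"
proof
  fix w
  show "(z \<otimes>\<^bsub>F\<^esub> (x \<oplus>\<^bsub>F\<^esub> y)) w = (z \<otimes>\<^bsub>F\<^esub> x \<oplus>\<^bsub>F\<^esub> z \<otimes>\<^bsub>F\<^esub> y) w"
    using assms
    by (simp add: free_algebra_sel(2,4) r_distr Pi_def finsum_addf[symmetric] del: finsum_addf)
qed

text \<open>In the convolution sum at \<open>w\<close> only the cut after \<open>length u\<close>
  letters can contribute, and it occurs among the indices exactly when \<open>u\<close> is no longer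
  than \<open>w\<close>.\<close>

lemma mon_mult:
  assumes "c \<in> carrier k" "d \<in> carrier k"
  shows "mnm c u \<otimes>\<^bsub>F\<^esub> mnm d v = mnm (c \<otimes> d) (u @ v)"
proof
  fix w
  have "(mnm c u \<otimes>\<^bsub>F\<^esub> mnm d v) w =
      (\<Oplus>i\<in>{..length w}. if length u = i then mnm (c \<otimes> d) (u @ v) w else \<zero>)"
    unfolding free_algebra_sel(4)
    by (rule finsum_cong') (use assms in \<open>auto simp: monomial_def\<close>)
  also have "\<dots> = mnm (c \<otimes> d) (u @ v) w"
  proof (cases "length u \<le> length w")
    case True
    then show ?thesis
      using add.finprod_singleton[of "length u" "{..length w}" "\<lambda>_. mnm (c \<otimes> d) (u @ v) w"] assms
      by (simp add: monomial_def)
  next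
    case False
    then have "mnm (c \<otimes> d) (u @ v) w = \<zero>" by (auto simp: monomial_def)
    then show ?thesis by (simp cong: if_cong)
  qed
  finally show "(mnm c u \<otimes>\<^bsub>F\<^esub> mnm d v) w = mnm (c \<otimes> d) (u @ v) w" .
qed

text \<open>Reduces additive identities to monomials. The induction runs over a finite set
  \<open>S\<close> bounding the support and clears the coefficient of one word at a time.\<close>

lemma F_induct [consumes 1, case_names zero mnm add]:
  assumes "x \<in> carrier F"
    and zero: "P \<zero>\<^bsub>F\<^esub>"
    and mnm: "\<And>c w. \<lbrakk>c \<in> carrier k; w \<in> lists V\<rbrakk> \<Longrightarrow> P (mnm c w)"
    and add: "\<And>x y. \<lbrakk>x \<in> carrier F; y \<in> carrier F; P x; P y\<rbrakk> \<Longrightarrow> P (x \<oplus>\<^bsub>F\<^esub> y)"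
  shows "P x"
proof -
  have "P x" if "finite S" "x \<in> carrier F" "{w. x w \<noteq> \<zero>} \<subseteq> S" for S x
    using that
  proof (induction S arbitrary: x)
    case empty
    then have "x = \<zero>\<^bsub>F\<^esub>" by (auto simp: free_algebra_sel(3) fun_eq_iff)
    with zero show ?case by simp
  next
    case (insert u S)
    define y where "y = x(u := \<zero>)"
    have y: "y \<in> carrier F" "{w. y w \<noteq> \<zero>} \<subseteq> S"
      using insert.prems
      by (auto simp: y_def split: if_splits intro!: F_support_mono[OF _ _ F_support[OF insert.prems(1)]])
    have x: "x = y \<oplus>\<^bsub>F\<^esub> mnm (x u) u"
      using insert.prems(1) by (auto simp: fun_eq_iff y_def monomial_def free_algebra_sel(2))
    show ?case
    proof (cases "u \<in> lists V")
      case True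
      then show ?thesis
        by (subst x) (use insert y in \<open>simp add: add mnm\<close>)
    next
      \<comment> \<open>\<open>S\<close> only bounds the support and may contain lists that are not
        words over \<open>V\<close>; at such a list the coefficient is already zero.\<close>
      case False
      then have "x = y" using F_outside[OF insert.prems(1) False] by (simp add: y_def fun_upd_idem)
      then show ?thesis using insert.IH[OF y] by simp
    qed
  qed
  then show ?thesis using assms(1) F_support[OF assms(1)] by blast
qed

lemma F_null:
  assumes "x \<in> carrier F"
  shows "\<zero>\<^bsub>F\<^esub> \<otimes>\<^bsub>F\<^esub> x = \<zero>\<^bsub>F\<^esub>" "x \<otimes>\<^bsub>F\<^esub> \<zero>\<^bsub>F\<^esub> = \<zero>\<^bsub>F\<^esub>"
  using assms by (simp_all add: fun_eq_iff free_algebra_sel(3,4))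

text \<open>Both sides are additive in each argument, so three nested inductions leave only
  monomials, where associativity in \<open>k\<close> and of concatenation is enough. Double
  convolution sums never have to be rearranged.\<close>

lemma F_assoc:
  assumes "x \<in> carrier F" "y \<in> carrier F" "z \<in> carrier F"
  shows "(x \<otimes>\<^bsub>F\<^esub> y) \<otimes>\<^bsub>F\<^esub> z = x \<otimes>\<^bsub>F\<^esub> (y \<otimes>\<^bsub>F\<^esub> z)"
  using assms(1)
proof (induction rule: F_induct)
  case (mnm c u)
  note u = mnm
  show ?case using assms(2)
  proof (induction rule: F_induct)
    case (mnm d v)
    note v = mnm
    show ?case using assms(3)
      by (induction rule: F_induct)
        (use u v in \<open>simp_all add: F_null F_mult_closed F_r_distr mon_mult m_assoc\<close>)
  qed (use u assms in \<open>simp_all add: F_null F_mult_closed F_r_distr F_l_distr\<close>)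
qed (use assms in \<open>simp_all add: F_null F_mult_closed F_l_distr\<close>)

lemma F_ring: "ring F"
proof (rule ringI)
  show "Group.monoid F"
  proof (rule monoidI)
    fix x assume "x \<in> carrier F"
    then show "\<one>\<^bsub>F\<^esub> \<otimes>\<^bsub>F\<^esub> x = x" "x \<otimes>\<^bsub>F\<^esub> \<one>\<^bsub>F\<^esub> = x"
      by (induction rule: F_induct)
        (simp_all add: free_algebra_one F_null F_mult_closed F_r_distr F_l_distr mon_mult)
  qed (simp_all add: F_mult_closed F_assoc, simp add: free_algebra_one)
qed (simp_all add: F_abelian_group F_l_distr F_r_distr)

end

text \<open>The condition \<open>central\<close> makes the extension multiplicative: in a product of
  two monomials the second coefficient has to pass the letters of the first word. It is imposed on
  letters and carried over to words by \<open>ev_central\<close>.\<close>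

locale free_alg_hom = free_alg k V + R: ring R
  for k :: "'k ring" (structure) and V :: "'v set" and R :: "('r, 'b) ring_scheme" (structure) +
  fixes \<kappa> :: "'k \<Rightarrow> 'r" and \<gamma> :: "'v \<Rightarrow> 'r"
  assumes \<kappa>: "\<kappa> \<in> ring_hom k R"
    and \<gamma>: "\<And>v. v \<in> V \<Longrightarrow> \<gamma> v \<in> carrier R"
    and central: "\<And>c v. \<lbrakk>c \<in> carrier k; v \<in> V\<rbrakk> \<Longrightarrow> \<kappa> c \<otimes>\<^bsub>R\<^esub> \<gamma> v = \<gamma> v \<otimes>\<^bsub>R\<^esub> \<kappa> c"
begin

definition "ev w = foldr (\<lambda>v r. \<gamma> v \<otimes>\<^bsub>R\<^esub> r) w \<one>\<^bsub>R\<^esub>"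

definition "\<Phi> x = (\<Oplus>\<^bsub>R\<^esub>w\<in>{w. x w \<noteq> \<zero>\<^bsub>k\<^esub>}. \<kappa> (x w) \<otimes>\<^bsub>R\<^esub> ev w)"

lemma ev_closed [simp]: "w \<in> lists V \<Longrightarrow> ev w \<in> carrier R"
  by (induction w) (auto simp: ev_def \<gamma>)

lemma ev_simps: "ev [] = \<one>\<^bsub>R\<^esub>" "ev (v # w) = \<gamma> v \<otimes>\<^bsub>R\<^esub> ev w"
  by (simp_all add: ev_def)

lemma ev_append: "\<lbrakk>u \<in> lists V; v \<in> lists V\<rbrakk> \<Longrightarrow> ev (u @ v) = ev u \<otimes>\<^bsub>R\<^esub> ev v"
  by (induction u) (simp_all add: ev_simps \<gamma> R.m_assoc)

lemma \<kappa>_closed [simp]: "c \<in> carrier k \<Longrightarrow> \<kappa> c \<in> carrier R"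
  using \<kappa> by (rule ring_hom_closed)

lemma \<kappa>_zero [simp]: "\<kappa> \<zero>\<^bsub>k\<^esub> = \<zero>\<^bsub>R\<^esub>"
  by (rule add_hom_zero[OF is_abelian_group R.is_abelian_group ring_hom_add_hom[OF \<kappa>]])

lemma ev_central:
  assumes "c \<in> carrier k" "w \<in> lists V"
  shows "\<kappa> c \<otimes>\<^bsub>R\<^esub> ev w = ev w \<otimes>\<^bsub>R\<^esub> \<kappa> c"
  using assms(2)
proof (induction w)
  case (Cons v w)
  then show ?case
    using assms(1) by (simp add: ev_simps \<gamma> central R.m_assoc flip: R.m_assoc[of "\<kappa> c"])
qed (use assms in \<open>simp add: ev_simps\<close>)

text \<open>The index set may exceed the support, so that two elements can be summed over a common
  set in \<open>\<Phi>_add\<close>.\<close>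

lemma \<Phi>_eq:
  assumes "x \<in> carrier F" "{w. x w \<noteq> \<zero>\<^bsub>k\<^esub>} \<subseteq> S" "finite S" "S \<subseteq> lists V"
  shows "\<Phi> x = (\<Oplus>\<^bsub>R\<^esub>w\<in>S. \<kappa> (x w) \<otimes>\<^bsub>R\<^esub> ev w)"
  unfolding \<Phi>_def
  by (rule R.add.finprod_mono_neutral_cong_left) (use assms in \<open>auto simp: subset_iff\<close>)

lemma \<Phi>_closed: "x \<in> carrier F \<Longrightarrow> \<Phi> x \<in> carrier R"
  unfolding \<Phi>_def by (rule R.finsum_closed) (use F_support(2)[of x] in \<open>auto simp: subset_iff simp del: in_lists_conv_set\<close>)

lemma \<Phi>_add:
  assumes "x \<in> carrier F" "y \<in> carrier F"
  shows "\<Phi> (x \<oplus>\<^bsub>F\<^esub> y) = \<Phi> x \<oplus>\<^bsub>R\<^esub> \<Phi> y"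
proof -
  let ?S = "{w. x w \<noteq> \<zero>\<^bsub>k\<^esub>} \<union> {w. y w \<noteq> \<zero>\<^bsub>k\<^esub>}"
  have S: "finite ?S" "?S \<subseteq> lists V"
    using F_support[OF assms(1)] F_support[OF assms(2)] by auto
  have "\<Phi> (x \<oplus>\<^bsub>F\<^esub> y) = (\<Oplus>\<^bsub>R\<^esub>w\<in>?S. \<kappa> ((x \<oplus>\<^bsub>F\<^esub> y) w) \<otimes>\<^bsub>R\<^esub> ev w)"
    by (rule \<Phi>_eq[OF F_add_closed[OF assms] _ S]) (auto simp: free_algebra_sel(2))
  also have "\<dots> = (\<Oplus>\<^bsub>R\<^esub>w\<in>?S. \<kappa> (x w) \<otimes>\<^bsub>R\<^esub> ev w \<oplus>\<^bsub>R\<^esub> \<kappa> (y w) \<otimes>\<^bsub>R\<^esub> ev w)"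
    by (rule R.finsum_cong')
      (use assms S in \<open>auto simp: free_algebra_sel(2) ring_hom_add[OF \<kappa>] R.l_distr subset_iff\<close>)
  also have "\<dots> = (\<Oplus>\<^bsub>R\<^esub>w\<in>?S. \<kappa> (x w) \<otimes>\<^bsub>R\<^esub> ev w) \<oplus>\<^bsub>R\<^esub> (\<Oplus>\<^bsub>R\<^esub>w\<in>?S. \<kappa> (y w) \<otimes>\<^bsub>R\<^esub> ev w)"
    by (rule R.finsum_addf) (use assms S in \<open>auto simp: subset_iff\<close>)
  also have "\<dots> = \<Phi> x \<oplus>\<^bsub>R\<^esub> \<Phi> y"
    using \<Phi>_eq[OF assms(1) _ S] \<Phi>_eq[OF assms(2) _ S] by simp
  finally show ?thesis .
qed

lemma \<Phi>_mon:
  assumes "c \<in> carrier k" "w \<in> lists V"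
  shows "\<Phi> (mnm c w) = \<kappa> c \<otimes>\<^bsub>R\<^esub> ev w"
proof -
  have "\<Phi> (mnm c w) = (\<Oplus>\<^bsub>R\<^esub>w'\<in>{w}. \<kappa> (mnm c w w') \<otimes>\<^bsub>R\<^esub> ev w')"
    by (rule \<Phi>_eq[OF mnm_closed])
      (use assms in \<open>auto simp: monomial_def simp del: in_lists_conv_set\<close>)
  then show ?thesis
    using assms by (simp add: monomial_def del: in_lists_conv_set)
qed

lemma \<Phi>_hom: "\<Phi> \<in> ring_hom F R"
proof (rule ring_hom_memI)
  show "\<Phi> \<one>\<^bsub>F\<^esub> = \<one>\<^bsub>R\<^esub>"
    by (simp add: free_algebra_one \<Phi>_mon ev_simps ring_hom_one[OF \<kappa>])
  have z: "\<Phi> \<zero>\<^bsub>F\<^esub> = \<zero>\<^bsub>R\<^esub>"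
    using \<Phi>_eq[of "\<zero>\<^bsub>F\<^esub>" "{}"] abelian_groupE(2)[OF F_abelian_group]
    by (simp add: free_algebra_sel(3))
  fix x y assume xy: "x \<in> carrier F" "y \<in> carrier F"
  show "\<Phi> (x \<otimes>\<^bsub>F\<^esub> y) = \<Phi> x \<otimes>\<^bsub>R\<^esub> \<Phi> y"
    using xy(1)
  proof (induction rule: F_induct)
    case (mnm c u)
    note u = mnm
    show ?case using xy(2)
    proof (induction rule: F_induct)
      case (mnm d v)
      have "\<kappa> c \<otimes>\<^bsub>R\<^esub> ev u \<otimes>\<^bsub>R\<^esub> (\<kappa> d \<otimes>\<^bsub>R\<^esub> ev v) = \<kappa> c \<otimes>\<^bsub>R\<^esub> (ev u \<otimes>\<^bsub>R\<^esub> \<kappa> d) \<otimes>\<^bsub>R\<^esub> ev v"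
        using u mnm by (simp add: R.m_assoc)
      also have "\<dots> = \<kappa> c \<otimes>\<^bsub>R\<^esub> \<kappa> d \<otimes>\<^bsub>R\<^esub> (ev u \<otimes>\<^bsub>R\<^esub> ev v)"
        unfolding ev_central[OF mnm(1) u(2), symmetric] using u mnm by (simp add: R.m_assoc)
      finally show ?case
        using u mnm by (simp add: mon_mult \<Phi>_mon ev_append ring_hom_mult[OF \<kappa>])
    qed (use u in \<open>simp_all add: z F_null F_r_distr F_mult_closed \<Phi>_add \<Phi>_closed R.r_distr\<close>)
  qed (use xy in \<open>simp_all add: z F_null F_l_distr F_mult_closed \<Phi>_add \<Phi>_closed R.l_distr\<close>)
qed (simp_all add: \<Phi>_closed \<Phi>_add)

end

section \<open>The enveloping algebra\<close>

text \<open>The pairs of maps \<open>A \<rightarrow> R\<close>, \<open>L \<rightarrow> R\<close> that extend to a ring homomorphism on the enveloping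
  algebra. No relation for the scalars is needed: \<open>\<alpha> \<circ> \<phi>\<close> automatically commutes with \<open>\<beta>\<close>, because
  the derivation attached to an element of \<open>L\<close> kills \<open>\<phi>(k)\<close>.\<close>

definition lr_rep ::
    "['a ring, ('a, 'l) lie_rinehart, ('r, 'b) ring_scheme, 'a \<Rightarrow> 'r, 'l \<Rightarrow> 'r] \<Rightarrow> bool"
  where "lr_rep A L R \<alpha> \<beta> \<longleftrightarrow> \<alpha> \<in> ring_hom A R \<and> \<beta> \<in> add_hom L R \<and>
    (\<forall>x\<in>carrier L. \<forall>a\<in>carrier A. \<beta> x \<otimes>\<^bsub>R\<^esub> \<alpha> a = \<alpha> a \<otimes>\<^bsub>R\<^esub> \<beta> x \<oplus>\<^bsub>R\<^esub> \<alpha> (anchor L x a)) \<and>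
    (\<forall>x\<in>carrier L. \<forall>y\<in>carrier L. \<beta> x \<otimes>\<^bsub>R\<^esub> \<beta> y = \<beta> y \<otimes>\<^bsub>R\<^esub> \<beta> x \<oplus>\<^bsub>R\<^esub> \<beta> (bracket L x y)) \<and>
    (\<forall>a\<in>carrier A. \<forall>x\<in>carrier L. \<beta> (a \<odot>\<^bsub>L\<^esub> x) = \<alpha> a \<otimes>\<^bsub>R\<^esub> \<beta> x)"

text \<open>Defining relations are given in the forms x - y and x - y - z; this turns their
  vanishing into the equations x = y and x = y + z, the form used in \<open>lr_rep\<close>.\<close>

lemma (in abelian_group) minus_minus_eq_zero:
  shows "\<lbrakk>x \<in> carrier G; y \<in> carrier G\<rbrakk> \<Longrightarrow> x \<ominus> y = \<zero> \<longleftrightarrow> x = y"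
    and "\<lbrakk>x \<in> carrier G; y \<in> carrier G; z \<in> carrier G\<rbrakk> \<Longrightarrow> x \<ominus> y \<ominus> z = \<zero> \<longleftrightarrow> x = y \<oplus> z"
proof -
  have *: "x \<ominus> y = \<zero> \<longleftrightarrow> x = y" if "x \<in> carrier G" "y \<in> carrier G" for x y
  proof
    assume "x \<ominus> y = \<zero>"
    then have "x \<ominus> y \<oplus> y = y" using that by simp
    then show "x = y" using that by (simp add: minus_eq a_assoc l_neg)
  qed (use that in \<open>simp add: minus_eq r_neg\<close>)
  then show "\<lbrakk>x \<in> carrier G; y \<in> carrier G\<rbrakk> \<Longrightarrow> x \<ominus> y = \<zero> \<longleftrightarrow> x = y" .
  assume c: "x \<in> carrier G" "y \<in> carrier G" "z \<in> carrier G"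
  then have "x \<ominus> y \<ominus> z = x \<ominus> (y \<oplus> z)" by (simp add: minus_eq minus_add a_assoc)
  then show "x \<ominus> y \<ominus> z = \<zero> \<longleftrightarrow> x = y \<oplus> z" using *[of x "y \<oplus> z"] c by simp
qed

lemma hom_diff:
  assumes "ring R" "ring S" "h \<in> ring_hom R S" "x \<in> carrier R" "y \<in> carrier R"
  shows "h (x \<ominus>\<^bsub>R\<^esub> y) = h x \<ominus>\<^bsub>S\<^esub> h y"
  using assms by (intro add_hom_diff ring_hom_add_hom ring.is_abelian_group) auto

lemma quotient_cosetE:
  assumes "X \<in> carrier (R Quot I)"
  obtains x where "x \<in> carrier R" "X = I +>\<^bsub>R\<^esub> x"
  using assms unfolding FactRing_simps by auto

text \<open>Treats the same two forms on the side of the quotient: a relation lying in the ideal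
  becomes an equation between cosets.\<close>

lemma (in ideal) quotient_eqD:
  shows "\<lbrakk>x \<in> carrier R; y \<in> carrier R; x \<ominus> y \<in> I\<rbrakk> \<Longrightarrow> I +> x = I +> y"
    and "\<lbrakk>x \<in> carrier R; y \<in> carrier R; z \<in> carrier R; x \<ominus> y \<ominus> z \<in> I\<rbrakk> \<Longrightarrow>
      I +> x = (I +> y) \<oplus>\<^bsub>R Quot I\<^esub> (I +> z)"
proof -
  have *: "I +> x = I +> y" if "x \<ominus> y \<in> I" "x \<in> carrier R" "y \<in> carrier R" for x y
    using that a_repr_independence'[of x y] a_rcos_module_minus[OF ring_axioms, of y x] by simp
  then show "\<lbrakk>x \<in> carrier R; y \<in> carrier R; x \<ominus> y \<in> I\<rbrakk> \<Longrightarrow> I +> x = I +> y" .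
  assume c: "x \<in> carrier R" "y \<in> carrier R" "z \<in> carrier R" "x \<ominus> y \<ominus> z \<in> I"
  then have "x \<ominus> (y \<oplus> z) \<in> I"
    by (simp add: minus_eq minus_add a_assoc)
  then have "I +> x = I +> (y \<oplus> z)" using * c by simp
  then show "I +> x = (I +> y) \<oplus>\<^bsub>R Quot I\<^esub> (I +> z)"
    using ring_hom_add[OF rcos_ring_hom] c by simp
qed

section \<open>Generators and relations of the enveloping algebra\<close>

context lie_rinehart
begin

abbreviation "V \<equiv> direct_sum A \<phi> L"
abbreviation "F \<equiv> free_algebra k (carrier V)"
abbreviation "T \<equiv> tensor_algebra k V"
abbreviation "U \<equiv> env k A \<phi> L"
abbreviation "q1 x \<equiv> linearity_ideal k V +>\<^bsub>F\<^esub> x"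
abbreviation "q2 x \<equiv> env_ideal k A \<phi> L +>\<^bsub>T\<^esub> x"
abbreviation "incl \<equiv> tensor_algebra_incl k V"
abbreviation "scal \<equiv> tensor_algebra_scalar k V"
abbreviation "eA \<equiv> env_A k A \<phi> L"
abbreviation "eL \<equiv> env_L k A \<phi> L"

sublocale fa: free_alg k "carrier V"
  by (simp add: free_alg_def phi.R.cring_axioms)

lemma V_sel [simp]:
  "v \<in> carrier V \<longleftrightarrow> fst v \<in> carrier A \<and> snd v \<in> carrier L"
  "v \<oplus>\<^bsub>V\<^esub> w = (fst v \<oplus>\<^bsub>A\<^esub> fst w, snd v \<oplus>\<^bsub>L\<^esub> snd w)"
  "c \<odot>\<^bsub>V\<^esub> v = (\<phi> c \<otimes>\<^bsub>A\<^esub> fst v, \<phi> c \<odot>\<^bsub>L\<^esub> snd v)"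
  by (cases v; simp add: direct_sum_def)+

lemma anchor_closed [simp]: "\<lbrakk>x \<in> carrier L; a \<in> carrier A\<rbrakk> \<Longrightarrow> anchor L x a \<in> carrier A"
  using anchor_derivation[of x] by (auto simp: derivations_def)

text \<open>For a derivation D, D(1) = D(1 * 1) = D(1) + D(1) gives D(1) = 0, and k-linearity
  carries this over to \<phi>(c) * 1.\<close>

lemma anchor_scalar:
  assumes "x \<in> carrier L" "c \<in> carrier k"
  shows "anchor L x (\<phi> c) = \<zero>\<^bsub>A\<^esub>"
proof -
  have D: "anchor L x (a \<otimes>\<^bsub>A\<^esub> b) = a \<otimes>\<^bsub>A\<^esub> anchor L x b \<oplus>\<^bsub>A\<^esub> anchor L x a \<otimes>\<^bsub>A\<^esub> b"
    if "a \<in> carrier A" "b \<in> carrier A" for a b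
    using anchor_derivation[OF assms(1)] that by (auto simp: derivations_def)
  have "anchor L x \<one>\<^bsub>A\<^esub> = anchor L x \<one>\<^bsub>A\<^esub> \<oplus>\<^bsub>A\<^esub> anchor L x \<one>\<^bsub>A\<^esub>"
    using D[of "\<one>\<^bsub>A\<^esub>" "\<one>\<^bsub>A\<^esub>"] assms by simp
  then have "anchor L x \<one>\<^bsub>A\<^esub> = \<zero>\<^bsub>A\<^esub>" using assms by simp
  moreover have "anchor L x (\<phi> c \<otimes>\<^bsub>A\<^esub> \<one>\<^bsub>A\<^esub>) = \<phi> c \<otimes>\<^bsub>A\<^esub> anchor L x \<one>\<^bsub>A\<^esub>"
    using anchor_derivation[OF assms(1)] assms(2) unfolding derivations_def by blast
  ultimately show ?thesis using assms by simp
qed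

lemma lin_rels_closed:
  "{monomial k \<one>\<^bsub>k\<^esub> [v \<oplus>\<^bsub>V\<^esub> w] \<ominus>\<^bsub>F\<^esub> monomial k \<one>\<^bsub>k\<^esub> [v] \<ominus>\<^bsub>F\<^esub> monomial k \<one>\<^bsub>k\<^esub> [w] | v w.
       v \<in> carrier V \<and> w \<in> carrier V} \<union>
   {monomial k \<one>\<^bsub>k\<^esub> [c \<odot>\<^bsub>V\<^esub> v] \<ominus>\<^bsub>F\<^esub> monomial k c [v] | c v. c \<in> carrier k \<and> v \<in> carrier V} \<subseteq> carrier F"
proof -
  interpret F: ring F by (rule fa.F_ring)
  show ?thesis by (auto intro!: F.minus_closed fa.mnm_closed)
qed

lemma ideal_lin: "ideal (linearity_ideal k V) F"
  unfolding linearity_ideal_def Let_def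
  by (rule ring.genideal_ideal[OF fa.F_ring lin_rels_closed])

lemma T_ring: "ring T"
  unfolding tensor_algebra_def by (rule ideal.quotient_is_ring[OF ideal_lin])

lemma q1_hom: "q1 \<in> ring_hom F T"
  unfolding tensor_algebra_def by (rule ideal.rcos_ring_hom[OF ideal_lin])

lemma mnm1_closed [simp]: "v \<in> carrier V \<Longrightarrow> monomial k \<one>\<^bsub>k\<^esub> [v] \<in> carrier F"
  "c \<in> carrier k \<Longrightarrow> monomial k c [] \<in> carrier F"
  by (auto intro!: fa.mnm_closed)

lemma incl_closed [simp]: "v \<in> carrier V \<Longrightarrow> incl v \<in> carrier T"
  unfolding tensor_algebra_incl_def by (rule ring_hom_closed[OF q1_hom]) simp

lemma scal_closed [simp]: "c \<in> carrier k \<Longrightarrow> scal c \<in> carrier T"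
  unfolding tensor_algebra_scalar_def by (rule ring_hom_closed[OF q1_hom]) simp

lemma incl_add:
  assumes "v \<in> carrier V" "w \<in> carrier V"
  shows "incl (v \<oplus>\<^bsub>V\<^esub> w) = incl v \<oplus>\<^bsub>T\<^esub> incl w"
proof -
  have "monomial k \<one>\<^bsub>k\<^esub> [v \<oplus>\<^bsub>V\<^esub> w] \<ominus>\<^bsub>F\<^esub> monomial k \<one>\<^bsub>k\<^esub> [v] \<ominus>\<^bsub>F\<^esub> monomial k \<one>\<^bsub>k\<^esub> [w]
      \<in> linearity_ideal k V"
    unfolding linearity_ideal_def Let_def
    by (rule subsetD[OF ring.genideal_self[OF fa.F_ring lin_rels_closed]]) (use assms in blast)
  from ideal.quotient_eqD(2)[OF ideal_lin _ _ _ this] show ?thesis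
    using assms by (auto simp: tensor_algebra_incl_def tensor_algebra_def)
qed

abbreviation "env_rels \<equiv>
  {scal c \<ominus>\<^bsub>T\<^esub> incl (\<phi> c, \<zero>\<^bsub>L\<^esub>) | c. c \<in> carrier k} \<union>
  {incl (a, \<zero>\<^bsub>L\<^esub>) \<otimes>\<^bsub>T\<^esub> incl (b, \<zero>\<^bsub>L\<^esub>) \<ominus>\<^bsub>T\<^esub> incl (a \<otimes>\<^bsub>A\<^esub> b, \<zero>\<^bsub>L\<^esub>) | a b. a \<in> carrier A \<and> b \<in> carrier A} \<union>
  {incl (\<zero>\<^bsub>A\<^esub>, x) \<otimes>\<^bsub>T\<^esub> incl (a, \<zero>\<^bsub>L\<^esub>) \<ominus>\<^bsub>T\<^esub> incl (a, \<zero>\<^bsub>L\<^esub>) \<otimes>\<^bsub>T\<^esub> incl (\<zero>\<^bsub>A\<^esub>, x)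
     \<ominus>\<^bsub>T\<^esub> incl (anchor L x a, \<zero>\<^bsub>L\<^esub>) | x a. x \<in> carrier L \<and> a \<in> carrier A} \<union>
  {incl (\<zero>\<^bsub>A\<^esub>, x) \<otimes>\<^bsub>T\<^esub> incl (\<zero>\<^bsub>A\<^esub>, y) \<ominus>\<^bsub>T\<^esub> incl (\<zero>\<^bsub>A\<^esub>, y) \<otimes>\<^bsub>T\<^esub> incl (\<zero>\<^bsub>A\<^esub>, x)
     \<ominus>\<^bsub>T\<^esub> incl (\<zero>\<^bsub>A\<^esub>, bracket L x y) | x y. x \<in> carrier L \<and> y \<in> carrier L} \<union>
  {incl (\<zero>\<^bsub>A\<^esub>, a \<odot>\<^bsub>L\<^esub> x) \<ominus>\<^bsub>T\<^esub> incl (a, \<zero>\<^bsub>L\<^esub>) \<otimes>\<^bsub>T\<^esub> incl (\<zero>\<^bsub>A\<^esub>, x) | a x. a \<in> carrier A \<and> x \<in> carrier L}"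

lemma env_rels_intros:
  "c \<in> carrier k \<Longrightarrow> scal c \<ominus>\<^bsub>T\<^esub> incl (\<phi> c, \<zero>\<^bsub>L\<^esub>) \<in> env_rels"
  "\<lbrakk>a \<in> carrier A; b \<in> carrier A\<rbrakk> \<Longrightarrow>
    incl (a, \<zero>\<^bsub>L\<^esub>) \<otimes>\<^bsub>T\<^esub> incl (b, \<zero>\<^bsub>L\<^esub>) \<ominus>\<^bsub>T\<^esub> incl (a \<otimes>\<^bsub>A\<^esub> b, \<zero>\<^bsub>L\<^esub>) \<in> env_rels"
  "\<lbrakk>x \<in> carrier L; a \<in> carrier A\<rbrakk> \<Longrightarrow>
    incl (\<zero>\<^bsub>A\<^esub>, x) \<otimes>\<^bsub>T\<^esub> incl (a, \<zero>\<^bsub>L\<^esub>) \<ominus>\<^bsub>T\<^esub> incl (a, \<zero>\<^bsub>L\<^esub>) \<otimes>\<^bsub>T\<^esub> incl (\<zero>\<^bsub>A\<^esub>, x)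
      \<ominus>\<^bsub>T\<^esub> incl (anchor L x a, \<zero>\<^bsub>L\<^esub>) \<in> env_rels"
  "\<lbrakk>x \<in> carrier L; y \<in> carrier L\<rbrakk> \<Longrightarrow>
    incl (\<zero>\<^bsub>A\<^esub>, x) \<otimes>\<^bsub>T\<^esub> incl (\<zero>\<^bsub>A\<^esub>, y) \<ominus>\<^bsub>T\<^esub> incl (\<zero>\<^bsub>A\<^esub>, y) \<otimes>\<^bsub>T\<^esub> incl (\<zero>\<^bsub>A\<^esub>, x)
      \<ominus>\<^bsub>T\<^esub> incl (\<zero>\<^bsub>A\<^esub>, bracket L x y) \<in> env_rels"
  "\<lbrakk>a \<in> carrier A; x \<in> carrier L\<rbrakk> \<Longrightarrow>
    incl (\<zero>\<^bsub>A\<^esub>, a \<odot>\<^bsub>L\<^esub> x) \<ominus>\<^bsub>T\<^esub> incl (a, \<zero>\<^bsub>L\<^esub>) \<otimes>\<^bsub>T\<^esub> incl (\<zero>\<^bsub>A\<^esub>, x) \<in> env_rels"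
  by blast+

lemma env_ideal_eq: "env_ideal k A \<phi> L = Idl\<^bsub>T\<^esub> env_rels"
  by (simp add: env_ideal_def Let_def)

lemma env_rels_closed: "env_rels \<subseteq> carrier T"
proof -
  interpret T: ring T by (rule T_ring)
  show ?thesis
    by (auto intro!: T.minus_closed T.m_closed incl_closed bracket_closed smult_closed)
qed

lemma ideal_env: "ideal (env_ideal k A \<phi> L) T"
  unfolding env_ideal_eq by (rule ring.genideal_ideal[OF T_ring env_rels_closed])

lemma U_ring: "ring U"
  unfolding env_def by (rule ideal.quotient_is_ring[OF ideal_env])

lemma q2_hom: "q2 \<in> ring_hom T U"
  unfolding env_def by (rule ideal.rcos_ring_hom[OF ideal_env])

lemma env_relsD: "x \<in> env_rels \<Longrightarrow> x \<in> env_ideal k A \<phi> L"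
  unfolding env_ideal_eq by (rule subsetD[OF ring.genideal_self[OF T_ring env_rels_closed]])

lemma eA_eq: "eA a = q2 (incl (a, \<zero>\<^bsub>L\<^esub>))"
  by (simp add: env_A_def env_incl_def)

lemma eL_eq: "eL x = q2 (incl (\<zero>\<^bsub>A\<^esub>, x))"
  by (simp add: env_L_def env_incl_def)

text \<open>Identifies the scalars of the tensor algebra with elements coming from \<open>A\<close>,
  so that coefficients can be treated as left factors \<open>eA (\<phi> c)\<close> in
  \<open>env_induct\<close>.\<close>

lemma eA_scal: "c \<in> carrier k \<Longrightarrow> q2 (scal c) = eA (\<phi> c)"
  unfolding eA_eq by (rule ideal.quotient_eqD(1)[OF ideal_env _ _ env_relsD[OF env_rels_intros(1)]]) auto

lemma lr_rep_env: "lr_rep A L U eA eL"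
  unfolding lr_rep_def
proof (intro conjI ballI)
  interpret T: ring T by (rule T_ring)
  note q2 = ring_hom_closed[OF q2_hom] ring_hom_mult[OF q2_hom] ring_hom_add[OF q2_hom]
  note rel2 = ideal.quotient_eqD(2)[OF ideal_env _ _ _ env_relsD, folded env_def]
  show "eA \<in> ring_hom A U"
  proof (rule ring_hom_memI)
    fix a b assume ab: "a \<in> carrier A" "b \<in> carrier A"
    then show "eA a \<in> carrier U" by (simp add: eA_eq q2)
    have "q2 (incl (a, \<zero>\<^bsub>L\<^esub>) \<otimes>\<^bsub>T\<^esub> incl (b, \<zero>\<^bsub>L\<^esub>)) = q2 (incl (a \<otimes>\<^bsub>A\<^esub> b, \<zero>\<^bsub>L\<^esub>))"
      by (rule ideal.quotient_eqD(1)[OF ideal_env _ _ env_relsD[OF env_rels_intros(2)]]) (use ab in simp_all)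
    with ab show "eA (a \<otimes>\<^bsub>A\<^esub> b) = eA a \<otimes>\<^bsub>U\<^esub> eA b" by (simp add: eA_eq q2)
    show "eA (a \<oplus>\<^bsub>A\<^esub> b) = eA a \<oplus>\<^bsub>U\<^esub> eA b"
      using ab incl_add[of "(a, \<zero>\<^bsub>L\<^esub>)" "(b, \<zero>\<^bsub>L\<^esub>)"] by (simp add: eA_eq flip: q2(3))
  next
    \<comment> \<open>The product relation on \<open>A\<close> alone makes \<open>eA\<close> of one
      an idempotent; that it is the unit comes from the scalar relation at c = 1.\<close>
    have "scal \<one>\<^bsub>k\<^esub> = \<one>\<^bsub>T\<^esub>"
      using ring_hom_one[OF q1_hom] by (simp add: tensor_algebra_scalar_def free_algebra_one)
    then show "eA \<one>\<^bsub>A\<^esub> = \<one>\<^bsub>U\<^esub>"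
      using eA_scal[of "\<one>\<^bsub>k\<^esub>"] ring_hom_one[OF q2_hom] by simp
  qed
  show "eL \<in> add_hom L U"
  proof (rule add_homI)
    fix x y assume xy: "x \<in> carrier L" "y \<in> carrier L"
    then show "eL x \<in> carrier U" by (simp add: eL_eq q2)
    show "eL (x \<oplus>\<^bsub>L\<^esub> y) = eL x \<oplus>\<^bsub>U\<^esub> eL y"
      using xy incl_add[of "(\<zero>\<^bsub>A\<^esub>, x)" "(\<zero>\<^bsub>A\<^esub>, y)"] by (simp add: eL_eq flip: q2(3))
  qed
  fix x assume x: "x \<in> carrier L"
  {
    fix a assume a: "a \<in> carrier A"
    have "q2 (incl (\<zero>\<^bsub>A\<^esub>, x) \<otimes>\<^bsub>T\<^esub> incl (a, \<zero>\<^bsub>L\<^esub>)) =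
        q2 (incl (a, \<zero>\<^bsub>L\<^esub>) \<otimes>\<^bsub>T\<^esub> incl (\<zero>\<^bsub>A\<^esub>, x)) \<oplus>\<^bsub>U\<^esub> q2 (incl (anchor L x a, \<zero>\<^bsub>L\<^esub>))"
      by (rule rel2[OF _ _ _ env_rels_intros(3)]) (use a x in simp_all)
    then show "eL x \<otimes>\<^bsub>U\<^esub> eA a = eA a \<otimes>\<^bsub>U\<^esub> eL x \<oplus>\<^bsub>U\<^esub> eA (anchor L x a)"
      using a x by (simp add: eA_eq eL_eq q2)
  next
    fix y assume y: "y \<in> carrier L"
    have "q2 (incl (\<zero>\<^bsub>A\<^esub>, x) \<otimes>\<^bsub>T\<^esub> incl (\<zero>\<^bsub>A\<^esub>, y)) =
        q2 (incl (\<zero>\<^bsub>A\<^esub>, y) \<otimes>\<^bsub>T\<^esub> incl (\<zero>\<^bsub>A\<^esub>, x)) \<oplus>\<^bsub>U\<^esub> q2 (incl (\<zero>\<^bsub>A\<^esub>, bracket L x y))"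
      by (rule rel2[OF _ _ _ env_rels_intros(4)]) (use y x bracket_closed in simp_all)
    then show "eL x \<otimes>\<^bsub>U\<^esub> eL y = eL y \<otimes>\<^bsub>U\<^esub> eL x \<oplus>\<^bsub>U\<^esub> eL (bracket L x y)"
      using x y by (simp add: eL_eq q2)
  }
next
  note q2 = ring_hom_closed[OF q2_hom] ring_hom_mult[OF q2_hom] ring_hom_add[OF q2_hom]
  interpret T: ring T by (rule T_ring)
  fix a x assume ax: "a \<in> carrier A" "x \<in> carrier L"
  have "q2 (incl (\<zero>\<^bsub>A\<^esub>, a \<odot>\<^bsub>L\<^esub> x)) = q2 (incl (a, \<zero>\<^bsub>L\<^esub>) \<otimes>\<^bsub>T\<^esub> incl (\<zero>\<^bsub>A\<^esub>, x))"
    by (rule ideal.quotient_eqD(1)[OF ideal_env _ _ env_relsD[OF env_rels_intros(5)]])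
      (use ax smult_closed in simp_all)
  then show "eL (a \<odot>\<^bsub>L\<^esub> x) = eA a \<otimes>\<^bsub>U\<^esub> eL x"
    using ax by (simp add: eA_eq eL_eq q2)
qed

lemma eA_hom: "eA \<in> ring_hom A U" and eL_hom: "eL \<in> add_hom L U"
  using lr_rep_env unfolding lr_rep_def by blast+

lemma eL_eA: "\<lbrakk>x \<in> carrier L; a \<in> carrier A\<rbrakk> \<Longrightarrow>
    eL x \<otimes>\<^bsub>U\<^esub> eA a = eA a \<otimes>\<^bsub>U\<^esub> eL x \<oplus>\<^bsub>U\<^esub> eA (anchor L x a)"
  and eL_eL: "\<lbrakk>x \<in> carrier L; y \<in> carrier L\<rbrakk> \<Longrightarrow>
    eL x \<otimes>\<^bsub>U\<^esub> eL y = eL y \<otimes>\<^bsub>U\<^esub> eL x \<oplus>\<^bsub>U\<^esub> eL (bracket L x y)"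
  and eL_smult: "\<lbrakk>a \<in> carrier A; x \<in> carrier L\<rbrakk> \<Longrightarrow> eL (a \<odot>\<^bsub>L\<^esub> x) = eA a \<otimes>\<^bsub>U\<^esub> eL x"
  using lr_rep_env unfolding lr_rep_def by blast+

lemma eA_closed [simp]: "a \<in> carrier A \<Longrightarrow> eA a \<in> carrier U"
  using eA_hom by (rule ring_hom_closed)

lemma eL_closed [simp]: "x \<in> carrier L \<Longrightarrow> eL x \<in> carrier U"
  using eL_hom by (rule add_hom_closed)

text \<open>\<open>U\<close> is spanned by words, and a letter (a, x) becomes the sum of
  \<open>eA a\<close> and \<open>eL x\<close>, so everything is reached from one by sums and by left
  multiplication with generators. Zero and multiples by scalars fall under the case
  \<open>A\<close>.\<close>

lemma env_induct [consumes 1, case_names one add A L]: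
  assumes "u \<in> carrier U"
    and one: "P \<one>\<^bsub>U\<^esub>"
    and add: "\<And>u v. \<lbrakk>u \<in> carrier U; v \<in> carrier U; P u; P v\<rbrakk> \<Longrightarrow> P (u \<oplus>\<^bsub>U\<^esub> v)"
    and A: "\<And>a u. \<lbrakk>a \<in> carrier A; u \<in> carrier U; P u\<rbrakk> \<Longrightarrow> P (eA a \<otimes>\<^bsub>U\<^esub> u)"
    and L: "\<And>x u. \<lbrakk>x \<in> carrier L; u \<in> carrier U; P u\<rbrakk> \<Longrightarrow> P (eL x \<otimes>\<^bsub>U\<^esub> u)"
  shows "P u"
proof -
  interpret U: ring U by (rule U_ring)
  define q where "q = q2 \<circ> q1"
  have q: "q \<in> ring_hom F U"
    unfolding q_def by (rule ring_hom_trans[OF q1_hom q2_hom])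
  note qs = ring_hom_closed[OF q] ring_hom_mult[OF q] ring_hom_add[OF q]
  have word: "q (monomial k \<one>\<^bsub>k\<^esub> w) \<in> carrier U \<and> P (q (monomial k \<one>\<^bsub>k\<^esub> w))"
    if "w \<in> lists (carrier V)" for w
    using that
  proof (induction w)
    case Nil
    then show ?case using one ring_hom_one[OF q] by (simp add: free_algebra_one)
  next
    case (Cons v w)
    obtain a x where v: "v = (a, x)" "a \<in> carrier A" "x \<in> carrier L" using Cons by (cases v) auto
    have "q (monomial k \<one>\<^bsub>k\<^esub> [v]) = q2 (incl v)"
      by (simp add: q_def tensor_algebra_incl_def)
    also have "\<dots> = q2 (incl (a, \<zero>\<^bsub>L\<^esub>) \<oplus>\<^bsub>T\<^esub> incl (\<zero>\<^bsub>A\<^esub>, x))"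
      using incl_add[of "(a, \<zero>\<^bsub>L\<^esub>)" "(\<zero>\<^bsub>A\<^esub>, x)"] v by simp
    also have "\<dots> = eA a \<oplus>\<^bsub>U\<^esub> eL x"
      using v by (simp add: ring_hom_add[OF q2_hom] eA_eq eL_eq)
    finally have v': "q (monomial k \<one>\<^bsub>k\<^esub> [v]) = eA a \<oplus>\<^bsub>U\<^esub> eL x" .
    have "q (monomial k \<one>\<^bsub>k\<^esub> (v # w)) = (eA a \<oplus>\<^bsub>U\<^esub> eL x) \<otimes>\<^bsub>U\<^esub> q (monomial k \<one>\<^bsub>k\<^esub> w)"
      using Cons.hyps fa.mon_mult[of "\<one>\<^bsub>k\<^esub>" "\<one>\<^bsub>k\<^esub>" "[v]" w]
        qs(2)[of "monomial k \<one>\<^bsub>k\<^esub> [v]" "monomial k \<one>\<^bsub>k\<^esub> w"] fa.mnm_closed[OF _ Cons.hyps(2)]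
      by (simp add: v')
    then show ?case
      using v Cons.IH by (simp add: U.l_distr add A L)
  qed
  have "q x \<in> carrier U \<and> P (q x)" if "x \<in> carrier F" for x
    using that
  proof (induction rule: fa.F_induct)
    case zero
    \<comment> \<open>Zero is reached as \<open>eA\<close> of zero, multiplied by one.\<close>
    have "P (eA \<zero>\<^bsub>A\<^esub> \<otimes>\<^bsub>U\<^esub> \<one>\<^bsub>U\<^esub>)" by (rule A) (simp_all add: one)
    then show ?case
      using add_hom_zero[OF phi.S.is_abelian_group U.is_abelian_group ring_hom_add_hom[OF eA_hom]]
        add_hom_zero[OF fa.F_abelian_group U.is_abelian_group ring_hom_add_hom[OF q]] by simp
  next
    case (mnm c w)
    have "q (monomial k c []) = eA (\<phi> c)"
      using eA_scal[OF mnm(1)] by (simp add: q_def tensor_algebra_scalar_def)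
    then have "q (monomial k c w) = eA (\<phi> c) \<otimes>\<^bsub>U\<^esub> q (monomial k \<one>\<^bsub>k\<^esub> w)"
      using mnm fa.mon_mult[of c "\<one>\<^bsub>k\<^esub>" "[]" w]
        qs(2)[of "monomial k c []" "monomial k \<one>\<^bsub>k\<^esub> w"] fa.mnm_closed[OF _ mnm(2)] by simp
    then show ?case
      using word[OF mnm(2)] mnm by (simp add: A)
  qed (simp add: qs add)
  moreover obtain x where "x \<in> carrier F" "u = q x"
  proof -
    obtain t where t: "t \<in> carrier T" "u = q2 t"
      using assms(1) unfolding env_def by (rule quotient_cosetE)
    moreover obtain x where "x \<in> carrier F" "t = q1 x"
      using t(1) unfolding tensor_algebra_def by (rule quotient_cosetE)
    ultimately show thesis using that by (simp add: q_def)
  qed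
  ultimately show ?thesis by simp
qed

text \<open>The extension passes through the layers of the construction: evaluation of words on the
  free algebra, then the quotient by the linearity ideal, then the quotient by the enveloping
  relations. Each ideal is killed because its generators are.\<close>

theorem env_universal:
  assumes "ring R" "lr_rep A L R \<alpha> \<beta>"
  shows "\<exists>h\<in>ring_hom U R. (\<forall>a\<in>carrier A. h (eA a) = \<alpha> a) \<and> (\<forall>x\<in>carrier L. h (eL x) = \<beta> x)"
proof -
  interpret R: ring R by fact
  have \<alpha>: "\<alpha> \<in> ring_hom A R" and \<beta>: "\<beta> \<in> add_hom L R"
    and rA: "\<And>x a. \<lbrakk>x \<in> carrier L; a \<in> carrier A\<rbrakk> \<Longrightarrow>
        \<beta> x \<otimes>\<^bsub>R\<^esub> \<alpha> a = \<alpha> a \<otimes>\<^bsub>R\<^esub> \<beta> x \<oplus>\<^bsub>R\<^esub> \<alpha> (anchor L x a)"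
    and rL: "\<And>x y. \<lbrakk>x \<in> carrier L; y \<in> carrier L\<rbrakk> \<Longrightarrow>
        \<beta> x \<otimes>\<^bsub>R\<^esub> \<beta> y = \<beta> y \<otimes>\<^bsub>R\<^esub> \<beta> x \<oplus>\<^bsub>R\<^esub> \<beta> (bracket L x y)"
    and rs: "\<And>a x. \<lbrakk>a \<in> carrier A; x \<in> carrier L\<rbrakk> \<Longrightarrow> \<beta> (a \<odot>\<^bsub>L\<^esub> x) = \<alpha> a \<otimes>\<^bsub>R\<^esub> \<beta> x"
    using assms(2) unfolding lr_rep_def by blast+
  note cl [simp] = ring_hom_closed[OF \<alpha>] add_hom_closed[OF \<beta>]
  have \<alpha>0 [simp]: "\<alpha> \<zero>\<^bsub>A\<^esub> = \<zero>\<^bsub>R\<^esub>"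
    by (rule add_hom_zero[OF phi.S.is_abelian_group R.is_abelian_group ring_hom_add_hom[OF \<alpha>]])
  have \<beta>0 [simp]: "\<beta> \<zero>\<^bsub>L\<^esub> = \<zero>\<^bsub>R\<^esub>"
    by (rule add_hom_zero[OF M.abelian_group_axioms R.is_abelian_group \<beta>])
  \<comment> \<open>In \<open>U\<close> a letter (a, x) is the sum of \<open>eA a\<close> and
    \<open>eL x\<close>, which dictates its image in \<open>R\<close>.\<close>
  define \<gamma> where "\<gamma> v = \<alpha> (fst v) \<oplus>\<^bsub>R\<^esub> \<beta> (snd v)" for v
  interpret \<Phi>: free_alg_hom k "carrier V" R "\<alpha> \<circ> \<phi>" \<gamma>
  proof (unfold_locales)
    show "\<alpha> \<circ> \<phi> \<in> ring_hom k R"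
      by (rule ring_hom_trans[OF phi.homh \<alpha>])
    fix v assume "v \<in> carrier V"
    then obtain a x where v: "v = (a, x)" "a \<in> carrier A" "x \<in> carrier L" by (cases v) auto
    then show "\<gamma> v \<in> carrier R" by (simp add: \<gamma>_def)
    fix c assume c: "c \<in> carrier k"
    \<comment> \<open>Centrality splits in two: against \<open>\<alpha> a\<close> it is
      commutativity of \<open>A\<close>; against \<open>\<beta> x\<close> the correction term
      \<open>\<alpha> (anchor L x (\<phi> c))\<close> vanishes.\<close>
    have "\<alpha> (\<phi> c) \<otimes>\<^bsub>R\<^esub> \<alpha> a = \<alpha> a \<otimes>\<^bsub>R\<^esub> \<alpha> (\<phi> c)"
      using c v by (simp add: phi.S.m_comm flip: ring_hom_mult[OF \<alpha>])
    moreover have "\<beta> x \<otimes>\<^bsub>R\<^esub> \<alpha> (\<phi> c) = \<alpha> (\<phi> c) \<otimes>\<^bsub>R\<^esub> \<beta> x"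
      using c v by (simp add: rA anchor_scalar)
    ultimately show "(\<alpha> \<circ> \<phi>) c \<otimes>\<^bsub>R\<^esub> \<gamma> v = \<gamma> v \<otimes>\<^bsub>R\<^esub> (\<alpha> \<circ> \<phi>) c"
      using c v by (simp add: \<gamma>_def R.l_distr R.r_distr)
  qed
  have letter: "\<Phi>.\<Phi> (monomial k c [(a, x)]) = \<alpha> (\<phi> c) \<otimes>\<^bsub>R\<^esub> (\<alpha> a \<oplus>\<^bsub>R\<^esub> \<beta> x)"
    if "c \<in> carrier k" "a \<in> carrier A" "x \<in> carrier L" for c a x
    using that \<Phi>.\<Phi>_mon[of c "[(a, x)]"] by (simp add: \<Phi>.ev_simps \<gamma>_def)
  have \<alpha>1: "\<alpha> \<one>\<^bsub>A\<^esub> = \<one>\<^bsub>R\<^esub>" by (rule ring_hom_one[OF \<alpha>])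
  have van1: "\<Phi>.\<Phi> x = \<zero>\<^bsub>R\<^esub>" if "x \<in> linearity_ideal k V" for x
  proof (rule genideal_vanish[OF fa.F_ring R.ring_axioms \<Phi>.\<Phi>_hom lin_rels_closed])
    show "x \<in> Idl\<^bsub>F\<^esub> ({monomial k \<one>\<^bsub>k\<^esub> [v \<oplus>\<^bsub>V\<^esub> w] \<ominus>\<^bsub>F\<^esub> monomial k \<one>\<^bsub>k\<^esub> [v] \<ominus>\<^bsub>F\<^esub> monomial k \<one>\<^bsub>k\<^esub> [w] | v w.
         v \<in> carrier V \<and> w \<in> carrier V} \<union>
         {monomial k \<one>\<^bsub>k\<^esub> [c \<odot>\<^bsub>V\<^esub> v] \<ominus>\<^bsub>F\<^esub> monomial k c [v] | c v. c \<in> carrier k \<and> v \<in> carrier V})"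
      using that by (simp add: linearity_ideal_def Let_def)
  next
    interpret F: ring F by (rule fa.F_ring)
    note hd = hom_diff[OF fa.F_ring R.ring_axioms \<Phi>.\<Phi>_hom]
    have c: "monomial k c [(a, x)] \<in> carrier F" if "c \<in> carrier k" "a \<in> carrier A" "x \<in> carrier L" for c a x
      by (rule fa.mnm_closed) (use that in auto)
    have 1: "\<Phi>.\<Phi> (monomial k \<one>\<^bsub>k\<^esub> [v \<oplus>\<^bsub>V\<^esub> w] \<ominus>\<^bsub>F\<^esub> monomial k \<one>\<^bsub>k\<^esub> [v] \<ominus>\<^bsub>F\<^esub> monomial k \<one>\<^bsub>k\<^esub> [w]) = \<zero>\<^bsub>R\<^esub>"
      if "v \<in> carrier V" "w \<in> carrier V" for v w
    proof -
      obtain a x b y where vw: "v = (a, x)" "w = (b, y)" by (cases v, cases w)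
      with that show ?thesis
        by (simp add: hd c letter \<alpha>1 R.minus_minus_eq_zero(2) ring_hom_add[OF \<alpha>] add_hom_add[OF \<beta>] R.a_ac)
    qed
    have 2: "\<Phi>.\<Phi> (monomial k \<one>\<^bsub>k\<^esub> [c' \<odot>\<^bsub>V\<^esub> v] \<ominus>\<^bsub>F\<^esub> monomial k c' [v]) = \<zero>\<^bsub>R\<^esub>"
      if "v \<in> carrier V" "c' \<in> carrier k" for v c'
    proof -
      obtain a x where vw: "v = (a, x)" by (cases v)
      with that show ?thesis
        by (simp add: hd c letter \<alpha>1 R.minus_minus_eq_zero(1) ring_hom_mult[OF \<alpha>] rs R.r_distr)
    qed
    fix y
    assume "y \<in> {monomial k \<one>\<^bsub>k\<^esub> [v \<oplus>\<^bsub>V\<^esub> w] \<ominus>\<^bsub>F\<^esub> monomial k \<one>\<^bsub>k\<^esub> [v] \<ominus>\<^bsub>F\<^esub> monomial k \<one>\<^bsub>k\<^esub> [w] | v w.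
         v \<in> carrier V \<and> w \<in> carrier V} \<union>
         {monomial k \<one>\<^bsub>k\<^esub> [c \<odot>\<^bsub>V\<^esub> v] \<ominus>\<^bsub>F\<^esub> monomial k c [v] | c v. c \<in> carrier k \<and> v \<in> carrier V}"
    then show "\<Phi>.\<Phi> y = \<zero>\<^bsub>R\<^esub>"
      using 1 2 by blast
  qed
  obtain g where g: "g \<in> ring_hom T R" "\<And>x. x \<in> carrier F \<Longrightarrow> g (q1 x) = \<Phi>.\<Phi> x"
    using quotient_hom[OF fa.F_ring R.ring_axioms ideal_lin \<Phi>.\<Phi>_hom van1]
    unfolding tensor_algebra_def by blast
  have gi: "g (incl (a, x)) = \<alpha> a \<oplus>\<^bsub>R\<^esub> \<beta> x" if "a \<in> carrier A" "x \<in> carrier L" for a x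
    using that g(2)[OF mnm1_closed(1), of "(a, x)"]
    by (simp add: tensor_algebra_incl_def letter \<alpha>1)
  have gs: "g (scal c) = \<alpha> (\<phi> c)" if "c \<in> carrier k" for c
    using that g(2)[OF mnm1_closed(2), of c] \<Phi>.\<Phi>_mon[of c "[]"]
    by (simp add: tensor_algebra_scalar_def \<Phi>.ev_simps)
  have van2: "g x = \<zero>\<^bsub>R\<^esub>" if "x \<in> env_ideal k A \<phi> L" for x
  proof (rule genideal_vanish[OF T_ring R.ring_axioms g(1) env_rels_closed])
    show "x \<in> Idl\<^bsub>T\<^esub> env_rels" using that by (simp only: env_ideal_eq)
  next
    interpret T: ring T by (rule T_ring)
    note gd = hom_diff[OF T_ring R.ring_axioms g(1)] ring_hom_mult[OF g(1)]
    have 1: "g (scal c \<ominus>\<^bsub>T\<^esub> incl (\<phi> c, \<zero>\<^bsub>L\<^esub>)) = \<zero>\<^bsub>R\<^esub>" if "c \<in> carrier k" for c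
      using that by (simp add: gd gi gs R.minus_minus_eq_zero(1))
    have 2: "g (incl (a, \<zero>\<^bsub>L\<^esub>) \<otimes>\<^bsub>T\<^esub> incl (b, \<zero>\<^bsub>L\<^esub>) \<ominus>\<^bsub>T\<^esub> incl (a \<otimes>\<^bsub>A\<^esub> b, \<zero>\<^bsub>L\<^esub>)) = \<zero>\<^bsub>R\<^esub>"
      if "a \<in> carrier A" "b \<in> carrier A" for a b
      using that by (simp add: gd gi R.minus_minus_eq_zero(1) ring_hom_mult[OF \<alpha>])
    have 3: "g (incl (\<zero>\<^bsub>A\<^esub>, x) \<otimes>\<^bsub>T\<^esub> incl (a, \<zero>\<^bsub>L\<^esub>) \<ominus>\<^bsub>T\<^esub> incl (a, \<zero>\<^bsub>L\<^esub>) \<otimes>\<^bsub>T\<^esub> incl (\<zero>\<^bsub>A\<^esub>, x)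
        \<ominus>\<^bsub>T\<^esub> incl (anchor L x a, \<zero>\<^bsub>L\<^esub>)) = \<zero>\<^bsub>R\<^esub>"
      if "x \<in> carrier L" "a \<in> carrier A" for x a
      using that rA[OF that] by (simp add: gd gi R.minus_minus_eq_zero(2))
    have 4: "g (incl (\<zero>\<^bsub>A\<^esub>, x) \<otimes>\<^bsub>T\<^esub> incl (\<zero>\<^bsub>A\<^esub>, y) \<ominus>\<^bsub>T\<^esub> incl (\<zero>\<^bsub>A\<^esub>, y) \<otimes>\<^bsub>T\<^esub> incl (\<zero>\<^bsub>A\<^esub>, x)
        \<ominus>\<^bsub>T\<^esub> incl (\<zero>\<^bsub>A\<^esub>, bracket L x y)) = \<zero>\<^bsub>R\<^esub>"
      if "x \<in> carrier L" "y \<in> carrier L" for x y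
      using that rL[OF that] by (simp add: gd gi R.minus_minus_eq_zero(2) bracket_closed)
    have 5: "g (incl (\<zero>\<^bsub>A\<^esub>, a \<odot>\<^bsub>L\<^esub> x) \<ominus>\<^bsub>T\<^esub> incl (a, \<zero>\<^bsub>L\<^esub>) \<otimes>\<^bsub>T\<^esub> incl (\<zero>\<^bsub>A\<^esub>, x)) = \<zero>\<^bsub>R\<^esub>"
      if "a \<in> carrier A" "x \<in> carrier L" for a x
      using that rs[OF that] by (simp add: gd gi R.minus_minus_eq_zero(1))
    fix y assume "y \<in> env_rels"
    then show "g y = \<zero>\<^bsub>R\<^esub>"
      by (elim UnE CollectE exE conjE) (simp_all only: 1 2 3 4 5)
  qed
  obtain h where h: "h \<in> ring_hom U R" "\<And>x. x \<in> carrier T \<Longrightarrow> h (q2 x) = g x"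
    using quotient_hom[OF T_ring R.ring_axioms ideal_env g(1) van2] unfolding env_def by blast
  show ?thesis
    by (intro bexI[OF _ h(1)]) (simp_all add: eA_eq eL_eq h(2) gi)
qed

end

text \<open>Since \<open>env_map\<close> is a choice, its properties rest on the existence of one
  such homomorphism. The universal property of the enveloping algebra of \<open>L0\<close> supplies
  it for the pair \<open>L.eA\<close> and \<open>L.eL\<close> composed with \<open>f\<close>;
  compatibility of \<open>f\<close> with sums, scalars, brackets and anchors gives the clauses of
  \<open>lr_rep\<close>.\<close>

lemma env_map_spec:
  assumes "lie_rinehart k A \<phi> L0" "lie_rinehart k A \<phi> L" "f \<in> lie_rinehart_hom A L0 L"
  shows "env_map k A \<phi> L0 L f \<in> ring_hom (env k A \<phi> L0) (env k A \<phi> L)"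
    and "a \<in> carrier A \<Longrightarrow> env_map k A \<phi> L0 L f (env_A k A \<phi> L0 a) = env_A k A \<phi> L a"
    and "x \<in> carrier L0 \<Longrightarrow> env_map k A \<phi> L0 L f (env_L k A \<phi> L0 x) = env_L k A \<phi> L (f x)"
proof -
  interpret L0: lie_rinehart k A \<phi> L0 by fact
  interpret L: lie_rinehart k A \<phi> L by fact
  have f: "f x \<in> carrier L" "\<And>y. y \<in> carrier L0 \<Longrightarrow> f (x \<oplus>\<^bsub>L0\<^esub> y) = f x \<oplus>\<^bsub>L\<^esub> f y"
    "\<And>a. a \<in> carrier A \<Longrightarrow> f (a \<odot>\<^bsub>L0\<^esub> x) = a \<odot>\<^bsub>L\<^esub> f x"
    "\<And>y. y \<in> carrier L0 \<Longrightarrow> f (bracket L0 x y) = bracket L (f x) (f y)"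
    "\<And>a. a \<in> carrier A \<Longrightarrow> anchor L (f x) a = anchor L0 x a"
    if "x \<in> carrier L0" for x
    using assms(3) that unfolding lie_rinehart_hom_def by (blast intro: funcset_mem)+
  have "lr_rep A L0 L.U L.eA (\<lambda>x. L.eL (f x))"
    unfolding lr_rep_def
  proof (intro conjI ballI)
    show "(\<lambda>x. L.eL (f x)) \<in> add_hom L0 L.U"
      by (rule add_homI) (simp_all add: f add_hom_add[OF L.eL_hom])
    fix x assume x: "x \<in> carrier L0"
    show "L.eL (f x) \<otimes>\<^bsub>L.U\<^esub> L.eA a = L.eA a \<otimes>\<^bsub>L.U\<^esub> L.eL (f x) \<oplus>\<^bsub>L.U\<^esub> L.eA (anchor L0 x a)"
      if "a \<in> carrier A" for a
      using L.eL_eA[OF f(1)[OF x] that] f(5)[OF x that] by simp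
    show "L.eL (f x) \<otimes>\<^bsub>L.U\<^esub> L.eL (f y) =
        L.eL (f y) \<otimes>\<^bsub>L.U\<^esub> L.eL (f x) \<oplus>\<^bsub>L.U\<^esub> L.eL (f (bracket L0 x y))"
      if "y \<in> carrier L0" for y
      unfolding f(4)[OF x that] by (rule L.eL_eL[OF f(1)[OF x] f(1)[OF that]])
    show "L.eL (f (a \<odot>\<^bsub>L0\<^esub> x)) = L.eA a \<otimes>\<^bsub>L.U\<^esub> L.eL (f x)" if "a \<in> carrier A" for a
      unfolding f(3)[OF x that] by (rule L.eL_smult[OF that f(1)[OF x]])
  qed (rule L.eA_hom)
  from L0.env_universal[OF L.U_ring this] have "\<exists>h. h \<in> ring_hom L0.U L.U \<and> (\<forall>a\<in>carrier A. h (L0.eA a) = L.eA a) \<and>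
      (\<forall>x\<in>carrier L0. h (L0.eL x) = L.eL (f x))"
    unfolding Bex_def .
  then have *: "env_map k A \<phi> L0 L f \<in> ring_hom L0.U L.U \<and>
      (\<forall>a\<in>carrier A. env_map k A \<phi> L0 L f (L0.eA a) = L.eA a) \<and>
      (\<forall>x\<in>carrier L0. env_map k A \<phi> L0 L f (L0.eL x) = L.eL (f x))"
    unfolding env_map_def by (rule someI_ex)
  show "env_map k A \<phi> L0 L f \<in> ring_hom (env k A \<phi> L0) (env k A \<phi> L)"
    using * by (rule conjunct1)
  show "a \<in> carrier A \<Longrightarrow> env_map k A \<phi> L0 L f (env_A k A \<phi> L0 a) = env_A k A \<phi> L a"
    using *[THEN conjunct2, THEN conjunct1] by (rule bspec)
  show "x \<in> carrier L0 \<Longrightarrow> env_map k A \<phi> L0 L f (env_L k A \<phi> L0 x) = env_L k A \<phi> L (f x)"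
    using *[THEN conjunct2, THEN conjunct2] by (rule bspec)
qed

section \<open>Modules over U from operators for A and L\<close>

context lie_rinehart
begin

text \<open>The hypotheses are the clauses of \<open>lr_rep\<close> for the endomorphism ring,
  written pointwise on the carrier; the homomorphism supplied by \<open>env_universal\<close> is the
  action.\<close>

lemma left_module_exists:
  assumes G: "abelian_group G"
    and la: "\<And>a. a \<in> carrier A \<Longrightarrow> la a \<in> add_hom G G"
    and ll: "\<And>x. x \<in> carrier L \<Longrightarrow> ll x \<in> add_hom G G"
    and la_add: "\<And>a b t. \<lbrakk>a \<in> carrier A; b \<in> carrier A; t \<in> carrier G\<rbrakk> \<Longrightarrow>
      la (a \<oplus>\<^bsub>A\<^esub> b) t = la a t \<oplus>\<^bsub>G\<^esub> la b t"
    and la_mult: "\<And>a b t. \<lbrakk>a \<in> carrier A; b \<in> carrier A; t \<in> carrier G\<rbrakk> \<Longrightarrow>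
      la (a \<otimes>\<^bsub>A\<^esub> b) t = la a (la b t)"
    and la_one: "\<And>t. t \<in> carrier G \<Longrightarrow> la \<one>\<^bsub>A\<^esub> t = t"
    and ll_add: "\<And>x y t. \<lbrakk>x \<in> carrier L; y \<in> carrier L; t \<in> carrier G\<rbrakk> \<Longrightarrow>
      ll (x \<oplus>\<^bsub>L\<^esub> y) t = ll x t \<oplus>\<^bsub>G\<^esub> ll y t"
    and ll_la: "\<And>x a t. \<lbrakk>x \<in> carrier L; a \<in> carrier A; t \<in> carrier G\<rbrakk> \<Longrightarrow>
      ll x (la a t) = la a (ll x t) \<oplus>\<^bsub>G\<^esub> la (anchor L x a) t"
    and ll_ll: "\<And>x y t. \<lbrakk>x \<in> carrier L; y \<in> carrier L; t \<in> carrier G\<rbrakk> \<Longrightarrow>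
      ll x (ll y t) = ll y (ll x t) \<oplus>\<^bsub>G\<^esub> ll (bracket L x y) t"
    and ll_smult: "\<And>a x t. \<lbrakk>a \<in> carrier A; x \<in> carrier L; t \<in> carrier G\<rbrakk> \<Longrightarrow>
      ll (a \<odot>\<^bsub>L\<^esub> x) t = la a (ll x t)"
  shows "\<exists>act. left_module U (left_mod G act) \<and> (\<forall>t\<in>carrier G.
    (\<forall>a\<in>carrier A. act (eA a) t = la a t) \<and> (\<forall>x\<in>carrier L. act (eL x) t = ll x t))"
proof -
  let ?E = "end_ring G"
  define \<alpha> where "\<alpha> a = restrict (la a) (carrier G)" for a
  define \<beta> where "\<beta> x = restrict (ll x) (carrier G)" for x
  interpret E: ring "end_ring G" by (rule end_ring_ring[OF G])
  have E: "ring ?E" by (intro opp_ring_ring end_ring_ring G)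
  have \<alpha>: "\<alpha> a \<in> carrier (end_ring G)" if "a \<in> carrier A" for a
    using that restrict_end_ring[OF G la[of a]] by (simp add: \<alpha>_def)
  have \<beta>: "\<beta> x \<in> carrier (end_ring G)" if "x \<in> carrier L" for x
    using that restrict_end_ring[OF G ll[of x]] by (simp add: \<beta>_def)
  note cl = add_hom_closed[OF la] add_hom_closed[OF ll]
  have s: "\<alpha> a t = la a t" "\<beta> x t = ll x t" if "t \<in> carrier G" for a x t
    using that by (simp_all add: \<alpha>_def \<beta>_def)
  note s = s end_ring_apply cl \<alpha> \<beta>
  have "lr_rep A L ?E \<alpha> \<beta>"
    unfolding lr_rep_def
  proof (intro conjI ballI)
    show "\<alpha> \<in> ring_hom A ?E"
      by (rule ring_hom_memI; (rule end_ring_eqI[of _ G])?) (simp_all add: s la_add la_mult la_one)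
    show "\<beta> \<in> add_hom L ?E"
      by (rule add_homI; (rule end_ring_eqI[of _ G])?) (simp_all add: s ll_add)
    fix x assume x: "x \<in> carrier L"
    show "\<beta> x \<otimes>\<^bsub>?E\<^esub> \<alpha> a = \<alpha> a \<otimes>\<^bsub>?E\<^esub> \<beta> x \<oplus>\<^bsub>?E\<^esub> \<alpha> (anchor L x a)" if "a \<in> carrier A" for a
      by (rule end_ring_eqI[of _ G]) (use x that in \<open>simp_all add: s ll_la\<close>)
    show "\<beta> x \<otimes>\<^bsub>?E\<^esub> \<beta> y = \<beta> y \<otimes>\<^bsub>?E\<^esub> \<beta> x \<oplus>\<^bsub>?E\<^esub> \<beta> (bracket L x y)" if "y \<in> carrier L" for y
      by (rule end_ring_eqI[of _ G]) (use x that ll_ll[OF x that] in \<open>simp_all add: s bracket_closed\<close>)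
    show "\<beta> (a \<odot>\<^bsub>L\<^esub> x) = \<alpha> a \<otimes>\<^bsub>?E\<^esub> \<beta> x" if "a \<in> carrier A" for a
      by (rule end_ring_eqI[of _ G]) (use x that in \<open>simp_all add: s ll_smult\<close>)
  qed
  from env_universal[OF E this] obtain h where h: "h \<in> ring_hom U ?E" "\<forall>a\<in>carrier A. h (eA a) = \<alpha> a" "\<forall>x\<in>carrier L. h (eL x) = \<beta> x"
    by (elim bexE conjE)
  show ?thesis
    by (rule exI[of _ "\<lambda>r x. h r x"]) (use left_module_of_end_hom[OF U_ring G h(1)] h(2,3) in \<open>simp add: s\<close>)
qed

text \<open>A product in the opposite of the endomorphism ring applies its left factor first. Hence
  every composite is in the order opposite to that of \<open>left_module_exists\<close>; for
  instance t(ax) = (ta)x puts \<open>ll x\<close> outside \<open>la a\<close>.\<close>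

lemma right_module_exists:
  assumes G: "abelian_group G"
    and la: "\<And>a. a \<in> carrier A \<Longrightarrow> la a \<in> add_hom G G"
    and ll: "\<And>x. x \<in> carrier L \<Longrightarrow> ll x \<in> add_hom G G"
    and la_add: "\<And>a b t. \<lbrakk>a \<in> carrier A; b \<in> carrier A; t \<in> carrier G\<rbrakk> \<Longrightarrow>
      la (a \<oplus>\<^bsub>A\<^esub> b) t = la a t \<oplus>\<^bsub>G\<^esub> la b t"
    and la_mult: "\<And>a b t. \<lbrakk>a \<in> carrier A; b \<in> carrier A; t \<in> carrier G\<rbrakk> \<Longrightarrow>
      la (a \<otimes>\<^bsub>A\<^esub> b) t = la b (la a t)"
    and la_one: "\<And>t. t \<in> carrier G \<Longrightarrow> la \<one>\<^bsub>A\<^esub> t = t"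
    and ll_add: "\<And>x y t. \<lbrakk>x \<in> carrier L; y \<in> carrier L; t \<in> carrier G\<rbrakk> \<Longrightarrow>
      ll (x \<oplus>\<^bsub>L\<^esub> y) t = ll x t \<oplus>\<^bsub>G\<^esub> ll y t"
    and ll_la: "\<And>x a t. \<lbrakk>x \<in> carrier L; a \<in> carrier A; t \<in> carrier G\<rbrakk> \<Longrightarrow>
      la a (ll x t) = ll x (la a t) \<oplus>\<^bsub>G\<^esub> la (anchor L x a) t"
    and ll_ll: "\<And>x y t. \<lbrakk>x \<in> carrier L; y \<in> carrier L; t \<in> carrier G\<rbrakk> \<Longrightarrow>
      ll y (ll x t) = ll x (ll y t) \<oplus>\<^bsub>G\<^esub> ll (bracket L x y) t"
    and ll_smult: "\<And>a x t. \<lbrakk>a \<in> carrier A; x \<in> carrier L; t \<in> carrier G\<rbrakk> \<Longrightarrow>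
      ll (a \<odot>\<^bsub>L\<^esub> x) t = ll x (la a t)"
  shows "\<exists>act. right_module U (right_mod G act) \<and> (\<forall>t\<in>carrier G.
    (\<forall>a\<in>carrier A. act t (eA a) = la a t) \<and> (\<forall>x\<in>carrier L. act t (eL x) = ll x t))"
proof -
  let ?E = "opp_ring (end_ring G)"
  define \<alpha> where "\<alpha> a = restrict (la a) (carrier G)" for a
  define \<beta> where "\<beta> x = restrict (ll x) (carrier G)" for x
  interpret E: ring "end_ring G" by (rule end_ring_ring[OF G])
  have E: "ring ?E" by (intro opp_ring_ring end_ring_ring G)
  have \<alpha>: "\<alpha> a \<in> carrier (end_ring G)" if "a \<in> carrier A" for a
    using that restrict_end_ring[OF G la[of a]] by (simp add: \<alpha>_def)
  have \<beta>: "\<beta> x \<in> carrier (end_ring G)" if "x \<in> carrier L" for x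
    using that restrict_end_ring[OF G ll[of x]] by (simp add: \<beta>_def)
  note cl = add_hom_closed[OF la] add_hom_closed[OF ll]
  have s: "\<alpha> a t = la a t" "\<beta> x t = ll x t" if "t \<in> carrier G" for a x t
    using that by (simp_all add: \<alpha>_def \<beta>_def)
  note s = s end_ring_apply cl \<alpha> \<beta> opp_ring_sel
  have "lr_rep A L ?E \<alpha> \<beta>"
    unfolding lr_rep_def
  proof (intro conjI ballI)
    show "\<alpha> \<in> ring_hom A ?E"
      by (rule ring_hom_memI; (rule end_ring_eqI[of _ G])?) (simp_all add: s la_add la_mult la_one)
    show "\<beta> \<in> add_hom L ?E"
      by (rule add_homI; (rule end_ring_eqI[of _ G])?) (simp_all add: s ll_add)
    fix x assume x: "x \<in> carrier L"
    show "\<beta> x \<otimes>\<^bsub>?E\<^esub> \<alpha> a = \<alpha> a \<otimes>\<^bsub>?E\<^esub> \<beta> x \<oplus>\<^bsub>?E\<^esub> \<alpha> (anchor L x a)" if "a \<in> carrier A" for a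
      by (rule end_ring_eqI[of _ G]) (use x that in \<open>simp_all add: s ll_la\<close>)
    show "\<beta> x \<otimes>\<^bsub>?E\<^esub> \<beta> y = \<beta> y \<otimes>\<^bsub>?E\<^esub> \<beta> x \<oplus>\<^bsub>?E\<^esub> \<beta> (bracket L x y)" if "y \<in> carrier L" for y
      by (rule end_ring_eqI[of _ G]) (use x that ll_ll[OF x that] in \<open>simp_all add: s bracket_closed\<close>)
    show "\<beta> (a \<odot>\<^bsub>L\<^esub> x) = \<alpha> a \<otimes>\<^bsub>?E\<^esub> \<beta> x" if "a \<in> carrier A" for a
      by (rule end_ring_eqI[of _ G]) (use x that in \<open>simp_all add: s ll_smult\<close>)
  qed
  from env_universal[OF E this] obtain h where h: "h \<in> ring_hom U ?E" "\<forall>a\<in>carrier A. h (eA a) = \<alpha> a" "\<forall>x\<in>carrier L. h (eL x) = \<beta> x"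
    by (elim bexE conjE)
  show ?thesis
    by (rule exI[of _ "\<lambda>x r. h r x"]) (use right_module_of_end_hom[OF U_ring G h(1)] h(2,3) in \<open>simp add: s\<close>)
qed

end

section \<open>Tensor products\<close>

text \<open>The quotient group and its universal property see the two actions only through the
  balancing relations, for which closure is what matters. The module laws enter when the tensor
  product itself receives an action.\<close>

locale tensor_prod = M: abelian_group M + N: abelian_group N
  for M :: "('r, 'm) rmodule" and N :: "('r, 'n) module" +
  fixes R :: "'r ring"
  assumes M_smult: "\<lbrakk>x \<in> carrier M; r \<in> carrier R\<rbrakk> \<Longrightarrow> x \<bullet>\<^bsub>M\<^esub> r \<in> carrier M"
    and N_smult: "\<lbrakk>y \<in> carrier N; r \<in> carrier R\<rbrakk> \<Longrightarrow> r \<odot>\<^bsub>N\<^esub> y \<in> carrier N"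
begin

abbreviation "Fr \<equiv> tensor_free M N"
abbreviation "TG \<equiv> tensor_group R M N"
abbreviation "te \<equiv> tensor_elem R M N"

definition "cls c = tensor_null R M N #>\<^bsub>Fr\<^esub> c"

definition balanced :: "('g, 'b) ring_scheme \<Rightarrow> ('m \<Rightarrow> 'n \<Rightarrow> 'g) \<Rightarrow> bool"
  where "balanced G b \<longleftrightarrow>
    (\<forall>y\<in>carrier N. (\<lambda>x. b x y) \<in> add_hom M G) \<and> (\<forall>x\<in>carrier M. b x \<in> add_hom N G) \<and>
    (\<forall>x\<in>carrier M. \<forall>r\<in>carrier R. \<forall>y\<in>carrier N. b (x \<bullet>\<^bsub>M\<^esub> r) y = b x (r \<odot>\<^bsub>N\<^esub> y))"

sublocale Fr: comm_group Fr
  by (rule abelian_free_Abelian_group)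

lemma rels_closed: "tensor_rels R M N \<subseteq> carrier Fr"
proof -
  have d: "a - b \<in> carrier Fr" if "a \<in> carrier Fr" "b \<in> carrier Fr" for a b
    using that keys_diff[of a b] by auto
  show ?thesis
    unfolding tensor_rels_def
    by (intro Un_least subsetI; elim CollectE exE conjE; hypsubst; intro d)
      (simp_all add: M_smult N_smult)
qed

lemma null_subgroup: "subgroup (tensor_null R M N) Fr"
  unfolding tensor_null_def by (rule Fr.generate_is_subgroup[OF rels_closed])

lemma null_normal: "tensor_null R M N \<lhd> Fr"
  by (rule Fr.subgroup_imp_normal[OF null_subgroup])

lemma TG_sel:
  "carrier TG = cls ` carrier Fr" "\<zero>\<^bsub>TG\<^esub> = cls 0"
  "\<lbrakk>c \<in> carrier Fr; d \<in> carrier Fr\<rbrakk> \<Longrightarrow> cls c \<oplus>\<^bsub>TG\<^esub> cls d = cls (c + d)"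
  using normal.rcos_sum[OF null_normal, of c d] Fr.coset_mult_one[OF subgroup.subset[OF null_subgroup]]
  by (auto simp: tensor_group_def Let_def FactGroup_def RCOSETS_def cls_def)

lemma Fr_add_closed: "\<lbrakk>c \<in> carrier Fr; d \<in> carrier Fr\<rbrakk> \<Longrightarrow> c + d \<in> carrier Fr"
  using Fr.m_closed[of c d] by simp

lemma Fr_minus_closed: "c \<in> carrier Fr \<Longrightarrow> - c \<in> carrier Fr"
  by simp

lemma TG_abelian_group: "abelian_group TG"
proof (rule abelian_groupI)
  fix X assume "X \<in> carrier TG"
  then obtain c where c: "c \<in> carrier Fr" "X = cls c" by (auto simp: TG_sel(1))
  have 0: "0 \<in> carrier Fr" by simp
  show "\<zero>\<^bsub>TG\<^esub> \<oplus>\<^bsub>TG\<^esub> X = X"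
    using TG_sel(3)[OF 0 c(1)] c by (simp add: TG_sel(2))
  show "\<exists>Y\<in>carrier TG. Y \<oplus>\<^bsub>TG\<^esub> X = \<zero>\<^bsub>TG\<^esub>"
  proof (rule bexI)
    show "cls (- c) \<oplus>\<^bsub>TG\<^esub> X = \<zero>\<^bsub>TG\<^esub>"
      using TG_sel(3)[OF Fr_minus_closed[OF c(1)] c(1)] c by (simp add: TG_sel(2))
    show "cls (- c) \<in> carrier TG"
      using Fr_minus_closed[OF c(1)] unfolding TG_sel(1) by (rule imageI)
  qed
  fix Y assume "Y \<in> carrier TG"
  then obtain d where d: "d \<in> carrier Fr" "Y = cls d" by (auto simp: TG_sel(1))
  show "X \<oplus>\<^bsub>TG\<^esub> Y \<in> carrier TG" "X \<oplus>\<^bsub>TG\<^esub> Y = Y \<oplus>\<^bsub>TG\<^esub> X"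
    unfolding c(2) d(2) TG_sel(3)[OF c(1) d(1)] TG_sel(3)[OF d(1) c(1)] TG_sel(1)
    using Fr_add_closed[OF c(1) d(1)] by (auto simp: add.commute simp del: carrier_free_Abelian_group_iff)
  fix Z assume "Z \<in> carrier TG"
  then obtain e where e: "e \<in> carrier Fr" "Z = cls e" by (auto simp: TG_sel(1))
  show "X \<oplus>\<^bsub>TG\<^esub> Y \<oplus>\<^bsub>TG\<^esub> Z = X \<oplus>\<^bsub>TG\<^esub> (Y \<oplus>\<^bsub>TG\<^esub> Z)"
    unfolding c(2) d(2) e(2) using c d e Fr_add_closed
    by (simp add: TG_sel(3) add.assoc del: carrier_free_Abelian_group_iff)
next
  show "\<zero>\<^bsub>TG\<^esub> \<in> carrier TG" by (auto simp: TG_sel)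
qed

sublocale TG: abelian_group TG
  by (rule TG_abelian_group)

lemma cls_closed: "c \<in> carrier Fr \<Longrightarrow> cls c \<in> carrier TG"
  by (simp add: TG_sel(1) del: carrier_free_Abelian_group_iff)

lemma cls_minus:
  assumes "c \<in> carrier Fr"
  shows "cls (- c) = \<ominus>\<^bsub>TG\<^esub> cls c"
  using TG_sel(3)[OF Fr_minus_closed[OF assms] assms] TG.minus_equality[of "cls (- c)" "cls c"]
    cls_closed[OF assms] cls_closed[OF Fr_minus_closed[OF assms]] by (simp add: TG_sel(2))

lemma cls_diff:
  assumes "c \<in> carrier Fr" "d \<in> carrier Fr"
  shows "cls (c - d) = cls c \<ominus>\<^bsub>TG\<^esub> cls d"
  using TG_sel(3)[OF assms(1) Fr_minus_closed[OF assms(2)]] cls_minus[OF assms(2)]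
  by (simp add: TG.minus_eq)

lemma cls_eqD:
  "\<lbrakk>c \<in> carrier Fr; d \<in> carrier Fr; cls (c - d) = \<zero>\<^bsub>TG\<^esub>\<rbrakk> \<Longrightarrow> cls c = cls d"
  "\<lbrakk>c \<in> carrier Fr; d \<in> carrier Fr; e \<in> carrier Fr; cls (c - d - e) = \<zero>\<^bsub>TG\<^esub>\<rbrakk> \<Longrightarrow>
    cls c = cls d \<oplus>\<^bsub>TG\<^esub> cls e"
proof -
  assume c: "c \<in> carrier Fr" "d \<in> carrier Fr"
  note cl = cls_closed[OF c(1)] cls_closed[OF c(2)]
  show "cls c = cls d" if "cls (c - d) = \<zero>\<^bsub>TG\<^esub>"
    using that TG.minus_minus_eq_zero(1)[OF cl] unfolding cls_diff[OF c] by blast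
  have cd: "c - d \<in> carrier Fr"
    using Fr_add_closed[OF c(1) Fr_minus_closed[OF c(2)]] by simp
  show "cls c = cls d \<oplus>\<^bsub>TG\<^esub> cls e" if "e \<in> carrier Fr" "cls (c - d - e) = \<zero>\<^bsub>TG\<^esub>"
    using that(2) TG.minus_minus_eq_zero(2)[OF cl cls_closed[OF that(1)]]
    unfolding cls_diff[OF cd that(1)] cls_diff[OF c] by blast
qed

lemma cls_rel: "r \<in> tensor_rels R M N \<Longrightarrow> cls r = \<zero>\<^bsub>TG\<^esub>"
  using subgroup.rcos_const[OF null_subgroup Fr.is_group, of r]
    Fr.coset_mult_one[OF subgroup.subset[OF null_subgroup]] generate.incl[of r _ Fr]
  by (simp add: TG_sel(2) cls_def tensor_null_def)

lemma te_eq: "te x y = cls (frag_of (x, y))"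
  by (simp add: tensor_elem_def cls_def)

lemma te_closed [simp]: "\<lbrakk>x \<in> carrier M; y \<in> carrier N\<rbrakk> \<Longrightarrow> te x y \<in> carrier TG"
  unfolding te_eq by (rule cls_closed) simp

lemma te_add_left:
  assumes "x \<in> carrier M" "x' \<in> carrier M" "y \<in> carrier N"
  shows "te (x \<oplus>\<^bsub>M\<^esub> x') y = te x y \<oplus>\<^bsub>TG\<^esub> te x' y"
proof -
  have c: "frag_of (x \<oplus>\<^bsub>M\<^esub> x', y) \<in> carrier Fr" "frag_of (x, y) \<in> carrier Fr" "frag_of (x', y) \<in> carrier Fr"
    using assms by auto
  have "frag_of (x \<oplus>\<^bsub>M\<^esub> x', y) - frag_of (x, y) - frag_of (x', y) \<in> tensor_rels R M N"
    using assms unfolding tensor_rels_def by blast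
  then show ?thesis
    unfolding te_eq by (intro cls_eqD(2) c cls_rel)
qed

lemma te_add_right:
  assumes "x \<in> carrier M" "y \<in> carrier N" "y' \<in> carrier N"
  shows "te x (y \<oplus>\<^bsub>N\<^esub> y') = te x y \<oplus>\<^bsub>TG\<^esub> te x y'"
proof -
  have c: "frag_of (x, y \<oplus>\<^bsub>N\<^esub> y') \<in> carrier Fr" "frag_of (x, y) \<in> carrier Fr" "frag_of (x, y') \<in> carrier Fr"
    using assms by auto
  have "frag_of (x, y \<oplus>\<^bsub>N\<^esub> y') - frag_of (x, y) - frag_of (x, y') \<in> tensor_rels R M N"
    using assms unfolding tensor_rels_def by blast
  then show ?thesis
    unfolding te_eq by (intro cls_eqD(2) c cls_rel)
qed

lemma te_balanced:
  assumes "x \<in> carrier M" "r \<in> carrier R" "y \<in> carrier N"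
  shows "te (x \<bullet>\<^bsub>M\<^esub> r) y = te x (r \<odot>\<^bsub>N\<^esub> y)"
proof -
  have c: "frag_of (x \<bullet>\<^bsub>M\<^esub> r, y) \<in> carrier Fr" "frag_of (x, r \<odot>\<^bsub>N\<^esub> y) \<in> carrier Fr"
    using assms by (auto simp: M_smult N_smult)
  have "frag_of (x \<bullet>\<^bsub>M\<^esub> r, y) - frag_of (x, r \<odot>\<^bsub>N\<^esub> y) \<in> tensor_rels R M N"
    using assms unfolding tensor_rels_def by blast
  then show ?thesis
    unfolding te_eq by (intro cls_eqD(1) c cls_rel)
qed

lemma te_add_hom:
  "y \<in> carrier N \<Longrightarrow> (\<lambda>x. te x y) \<in> add_hom M TG"
  "x \<in> carrier M \<Longrightarrow> te x \<in> add_hom N TG"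
  by (auto intro!: add_homI simp: te_add_left te_add_right)

text \<open>Negatives are absorbed by -(x \<otimes> y) = (-x) \<otimes> y, so finite sums of
  elementary tensors exhaust the group.\<close>

lemma TG_induct [consumes 1, case_names elem add]:
  assumes "X \<in> carrier TG"
    and elem: "\<And>x y. \<lbrakk>x \<in> carrier M; y \<in> carrier N\<rbrakk> \<Longrightarrow> P (te x y)"
    and add: "\<And>X Y. \<lbrakk>X \<in> carrier TG; Y \<in> carrier TG; P X; P Y\<rbrakk> \<Longrightarrow> P (X \<oplus>\<^bsub>TG\<^esub> Y)"
  shows "P X"
proof -
  \<comment> \<open>The induction for free abelian groups combines elements by differences, while
    \<open>P\<close> is known to respect sums only. It is therefore carried for a class and its
    negative together.\<close>
  have "P (cls c) \<and> P (\<ominus>\<^bsub>TG\<^esub> cls c)" if "Poly_Mapping.keys c \<subseteq> carrier M \<times> carrier N" for c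
    using that
  proof (induction c rule: free_Abelian_group_induct[consumes 1])
    case 1
    have "te \<zero>\<^bsub>M\<^esub> \<zero>\<^bsub>N\<^esub> = \<zero>\<^bsub>TG\<^esub>"
      by (rule add_hom_zero[OF N.abelian_group_axioms TG_abelian_group te_add_hom(2)]) simp
    then have "P \<zero>\<^bsub>TG\<^esub>" using elem[of "\<zero>\<^bsub>M\<^esub>" "\<zero>\<^bsub>N\<^esub>"] by simp
    moreover have "\<ominus>\<^bsub>TG\<^esub> \<zero>\<^bsub>TG\<^esub> = \<zero>\<^bsub>TG\<^esub>" by (rule TG.minus_equality) simp_all
    ultimately show ?case unfolding TG_sel(2)[symmetric] by (simp only:)
  next
    case (2 c d)
    then have c: "c \<in> carrier Fr" "d \<in> carrier Fr" by simp_all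
    note cl = cls_closed[OF c(1)] cls_closed[OF c(2)]
    show ?case
      unfolding cls_diff[OF c] using 2(3,4) cl
      by (simp add: TG.minus_eq TG.minus_add add)
  next
    case (3 p)
    then obtain x y where p: "p = (x, y)" "x \<in> carrier M" "y \<in> carrier N" by auto
    have "te (\<ominus>\<^bsub>M\<^esub> x) y = \<ominus>\<^bsub>TG\<^esub> te x y"
      by (rule add_hom_minus[OF M.abelian_group_axioms TG_abelian_group te_add_hom(1)]) (use p in auto)
    then show ?case
      using p elem[of x y] elem[of "\<ominus>\<^bsub>M\<^esub> x" y] by (simp add: te_eq)
  qed
  with assms(1) show ?thesis by (auto simp: TG_sel(1))
qed

lemma balancedD:
  assumes "balanced G b"
  shows "y \<in> carrier N \<Longrightarrow> (\<lambda>x. b x y) \<in> add_hom M G" "x \<in> carrier M \<Longrightarrow> b x \<in> add_hom N G"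
    "\<lbrakk>x \<in> carrier M; r \<in> carrier R; y \<in> carrier N\<rbrakk> \<Longrightarrow> b (x \<bullet>\<^bsub>M\<^esub> r) y = b x (r \<odot>\<^bsub>N\<^esub> y)"
  using assms unfolding balanced_def by blast+

context
  fixes G :: "('g, 'b) ring_scheme" and b :: "'m \<Rightarrow> 'n \<Rightarrow> 'g"
  assumes G: "abelian_group G" and b: "balanced G b"
begin

interpretation G: abelian_group G by (rule G)

lemma b_closed: "\<lbrakk>x \<in> carrier M; y \<in> carrier N\<rbrakk> \<Longrightarrow> b x y \<in> carrier G"
  using add_hom_closed[OF balancedD(2)[OF b]] .

text \<open>\<open>tensor_lift\<close> is an explicit sum over a support, from which additivity is
  awkward to read off. The last clause identifies that sum with the homomorphism given by the
  universal property of the free abelian group.\<close>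

lemma tensor_lift_exists:
  "\<exists>h. (\<forall>c\<in>carrier Fr. h c \<in> carrier G) \<and>
    (\<forall>c\<in>carrier Fr. \<forall>d\<in>carrier Fr. h (c + d) = h c \<oplus>\<^bsub>G\<^esub> h d) \<and>
    (\<forall>x\<in>carrier M. \<forall>y\<in>carrier N. h (frag_of (x, y)) = b x y) \<and>
    (\<forall>c\<in>carrier Fr. h c = (\<Oplus>\<^bsub>G\<^esub>p\<in>Poly_Mapping.keys c. [Poly_Mapping.lookup c p] \<cdot>\<^bsub>G\<^esub> b (fst p) (snd p)))"
proof -
  have im: "(\<lambda>p. b (fst p) (snd p)) ` (carrier M \<times> carrier N) \<subseteq> carrier (add_monoid G)"
    using b_closed by auto
  obtain h where h: "h \<in> hom Fr (add_monoid G)"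
    "\<And>p. p \<in> carrier M \<times> carrier N \<Longrightarrow> h (frag_of p) = b (fst p) (snd p)"
    using comm_group.free_Abelian_group_universal[OF G.a_comm_group im] by metis
  have hc: "h c \<in> carrier G" if "c \<in> carrier Fr" for c
    using hom_in_carrier[OF h(1) that] by simp
  have ha: "h (c + d) = h c \<oplus>\<^bsub>G\<^esub> h d" if "c \<in> carrier Fr" "d \<in> carrier Fr" for c d
    using hom_mult[OF h(1) that] by simp
  have cmul: "frag_cmul n (frag_of p) \<in> carrier Fr" if "p \<in> carrier M \<times> carrier N" for n p
    using that keys_cmul[of n "frag_of p"] by auto
  have hm: "h (frag_cmul n (frag_of p)) = [n] \<cdot>\<^bsub>G\<^esub> b (fst p) (snd p)"
    if "p \<in> carrier M \<times> carrier N" for n :: int and p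
    using hom_int_pow[OF h(1), of "frag_of p" n] that h(2)[OF that] G.a_group Fr.is_group
    by (simp add: add_pow_def)
  have sum: "(\<Sum>p\<in>P. frag_cmul (n p) (frag_of p)) \<in> carrier Fr \<and>
      h (\<Sum>p\<in>P. frag_cmul (n p) (frag_of p)) = (\<Oplus>\<^bsub>G\<^esub>p\<in>P. [n p] \<cdot>\<^bsub>G\<^esub> b (fst p) (snd p))"
    if "finite P" "P \<subseteq> carrier M \<times> carrier N" for P and n :: "_ \<Rightarrow> int"
    using that
  proof (induction P rule: finite_induct)
    case empty
    then show ?case
      using hom_one[OF h(1) Fr.is_group G.a_group] by simp
  next
    case (insert p P)
    have p: "p \<in> carrier M \<times> carrier N" using insert.prems by blast
    have "(\<lambda>p. [n p] \<cdot>\<^bsub>G\<^esub> b (fst p) (snd p)) \<in> insert p P \<rightarrow> carrier G"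
      using insert.prems b_closed by (auto intro!: G.add.int_pow_closed)
    with insert p show ?case
      using Fr_add_closed[OF cmul[OF p, of "n p"]] ha[OF cmul[OF p, of "n p"]] hm[OF p]
      by (simp add: G.finsum_insert del: carrier_free_Abelian_group_iff)
  qed
  have "h c = (\<Oplus>\<^bsub>G\<^esub>p\<in>Poly_Mapping.keys c. [Poly_Mapping.lookup c p] \<cdot>\<^bsub>G\<^esub> b (fst p) (snd p))"
    if "c \<in> carrier Fr" for c
    using that sum[of "Poly_Mapping.keys c" "Poly_Mapping.lookup c"]
      frag_expansion[of c] by (simp add: frag_extend_def)
  with hc ha h(2) show ?thesis by (intro exI[of _ h]) auto
qed

lemma tensor_lift_props:
  "tensor_lift G b \<in> add_hom TG G"
  "\<lbrakk>x \<in> carrier M; y \<in> carrier N\<rbrakk> \<Longrightarrow> tensor_lift G b (te x y) = b x y"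
proof -
  obtain h where hc: "\<And>c. c \<in> carrier Fr \<Longrightarrow> h c \<in> carrier G"
    and ha: "\<And>c d. \<lbrakk>c \<in> carrier Fr; d \<in> carrier Fr\<rbrakk> \<Longrightarrow> h (c + d) = h c \<oplus>\<^bsub>G\<^esub> h d"
    and hf: "\<And>x y. \<lbrakk>x \<in> carrier M; y \<in> carrier N\<rbrakk> \<Longrightarrow> h (frag_of (x, y)) = b x y"
    and he: "\<And>c. c \<in> carrier Fr \<Longrightarrow>
      h c = (\<Oplus>\<^bsub>G\<^esub>p\<in>Poly_Mapping.keys c. [Poly_Mapping.lookup c p] \<cdot>\<^bsub>G\<^esub> b (fst p) (snd p))"
    using tensor_lift_exists by blast
  interpret h: group_hom Fr "add_monoid G" h
    using hc ha Fr.is_group G.a_group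
    by (auto simp: group_hom_def group_hom_axioms_def hom_def simp del: carrier_free_Abelian_group_iff)
  have hm: "h (- c) = \<ominus>\<^bsub>G\<^esub> h c" if "c \<in> carrier Fr" for c
    using h.hom_inv[OF that] that by (simp add: a_inv_def)
  have hd: "h (c - d) = h c \<ominus>\<^bsub>G\<^esub> h d" if "c \<in> carrier Fr" "d \<in> carrier Fr" for c d
    using ha[OF that(1) Fr_minus_closed[OF that(2)]] hm[OF that(2)] by (simp add: G.minus_eq)
  have fc: "frag_of (x, y) \<in> carrier Fr" if "x \<in> carrier M" "y \<in> carrier N" for x y
    using that by simp
  have dc: "c - d \<in> carrier Fr" if "c \<in> carrier Fr" "d \<in> carrier Fr" for c d
    using Fr_add_closed[OF that(1) Fr_minus_closed[OF that(2)]] by simp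
  note sms = hd hf fc dc b_closed M_smult N_smult
  have rel: "h c = \<zero>\<^bsub>G\<^esub>" if "c \<in> tensor_rels R M N" for c
  proof -
    have 1: "h (frag_of (x \<oplus>\<^bsub>M\<^esub> x', y) - frag_of (x, y) - frag_of (x', y)) = \<zero>\<^bsub>G\<^esub>"
      if "x \<in> carrier M" "x' \<in> carrier M" "y \<in> carrier N" for x x' y
      using that add_hom_add[OF balancedD(1)[OF b that(3)] that(1,2)]
      by (simp add: sms G.minus_minus_eq_zero(2) del: carrier_free_Abelian_group_iff)
    have 2: "h (frag_of (x, y \<oplus>\<^bsub>N\<^esub> y') - frag_of (x, y) - frag_of (x, y')) = \<zero>\<^bsub>G\<^esub>"
      if "x \<in> carrier M" "y \<in> carrier N" "y' \<in> carrier N" for x y y'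
      using that add_hom_add[OF balancedD(2)[OF b that(1)] that(2,3)]
      by (simp add: sms G.minus_minus_eq_zero(2) del: carrier_free_Abelian_group_iff)
    have 3: "h (frag_of (x \<bullet>\<^bsub>M\<^esub> r, y) - frag_of (x, r \<odot>\<^bsub>N\<^esub> y)) = \<zero>\<^bsub>G\<^esub>"
      if "x \<in> carrier M" "r \<in> carrier R" "y \<in> carrier N" for x r y
      using that balancedD(3)[OF b that]
      by (simp add: sms G.minus_minus_eq_zero(1) del: carrier_free_Abelian_group_iff)
    show ?thesis
      using that unfolding tensor_rels_def
      by (elim UnE CollectE exE conjE) (simp_all only: 1 2 3)
  qed
  have "tensor_rels R M N \<subseteq> kernel Fr (add_monoid G) h"
    using rel rels_closed unfolding kernel_def by (auto simp del: carrier_free_Abelian_group_iff)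
  then have null: "tensor_null R M N \<subseteq> kernel Fr (add_monoid G) h"
    unfolding tensor_null_def by (rule Fr.generate_subgroup_incl[OF _ h.subgroup_kernel])
  \<comment> \<open>\<open>tensor_lift\<close> evaluates at a chosen member of the coset, which
    differs from \<open>c\<close> by an element of the null subgroup. There \<open>h\<close>
    vanishes, so the choice is immaterial.\<close>
  have lift: "tensor_lift G b (cls c) = h c" if "c \<in> carrier Fr" for c
  proof -
    define d where "d = (SOME d. d \<in> cls c)"
    have "c \<in> cls c"
      unfolding cls_def using Fr.rcos_self[OF that null_subgroup] .
    then have "d \<in> cls c" unfolding d_def by (rule someI)
    then obtain z where z: "z \<in> tensor_null R M N" "d = z + c"
      by (auto simp: cls_def r_coset_def)
    then have zk: "z \<in> carrier Fr" "h z = \<zero>\<^bsub>G\<^esub>"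
      using null by (auto simp: kernel_def)
    have d: "d \<in> carrier Fr" "h d = h c"
      unfolding z(2) using Fr_add_closed[OF zk(1) that] ha[OF zk(1) that] zk(2) hc[OF that]
      by (simp_all del: carrier_free_Abelian_group_iff)
    show ?thesis
      using he[OF d(1)] d(2) by (simp add: tensor_lift_def d_def Let_def)
  qed
  show "tensor_lift G b \<in> add_hom TG G"
  proof (rule add_homI)
    fix X assume "X \<in> carrier TG"
    then obtain c where c: "c \<in> carrier Fr" "X = cls c" unfolding TG_sel(1) by blast
    then show "tensor_lift G b X \<in> carrier G" using lift hc by simp
    fix Y assume "Y \<in> carrier TG"
    then obtain d where d: "d \<in> carrier Fr" "Y = cls d" unfolding TG_sel(1) by blast
    show "tensor_lift G b (X \<oplus>\<^bsub>TG\<^esub> Y) = tensor_lift G b X \<oplus>\<^bsub>G\<^esub> tensor_lift G b Y"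
      unfolding c(2) d(2) TG_sel(3)[OF c(1) d(1)] lift[OF c(1)] lift[OF d(1)]
        lift[OF Fr_add_closed[OF c(1) d(1)]] by (rule ha[OF c(1) d(1)])
  qed
  show "tensor_lift G b (te x y) = b x y" if "x \<in> carrier M" "y \<in> carrier N"
    unfolding te_eq lift[OF fc[OF that]] by (rule hf[OF that])
qed

end

lemma add_hom_eqI:
  assumes "f \<in> add_hom TG G" "g \<in> add_hom TG G"
    and "\<And>x y. \<lbrakk>x \<in> carrier M; y \<in> carrier N\<rbrakk> \<Longrightarrow> f (te x y) = g (te x y)"
    and "X \<in> carrier TG"
  shows "f X = g X"
  using assms(4)
proof (induction rule: TG_induct)
  case (add X Y)
  then show ?case
    using add_hom_add[OF assms(1) add(1,2)] add_hom_add[OF assms(2) add(1,2)] by simp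
qed (rule assms(3))

end

section \<open>Composites, sums and differences of additive maps\<close>

lemma add_hom_compose:
  "\<lbrakk>f \<in> add_hom G H; g \<in> add_hom H J\<rbrakk> \<Longrightarrow> (\<lambda>x. g (f x)) \<in> add_hom G J"
  by (auto intro!: add_homI simp: add_hom_closed add_hom_add)

lemma add_hom_plus:
  assumes "abelian_group H" "f \<in> add_hom G H" "g \<in> add_hom G H"
  shows "(\<lambda>x. f x \<oplus>\<^bsub>H\<^esub> g x) \<in> add_hom G H"
proof -
  interpret H: abelian_group H by fact
  show ?thesis
    using assms(2,3) by (auto simp: add_hom_def Pi_iff H.a_ac)
qed

lemma add_hom_sub:
  assumes "abelian_group H" "f \<in> add_hom G H" "g \<in> add_hom G H"
  shows "(\<lambda>x. f x \<ominus>\<^bsub>H\<^esub> g x) \<in> add_hom G H"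
proof -
  interpret H: abelian_group H by fact
  show ?thesis
    using assms(2,3) by (auto simp: add_hom_def Pi_iff H.a_ac H.minus_eq H.minus_add)
qed

section \<open>Extension of scalars\<close>

locale ind_left_mod = R: ring R + S: ring S + N: left_module R N
  for R :: "'r ring" and h :: "'r \<Rightarrow> 's" and S :: "'s ring" and N :: "('r, 'n) module" +
  assumes h: "h \<in> ring_hom R S"
begin

lemma h_closed [simp]: "r \<in> carrier R \<Longrightarrow> h r \<in> carrier S"
  using h by (rule ring_hom_closed)

sublocale tp: tensor_prod "right_mod S (\<lambda>s r. s \<otimes>\<^bsub>S\<^esub> h r)" N R
  by (simp add: tensor_prod_def tensor_prod_axioms_def S.is_abelian_group N.abelian_group_axioms
      N.lsmult_closed)

abbreviation "I \<equiv> ind_left R h S N"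
abbreviation "e \<equiv> ind_left_elem R h S N"

lemma e_eq: "e = tp.te"
  by (simp add: ind_left_elem_def)

lemma I_sel [simp]: "carrier I = carrier tp.TG" "add I = add tp.TG" "\<zero>\<^bsub>I\<^esub> = \<zero>\<^bsub>tp.TG\<^esub>"
  by (simp_all add: ind_left_def Let_def)

lemma add_hom_I [simp]: "add_hom I G = add_hom tp.TG G" "add_hom G I = add_hom G tp.TG"
  by (simp_all add: add_hom_def)

lemma e_closed [simp]: "\<lbrakk>s \<in> carrier S; x \<in> carrier N\<rbrakk> \<Longrightarrow> e s x \<in> carrier tp.TG"
  by (simp add: e_eq)

lemma e_add_hom:
  "x \<in> carrier N \<Longrightarrow> (\<lambda>s. e s x) \<in> add_hom S tp.TG" "s \<in> carrier S \<Longrightarrow> e s \<in> add_hom N tp.TG"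
  using tp.te_add_hom by (simp_all add: e_eq)

lemma e_balanced:
  "\<lbrakk>s \<in> carrier S; r \<in> carrier R; x \<in> carrier N\<rbrakk> \<Longrightarrow> e (s \<otimes>\<^bsub>S\<^esub> h r) x = e s (r \<odot>\<^bsub>N\<^esub> x)"
  using tp.te_balanced[of s r x] by (simp add: e_eq)

text \<open>By associativity, left multiplication by \<open>u\<close> commutes with right
  multiplication by \<open>h r\<close>, so it respects the balancing relations and descends to the
  tensor product.\<close>

lemma act_props:
  assumes "u \<in> carrier S"
  shows "(\<lambda>X. u \<odot>\<^bsub>I\<^esub> X) \<in> add_hom tp.TG tp.TG"
    and "\<lbrakk>s \<in> carrier S; x \<in> carrier N\<rbrakk> \<Longrightarrow> u \<odot>\<^bsub>I\<^esub> e s x = e (u \<otimes>\<^bsub>S\<^esub> s) x"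
proof -
  have "tp.balanced tp.TG (\<lambda>s x. e (u \<otimes>\<^bsub>S\<^esub> s) x)"
    unfolding tp.balanced_def
  proof (intro conjI ballI)
    fix x assume "x \<in> carrier N"
    then show "(\<lambda>s. e (u \<otimes>\<^bsub>S\<^esub> s) x) \<in> add_hom (right_mod S (\<lambda>s r. s \<otimes>\<^bsub>S\<^esub> h r)) tp.TG"
      using assms by (auto intro!: add_homI simp: S.r_distr add_hom_add[OF e_add_hom(1)])
  next
    fix s assume "s \<in> carrier (right_mod S (\<lambda>s r. s \<otimes>\<^bsub>S\<^esub> h r))"
    then show "e (u \<otimes>\<^bsub>S\<^esub> s) \<in> add_hom N tp.TG" using assms by (simp add: e_add_hom(2))
    fix r x assume "r \<in> carrier R" "x \<in> carrier N"
    with \<open>s \<in> _\<close> assms show "e (u \<otimes>\<^bsub>S\<^esub> (s \<bullet>\<^bsub>right_mod S (\<lambda>s r. s \<otimes>\<^bsub>S\<^esub> h r)\<^esub> r)) x = e (u \<otimes>\<^bsub>S\<^esub> s) (r \<odot>\<^bsub>N\<^esub> x)"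
      using e_balanced[of "u \<otimes>\<^bsub>S\<^esub> s" r x] by (simp add: S.m_assoc)
  qed
  note lift = tp.tensor_lift_props[OF tp.TG_abelian_group this]
  have eq: "u \<odot>\<^bsub>I\<^esub> X = tensor_lift tp.TG (\<lambda>s x. e (u \<otimes>\<^bsub>S\<^esub> s) x) X" for X
    by (simp add: ind_left_def Let_def)
  show "(\<lambda>X. u \<odot>\<^bsub>I\<^esub> X) \<in> add_hom tp.TG tp.TG"
    using lift(1) by (simp add: eq)
  show "u \<odot>\<^bsub>I\<^esub> e s x = e (u \<otimes>\<^bsub>S\<^esub> s) x" if "s \<in> carrier S" "x \<in> carrier N"
    using lift(2)[of s x] that unfolding eq by (simp add: e_eq)
qed

lemma I_induct [consumes 1, case_names elem add]:
  assumes "X \<in> carrier tp.TG"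
    and "\<And>s x. \<lbrakk>s \<in> carrier S; x \<in> carrier N\<rbrakk> \<Longrightarrow> P (e s x)"
    and "\<And>X Y. \<lbrakk>X \<in> carrier tp.TG; Y \<in> carrier tp.TG; P X; P Y\<rbrakk> \<Longrightarrow> P (X \<oplus>\<^bsub>tp.TG\<^esub> Y)"
  shows "P X"
  using assms(1) by (rule tp.TG_induct) (use assms(2,3) in \<open>simp_all add: e_eq\<close>)

lemma I_module: "left_module S I"
proof -
  have I: "abelian_group I"
    by (rule abelian_group_cong[OF tp.TG_abelian_group]) simp_all
  note cl = add_hom_closed[OF act_props(1)] and ad = add_hom_add[OF act_props(1)]
  \<comment> \<open>Both sides are additive in \<open>X\<close>, so the identity is decided on the
    elements \<open>e s x\<close>, where it follows from distributivity in \<open>S\<close> and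
    additivity of \<open>e\<close>.\<close>
  have "(u \<oplus>\<^bsub>S\<^esub> v) \<odot>\<^bsub>I\<^esub> X = u \<odot>\<^bsub>I\<^esub> X \<oplus>\<^bsub>tp.TG\<^esub> v \<odot>\<^bsub>I\<^esub> X"
    if "u \<in> carrier S" "v \<in> carrier S" "X \<in> carrier tp.TG" for u v X
    by (rule tp.add_hom_eqI[OF _ add_hom_plus[OF tp.TG_abelian_group] _ that(3)])
      (use that in \<open>simp_all add: act_props(1) act_props(2) S.l_distr add_hom_add[OF e_add_hom(1)] flip: e_eq\<close>)
  moreover have "(u \<otimes>\<^bsub>S\<^esub> v) \<odot>\<^bsub>I\<^esub> X = u \<odot>\<^bsub>I\<^esub> (v \<odot>\<^bsub>I\<^esub> X)"
    if "u \<in> carrier S" "v \<in> carrier S" "X \<in> carrier tp.TG" for u v X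
    by (rule tp.add_hom_eqI[OF act_props(1) add_hom_compose[OF act_props(1) act_props(1)] _ that(3)])
      (use that in \<open>simp_all add: act_props(2) S.m_assoc flip: e_eq\<close>)
  moreover have "\<one>\<^bsub>S\<^esub> \<odot>\<^bsub>I\<^esub> X = X" if "X \<in> carrier tp.TG" for X
    using that by (induction rule: I_induct) (simp_all add: act_props(2) ad)
  ultimately show ?thesis
    unfolding left_module_def left_module_axioms_def
    using I S.ring_axioms by (simp add: cl ad)
qed

end

locale ind_right_mod = R: ring R + S: ring S + M: right_module R M
  for R :: "'r ring" and h :: "'r \<Rightarrow> 's" and S :: "'s ring" and M :: "('r, 'm) rmodule" +
  assumes h: "h \<in> ring_hom R S"
begin

lemma h_closed [simp]: "r \<in> carrier R \<Longrightarrow> h r \<in> carrier S"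
  using h by (rule ring_hom_closed)

sublocale tp: tensor_prod M "left_mod S (\<lambda>r s. h r \<otimes>\<^bsub>S\<^esub> s)" R
  by (simp add: tensor_prod_def tensor_prod_axioms_def S.is_abelian_group M.abelian_group_axioms
      M.rsmult_closed)

abbreviation "I \<equiv> ind_right R h S M"
abbreviation "e \<equiv> ind_right_elem R h S M"

lemma e_eq: "e = tp.te"
  by (simp add: ind_right_elem_def)

lemma I_sel [simp]: "carrier I = carrier tp.TG" "add I = add tp.TG" "\<zero>\<^bsub>I\<^esub> = \<zero>\<^bsub>tp.TG\<^esub>"
  by (simp_all add: ind_right_def Let_def)

lemma add_hom_I [simp]: "add_hom I G = add_hom tp.TG G" "add_hom G I = add_hom G tp.TG"
  by (simp_all add: add_hom_def)

lemma e_closed [simp]: "\<lbrakk>x \<in> carrier M; s \<in> carrier S\<rbrakk> \<Longrightarrow> e x s \<in> carrier tp.TG"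
  by (simp add: e_eq)

lemma e_add_hom:
  "s \<in> carrier S \<Longrightarrow> (\<lambda>x. e x s) \<in> add_hom M tp.TG" "x \<in> carrier M \<Longrightarrow> e x \<in> add_hom S tp.TG"
  using tp.te_add_hom by (simp_all add: e_eq)

lemma e_balanced:
  "\<lbrakk>x \<in> carrier M; r \<in> carrier R; s \<in> carrier S\<rbrakk> \<Longrightarrow> e (x \<bullet>\<^bsub>M\<^esub> r) s = e x (h r \<otimes>\<^bsub>S\<^esub> s)"
  using tp.te_balanced[of x r s] by (simp add: e_eq)

lemma act_props:
  assumes "u \<in> carrier S"
  shows "(\<lambda>X. X \<bullet>\<^bsub>I\<^esub> u) \<in> add_hom tp.TG tp.TG"
    and "\<lbrakk>x \<in> carrier M; s \<in> carrier S\<rbrakk> \<Longrightarrow> e x s \<bullet>\<^bsub>I\<^esub> u = e x (s \<otimes>\<^bsub>S\<^esub> u)"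
proof -
  have "tp.balanced tp.TG (\<lambda>x s. e x (s \<otimes>\<^bsub>S\<^esub> u))"
    unfolding tp.balanced_def
  proof (intro conjI ballI)
    fix s assume s: "s \<in> carrier (left_mod S (\<lambda>r s. h r \<otimes>\<^bsub>S\<^esub> s))"
    then show "(\<lambda>x. e x (s \<otimes>\<^bsub>S\<^esub> u)) \<in> add_hom M tp.TG"
      using assms by (simp add: e_add_hom(1))
    fix r x assume "r \<in> carrier R" "x \<in> carrier M"
    with s assms show "e (x \<bullet>\<^bsub>M\<^esub> r) (s \<otimes>\<^bsub>S\<^esub> u) = e x ((r \<odot>\<^bsub>left_mod S (\<lambda>r s. h r \<otimes>\<^bsub>S\<^esub> s)\<^esub> s) \<otimes>\<^bsub>S\<^esub> u)"
      using e_balanced[of x r "s \<otimes>\<^bsub>S\<^esub> u"] by (simp add: S.m_assoc)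
  next
    fix x assume "x \<in> carrier M"
    then show "(\<lambda>s. e x (s \<otimes>\<^bsub>S\<^esub> u)) \<in> add_hom (left_mod S (\<lambda>r s. h r \<otimes>\<^bsub>S\<^esub> s)) tp.TG"
      using assms by (auto intro!: add_homI simp: S.l_distr add_hom_add[OF e_add_hom(2)])
  qed
  note lift = tp.tensor_lift_props[OF tp.TG_abelian_group this]
  have eq: "X \<bullet>\<^bsub>I\<^esub> u = tensor_lift tp.TG (\<lambda>x s. e x (s \<otimes>\<^bsub>S\<^esub> u)) X" for X
    by (simp add: ind_right_def Let_def)
  show "(\<lambda>X. X \<bullet>\<^bsub>I\<^esub> u) \<in> add_hom tp.TG tp.TG"
    using lift(1) by (simp add: eq)
  show "e x s \<bullet>\<^bsub>I\<^esub> u = e x (s \<otimes>\<^bsub>S\<^esub> u)" if "x \<in> carrier M" "s \<in> carrier S"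
    using lift(2)[of x s] that unfolding eq by (simp add: e_eq)
qed

lemma I_induct [consumes 1, case_names elem add]:
  assumes "X \<in> carrier tp.TG"
    and "\<And>x s. \<lbrakk>x \<in> carrier M; s \<in> carrier S\<rbrakk> \<Longrightarrow> P (e x s)"
    and "\<And>X Y. \<lbrakk>X \<in> carrier tp.TG; Y \<in> carrier tp.TG; P X; P Y\<rbrakk> \<Longrightarrow> P (X \<oplus>\<^bsub>tp.TG\<^esub> Y)"
  shows "P X"
  using assms(1) by (rule tp.TG_induct) (use assms(2,3) in \<open>simp_all add: e_eq\<close>)

lemma I_module: "right_module S I"
proof -
  have I: "abelian_group I"
    by (rule abelian_group_cong[OF tp.TG_abelian_group]) simp_all
  note cl = add_hom_closed[OF act_props(1)] and ad = add_hom_add[OF act_props(1)]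
  have "X \<bullet>\<^bsub>I\<^esub> (u \<oplus>\<^bsub>S\<^esub> v) = X \<bullet>\<^bsub>I\<^esub> u \<oplus>\<^bsub>tp.TG\<^esub> X \<bullet>\<^bsub>I\<^esub> v"
    if "u \<in> carrier S" "v \<in> carrier S" "X \<in> carrier tp.TG" for u v X
    by (rule tp.add_hom_eqI[OF _ add_hom_plus[OF tp.TG_abelian_group] _ that(3)])
      (use that in \<open>simp_all add: act_props(1) act_props(2) S.r_distr add_hom_add[OF e_add_hom(2)] flip: e_eq\<close>)
  moreover have "X \<bullet>\<^bsub>I\<^esub> (u \<otimes>\<^bsub>S\<^esub> v) = (X \<bullet>\<^bsub>I\<^esub> u) \<bullet>\<^bsub>I\<^esub> v"
    if "u \<in> carrier S" "v \<in> carrier S" "X \<in> carrier tp.TG" for u v X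
    by (rule tp.add_hom_eqI[OF act_props(1) add_hom_compose[OF act_props(1) act_props(1)] _ that(3)])
      (use that in \<open>simp_all add: act_props(2) S.m_assoc flip: e_eq\<close>)
  moreover have "X \<bullet>\<^bsub>I\<^esub> \<one>\<^bsub>S\<^esub> = X" if "X \<in> carrier tp.TG" for X
    using that by (induction rule: I_induct) (simp_all add: act_props(2) ad)
  ultimately show ?thesis
    unfolding right_module_def right_module_axioms_def
    using I S.ring_axioms by (simp add: cl ad)
qed

end

section \<open>The right module \<open>M \<otimes>\<^sub>A N\<close>\<close>

text \<open>Sign bookkeeping for operators of the form one action minus another, on M \<otimes> N
  and on Hom alike. In the last identity, which yields the bracket relation, p and u stand for the
  double actions, q and s for the mixed terms, r and v for the bracket terms.\<close>

lemma (in abelian_group) diff_identities: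
  shows "\<lbrakk>p \<in> carrier G; q \<in> carrier G; r \<in> carrier G\<rbrakk> \<Longrightarrow> (p \<oplus> r) \<ominus> (q \<oplus> r) = p \<ominus> q"
    and "\<lbrakk>p \<in> carrier G; q \<in> carrier G; r \<in> carrier G\<rbrakk> \<Longrightarrow> (p \<oplus> r) \<ominus> q = (p \<ominus> q) \<oplus> r"
    and "\<lbrakk>p \<in> carrier G; q \<in> carrier G; r \<in> carrier G; s \<in> carrier G\<rbrakk> \<Longrightarrow> (p \<oplus> q) \<ominus> (r \<oplus> s) = (p \<ominus> r) \<oplus> (q \<ominus> s)"
    and "\<lbrakk>p \<in> carrier G; q \<in> carrier G; r \<in> carrier G; s \<in> carrier G; u \<in> carrier G; v \<in> carrier G\<rbrakk> \<Longrightarrow> 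
      ((p \<oplus> r) \<ominus> q) \<ominus> (s \<ominus> u) = ((p \<ominus> s) \<ominus> (q \<ominus> (u \<oplus> v))) \<oplus> (r \<ominus> v)"
proof -
  have 1: "(p \<oplus> r) \<ominus> (q \<oplus> r) = p \<ominus> q" if "p \<in> carrier G" "q \<in> carrier G" "r \<in> carrier G" for p q r
  proof -
    have "(p \<oplus> r) \<ominus> (q \<oplus> r) = p \<oplus> (r \<oplus> (\<ominus> r \<oplus> \<ominus> q))"
      using that by (simp add: minus_eq minus_add a_assoc a_comm[of "\<ominus> q"])
    then show ?thesis
      using that by (simp add: r_neg2 minus_eq)
  qed
  then show "\<lbrakk>p \<in> carrier G; q \<in> carrier G; r \<in> carrier G\<rbrakk> \<Longrightarrow> (p \<oplus> r) \<ominus> (q \<oplus> r) = p \<ominus> q" .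
  show "(p \<oplus> r) \<ominus> q = (p \<ominus> q) \<oplus> r" if "p \<in> carrier G" "q \<in> carrier G" "r \<in> carrier G"
    using that by (simp add: minus_eq minus_add a_ac)
  show "(p \<oplus> q) \<ominus> (r \<oplus> s) = (p \<ominus> r) \<oplus> (q \<ominus> s)" if "p \<in> carrier G" "q \<in> carrier G" "r \<in> carrier G" "s \<in> carrier G"
    using that by (simp add: minus_eq minus_add a_ac)
  assume c: "p \<in> carrier G" "q \<in> carrier G" "r \<in> carrier G" "s \<in> carrier G" "u \<in> carrier G" "v \<in> carrier G"
  have "((p \<ominus> s) \<ominus> (q \<ominus> (u \<oplus> v))) \<oplus> (r \<ominus> v) = ((p \<oplus> r \<ominus> q \<ominus> s) \<oplus> u \<oplus> v) \<ominus> (\<zero> \<oplus> v)"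
    using c by (simp add: minus_eq minus_add minus_minus a_ac)
  also have "\<dots> = (p \<oplus> r \<ominus> q \<ominus> s) \<oplus> u \<ominus> \<zero>"
    by (rule 1) (use c in simp_all)
  also have "\<dots> = ((p \<oplus> r) \<ominus> q) \<ominus> (s \<ominus> u)"
    using c minus_equality[of \<zero> \<zero>] by (simp add: minus_eq minus_add minus_minus a_ac)
  finally show "((p \<oplus> r) \<ominus> q) \<ominus> (s \<ominus> u) = ((p \<ominus> s) \<ominus> (q \<ominus> (u \<oplus> v))) \<oplus> (r \<ominus> v)" ..
qed

text \<open>Solves (m \<otimes> n) x = mx \<otimes> n - m \<otimes> xn for m \<otimes> xn, and
  likewise recovers g(m) x from g(mx) and (x g)(m).\<close>

lemma (in abelian_group) diff_diff_cancel:
  "\<lbrakk>p \<in> carrier G; q \<in> carrier G\<rbrakk> \<Longrightarrow> p \<ominus> (p \<ominus> q) = q"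
  by (simp add: minus_eq minus_add minus_minus r_neg2)

context lie_rinehart
begin

lemma right_module_rels:
  assumes "right_module U M" and "m \<in> carrier M" "x \<in> carrier L"
  shows "a \<in> carrier A \<Longrightarrow> (m \<bullet>\<^bsub>M\<^esub> eL x) \<bullet>\<^bsub>M\<^esub> eA a = (m \<bullet>\<^bsub>M\<^esub> eA a) \<bullet>\<^bsub>M\<^esub> eL x \<oplus>\<^bsub>M\<^esub> m \<bullet>\<^bsub>M\<^esub> eA (anchor L x a)"
    and "y \<in> carrier L \<Longrightarrow> (m \<bullet>\<^bsub>M\<^esub> eL x) \<bullet>\<^bsub>M\<^esub> eL y = (m \<bullet>\<^bsub>M\<^esub> eL y) \<bullet>\<^bsub>M\<^esub> eL x \<oplus>\<^bsub>M\<^esub> m \<bullet>\<^bsub>M\<^esub> eL (bracket L x y)"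
    and "a \<in> carrier A \<Longrightarrow> m \<bullet>\<^bsub>M\<^esub> eL (a \<odot>\<^bsub>L\<^esub> x) = (m \<bullet>\<^bsub>M\<^esub> eA a) \<bullet>\<^bsub>M\<^esub> eL x"
proof -
  interpret U: ring U by (rule U_ring)
  interpret M: right_module U M by fact
  show "(m \<bullet>\<^bsub>M\<^esub> eL x) \<bullet>\<^bsub>M\<^esub> eA a = (m \<bullet>\<^bsub>M\<^esub> eA a) \<bullet>\<^bsub>M\<^esub> eL x \<oplus>\<^bsub>M\<^esub> m \<bullet>\<^bsub>M\<^esub> eA (anchor L x a)" if "a \<in> carrier A"
    using eL_eA[OF assms(3) that] assms that
      M.rsmult_assoc[of "eL x" "eA a" m, symmetric] M.rsmult_assoc[of "eA a" "eL x" m, symmetric]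
    by (simp add: M.rsmult_add_right)
  show "(m \<bullet>\<^bsub>M\<^esub> eL x) \<bullet>\<^bsub>M\<^esub> eL y = (m \<bullet>\<^bsub>M\<^esub> eL y) \<bullet>\<^bsub>M\<^esub> eL x \<oplus>\<^bsub>M\<^esub> m \<bullet>\<^bsub>M\<^esub> eL (bracket L x y)" if "y \<in> carrier L"
    using arg_cong[OF eL_eL[OF assms(3) that], of "\<lambda>u. m \<bullet>\<^bsub>M\<^esub> u"] assms that bracket_closed
    by (simp add: M.rsmult_add_right M.rsmult_assoc)
  show "m \<bullet>\<^bsub>M\<^esub> eL (a \<odot>\<^bsub>L\<^esub> x) = (m \<bullet>\<^bsub>M\<^esub> eA a) \<bullet>\<^bsub>M\<^esub> eL x" if "a \<in> carrier A"
    using assms that by (simp add: eL_smult M.rsmult_assoc)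
qed

lemma left_module_rels:
  assumes "left_module U N" and "n \<in> carrier N" "x \<in> carrier L"
  shows "a \<in> carrier A \<Longrightarrow> eL x \<odot>\<^bsub>N\<^esub> (eA a \<odot>\<^bsub>N\<^esub> n) = eA a \<odot>\<^bsub>N\<^esub> (eL x \<odot>\<^bsub>N\<^esub> n) \<oplus>\<^bsub>N\<^esub> eA (anchor L x a) \<odot>\<^bsub>N\<^esub> n"
    and "y \<in> carrier L \<Longrightarrow> eL x \<odot>\<^bsub>N\<^esub> (eL y \<odot>\<^bsub>N\<^esub> n) = eL y \<odot>\<^bsub>N\<^esub> (eL x \<odot>\<^bsub>N\<^esub> n) \<oplus>\<^bsub>N\<^esub> eL (bracket L x y) \<odot>\<^bsub>N\<^esub> n"
    and "a \<in> carrier A \<Longrightarrow> eL (a \<odot>\<^bsub>L\<^esub> x) \<odot>\<^bsub>N\<^esub> n = eA a \<odot>\<^bsub>N\<^esub> (eL x \<odot>\<^bsub>N\<^esub> n)"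
proof -
  interpret U: ring U by (rule U_ring)
  interpret N: left_module U N by fact
  show "eL x \<odot>\<^bsub>N\<^esub> (eA a \<odot>\<^bsub>N\<^esub> n) = eA a \<odot>\<^bsub>N\<^esub> (eL x \<odot>\<^bsub>N\<^esub> n) \<oplus>\<^bsub>N\<^esub> eA (anchor L x a) \<odot>\<^bsub>N\<^esub> n" if "a \<in> carrier A"
    using arg_cong[OF eL_eA[OF assms(3) that], of "\<lambda>u. u \<odot>\<^bsub>N\<^esub> n"] assms that
    by (simp add: N.lsmult_add_left N.lsmult_assoc)
  show "eL x \<odot>\<^bsub>N\<^esub> (eL y \<odot>\<^bsub>N\<^esub> n) = eL y \<odot>\<^bsub>N\<^esub> (eL x \<odot>\<^bsub>N\<^esub> n) \<oplus>\<^bsub>N\<^esub> eL (bracket L x y) \<odot>\<^bsub>N\<^esub> n" if "y \<in> carrier L"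
    using arg_cong[OF eL_eL[OF assms(3) that], of "\<lambda>u. u \<odot>\<^bsub>N\<^esub> n"] assms that bracket_closed
    by (simp add: N.lsmult_add_left N.lsmult_assoc)
  show "eL (a \<odot>\<^bsub>L\<^esub> x) \<odot>\<^bsub>N\<^esub> n = eA a \<odot>\<^bsub>N\<^esub> (eL x \<odot>\<^bsub>N\<^esub> n)" if "a \<in> carrier A"
    using assms that by (simp add: eL_smult N.lsmult_assoc)
qed

end

locale lr_tensor_mod = lie_rinehart k A \<phi> L +
    M: right_module "env k A \<phi> L" M + N: left_module "env k A \<phi> L" N
  for k :: "'k ring" and A :: "'a ring" and \<phi> :: "'k \<Rightarrow> 'a" and L :: "('a, 'l) lie_rinehart"
    and M :: "(('k, 'a, 'l) env, 'm) rmodule" and N :: "(('k, 'a, 'l) env, 'n) module"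
begin

sublocale tp: tensor_prod "restrict_right eA M" "restrict_left eA N" A
  by (simp add: tensor_prod_def tensor_prod_axioms_def restrict_right_def restrict_left_def
      M.abelian_group_axioms N.abelian_group_axioms M.rsmult_closed N.lsmult_closed)

abbreviation "P \<equiv> lr_tensor k A \<phi> L M N"
abbreviation "t \<equiv> lr_tensor_elem k A \<phi> L M N"

lemma t_eq: "t = tp.te"
  by (simp add: lr_tensor_elem_def)

lemma t_closed [simp]: "\<lbrakk>m \<in> carrier M; n \<in> carrier N\<rbrakk> \<Longrightarrow> t m n \<in> carrier tp.TG"
  by (simp add: t_eq)

lemma t_add_hom:
  "n \<in> carrier N \<Longrightarrow> (\<lambda>m. t m n) \<in> add_hom M tp.TG" "m \<in> carrier M \<Longrightarrow> t m \<in> add_hom N tp.TG"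
  using tp.te_add_hom by (simp_all add: t_eq)

lemmas t_add = add_hom_add[OF t_add_hom(1)] add_hom_add[OF t_add_hom(2)]

lemma t_balanced:
  "\<lbrakk>m \<in> carrier M; a \<in> carrier A; n \<in> carrier N\<rbrakk> \<Longrightarrow> t (m \<bullet>\<^bsub>M\<^esub> eA a) n = t m (eA a \<odot>\<^bsub>N\<^esub> n)"
  using tp.te_balanced[of m a n] by (simp add: t_eq)

lemma t_lift:
  assumes "abelian_group G"
    and "\<And>n. n \<in> carrier N \<Longrightarrow> (\<lambda>m. b m n) \<in> add_hom M G" "\<And>m. m \<in> carrier M \<Longrightarrow> b m \<in> add_hom N G"
    and "\<And>m a n. \<lbrakk>m \<in> carrier M; a \<in> carrier A; n \<in> carrier N\<rbrakk> \<Longrightarrow> b (m \<bullet>\<^bsub>M\<^esub> eA a) n = b m (eA a \<odot>\<^bsub>N\<^esub> n)"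
  shows "tensor_lift G b \<in> add_hom tp.TG G"
    and "\<lbrakk>m \<in> carrier M; n \<in> carrier N\<rbrakk> \<Longrightarrow> tensor_lift G b (t m n) = b m n"
proof -
  have "tp.balanced G b"
    unfolding tp.balanced_def using assms(2-4) by simp
  from tp.tensor_lift_props[OF assms(1) this]
  show "tensor_lift G b \<in> add_hom tp.TG G"
    "\<lbrakk>m \<in> carrier M; n \<in> carrier N\<rbrakk> \<Longrightarrow> tensor_lift G b (t m n) = b m n"
    by (simp_all add: t_eq)
qed

lemma t_eqI:
  assumes "f \<in> add_hom tp.TG G" "g \<in> add_hom tp.TG G"
    and "\<And>m n. \<lbrakk>m \<in> carrier M; n \<in> carrier N\<rbrakk> \<Longrightarrow> f (t m n) = g (t m n)"
    and "X \<in> carrier tp.TG"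
  shows "f X = g X"
  by (rule tp.add_hom_eqI[OF assms(1,2) _ assms(4)]) (use assms(3) in \<open>simp add: t_eq\<close>)

lemmas M_rels = right_module_rels[OF M.right_module_axioms]
lemmas N_rels = left_module_rels[OF N.left_module_axioms]

definition "ra a = tensor_lift tp.TG (\<lambda>m n. t (m \<bullet>\<^bsub>M\<^esub> eA a) n)"
definition "rl x = tensor_lift tp.TG (\<lambda>m n. t (m \<bullet>\<^bsub>M\<^esub> eL x) n \<ominus>\<^bsub>tp.TG\<^esub> t m (eL x \<odot>\<^bsub>N\<^esub> n))"

lemmas act_closed = M.rsmult_closed N.lsmult_closed

text \<open>Acting by \<open>a\<close> on the first factor is balanced because elements of
  \<open>A\<close> commute, hence so do their actions on \<open>M\<close>.\<close>

lemma ra: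
  assumes "a \<in> carrier A"
  shows "ra a \<in> add_hom tp.TG tp.TG"
    and "\<lbrakk>m \<in> carrier M; n \<in> carrier N\<rbrakk> \<Longrightarrow> ra a (t m n) = t (m \<bullet>\<^bsub>M\<^esub> eA a) n"
proof -
  have 1: "(\<lambda>m. t (m \<bullet>\<^bsub>M\<^esub> eA a) n) \<in> add_hom M tp.TG" if "n \<in> carrier N" for n
    by (rule add_hom_compose[OF M.act_add_hom t_add_hom(1)]) (use that assms in auto)
  have 2: "t (m \<bullet>\<^bsub>M\<^esub> eA a) \<in> add_hom N tp.TG" if "m \<in> carrier M" for m
    by (rule t_add_hom(2)) (use that assms in \<open>simp add: act_closed\<close>)
  have 3: "t ((m \<bullet>\<^bsub>M\<^esub> eA b) \<bullet>\<^bsub>M\<^esub> eA a) n = t (m \<bullet>\<^bsub>M\<^esub> eA a) (eA b \<odot>\<^bsub>N\<^esub> n)"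
    if "m \<in> carrier M" "b \<in> carrier A" "n \<in> carrier N" for m b n
  proof -
    have "eA b \<otimes>\<^bsub>U\<^esub> eA a = eA a \<otimes>\<^bsub>U\<^esub> eA b"
      using that assms phi.S.m_comm[of a b] by (simp flip: ring_hom_mult[OF eA_hom])
    then have "(m \<bullet>\<^bsub>M\<^esub> eA b) \<bullet>\<^bsub>M\<^esub> eA a = (m \<bullet>\<^bsub>M\<^esub> eA a) \<bullet>\<^bsub>M\<^esub> eA b"
      using that assms by (simp flip: M.rsmult_assoc)
    then show ?thesis
      using that assms t_balanced[of "m \<bullet>\<^bsub>M\<^esub> eA a" b n] by (simp add: act_closed)
  qed
  note lift = t_lift[OF tp.TG_abelian_group 1 2 3]
  show "ra a \<in> add_hom tp.TG tp.TG" unfolding ra_def by (rule lift(1))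
  show "\<lbrakk>m \<in> carrier M; n \<in> carrier N\<rbrakk> \<Longrightarrow> ra a (t m n) = t (m \<bullet>\<^bsub>M\<^esub> eA a) n"
    unfolding ra_def by (rule lift(2))
qed

text \<open>Neither term is balanced by itself. Moving \<open>a\<close> from m to n changes each of
  them by the same amount, m x(a) \<otimes> n with x(a) the anchor, so the difference is
  balanced.\<close>

lemma rl:
  assumes "x \<in> carrier L"
  shows "rl x \<in> add_hom tp.TG tp.TG"
    and "\<lbrakk>m \<in> carrier M; n \<in> carrier N\<rbrakk> \<Longrightarrow>
      rl x (t m n) = t (m \<bullet>\<^bsub>M\<^esub> eL x) n \<ominus>\<^bsub>tp.TG\<^esub> t m (eL x \<odot>\<^bsub>N\<^esub> n)"
proof -
  have 1: "(\<lambda>m. t (m \<bullet>\<^bsub>M\<^esub> eL x) n \<ominus>\<^bsub>tp.TG\<^esub> t m (eL x \<odot>\<^bsub>N\<^esub> n)) \<in> add_hom M tp.TG" if "n \<in> carrier N" for n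
    by (rule add_hom_sub[OF tp.TG_abelian_group add_hom_compose[OF M.act_add_hom t_add_hom(1)] t_add_hom(1)])
      (use that assms in \<open>auto simp: act_closed\<close>)
  have 2: "(\<lambda>n. t (m \<bullet>\<^bsub>M\<^esub> eL x) n \<ominus>\<^bsub>tp.TG\<^esub> t m (eL x \<odot>\<^bsub>N\<^esub> n)) \<in> add_hom N tp.TG" if "m \<in> carrier M" for m
    by (rule add_hom_sub[OF tp.TG_abelian_group t_add_hom(2) add_hom_compose[OF N.act_add_hom t_add_hom(2)]])
      (use that assms in \<open>auto simp: act_closed\<close>)
  have 3: "t ((m \<bullet>\<^bsub>M\<^esub> eA a) \<bullet>\<^bsub>M\<^esub> eL x) n \<ominus>\<^bsub>tp.TG\<^esub> t (m \<bullet>\<^bsub>M\<^esub> eA a) (eL x \<odot>\<^bsub>N\<^esub> n) =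
      t (m \<bullet>\<^bsub>M\<^esub> eL x) (eA a \<odot>\<^bsub>N\<^esub> n) \<ominus>\<^bsub>tp.TG\<^esub> t m (eL x \<odot>\<^bsub>N\<^esub> (eA a \<odot>\<^bsub>N\<^esub> n))"
    if "m \<in> carrier M" "a \<in> carrier A" "n \<in> carrier N" for m a n
    using that assms
    by (simp add: act_closed M_rels(1) N_rels(1) t_add tp.TG.diff_identities(1) flip: t_balanced)
  note lift = t_lift[OF tp.TG_abelian_group 1 2 3]
  show "rl x \<in> add_hom tp.TG tp.TG" unfolding rl_def by (rule lift(1))
  show "\<lbrakk>m \<in> carrier M; n \<in> carrier N\<rbrakk> \<Longrightarrow>
      rl x (t m n) = t (m \<bullet>\<^bsub>M\<^esub> eL x) n \<ominus>\<^bsub>tp.TG\<^esub> t m (eL x \<odot>\<^bsub>N\<^esub> n)"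
    unfolding rl_def by (rule lift(2))
qed

lemma action_exists:
  "\<exists>act. right_module U (right_mod tp.TG act) \<and> (\<forall>X\<in>carrier tp.TG.
     (\<forall>a\<in>carrier A. act X (eA a) = ra a X) \<and> (\<forall>x\<in>carrier L. act X (eL x) = rl x X))"
proof (rule right_module_exists[OF tp.TG_abelian_group ra(1) rl(1)])
  note plus = add_hom_plus[OF tp.TG_abelian_group]
  note diff = add_hom_diff[OF tp.TG_abelian_group tp.TG_abelian_group]
  note s = ra rl act_closed t_add
  note comp = add_hom_compose[of _ tp.TG tp.TG _ tp.TG]
  have id: "(\<lambda>X. X) \<in> add_hom tp.TG tp.TG" by (simp add: add_hom_def)
  fix X assume X: "X \<in> carrier tp.TG"
  show "ra \<one>\<^bsub>A\<^esub> X = X"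
    by (rule t_eqI[OF ra(1) id _ X]) (simp_all add: s ring_hom_one[OF eA_hom] M.rsmult_one)
  fix a assume a: "a \<in> carrier A"
  show "ra (a \<oplus>\<^bsub>A\<^esub> b) X = ra a X \<oplus>\<^bsub>tp.TG\<^esub> ra b X" if b: "b \<in> carrier A" for b
    by (rule t_eqI[OF ra(1) plus[OF ra(1)[OF a] ra(1)[OF b]] _ X])
      (use a b in \<open>simp_all add: s ring_hom_add[OF eA_hom] M.rsmult_add_right\<close>)
  show "ra (a \<otimes>\<^bsub>A\<^esub> b) X = ra b (ra a X)" if b: "b \<in> carrier A" for b
    by (rule t_eqI[OF ra(1) comp[OF ra(1)[OF a] ra(1)[OF b]] _ X])
      (use a b in \<open>simp_all add: s ring_hom_mult[OF eA_hom] M.rsmult_assoc\<close>)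
  fix x assume x: "x \<in> carrier L"
  show "ra a (rl x X) = rl x (ra a X) \<oplus>\<^bsub>tp.TG\<^esub> ra (anchor L x a) X"
    by (rule t_eqI[OF comp[OF rl(1)[OF x] ra(1)[OF a]] plus[OF comp[OF ra(1)[OF a] rl(1)[OF x]] ra(1)] _ X])
      (use a x in \<open>simp_all add: s diff[OF ra(1)] M_rels(1) tp.TG.diff_identities(2)\<close>)
  show "rl (a \<odot>\<^bsub>L\<^esub> x) X = rl x (ra a X)"
    by (rule t_eqI[OF rl(1) comp[OF ra(1)[OF a] rl(1)[OF x]] _ X])
      (use a x in \<open>simp_all add: s smult_closed M_rels(3) N_rels(3) flip: t_balanced\<close>)
next
  note plus = add_hom_plus[OF tp.TG_abelian_group]
  note diff = add_hom_diff[OF tp.TG_abelian_group tp.TG_abelian_group]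
  note comp = add_hom_compose[of _ tp.TG tp.TG _ tp.TG]
  fix X x y assume X: "X \<in> carrier tp.TG" and x: "x \<in> carrier L" and y: "y \<in> carrier L"
  show "rl (x \<oplus>\<^bsub>L\<^esub> y) X = rl x X \<oplus>\<^bsub>tp.TG\<^esub> rl y X"
    by (rule t_eqI[OF rl(1) plus[OF rl(1)[OF x] rl(1)[OF y]] _ X])
      (use x y in \<open>simp_all add: rl act_closed t_add add_hom_add[OF eL_hom] M.rsmult_add_right
         N.lsmult_add_left tp.TG.diff_identities(3)\<close>)
  have "rl y (rl x (t m n)) = rl x (rl y (t m n)) \<oplus>\<^bsub>tp.TG\<^esub> rl (bracket L x y) (t m n)"
    if mn: "m \<in> carrier M" "n \<in> carrier N" for m n
  proof -
    \<comment> \<open>Only the side of \<open>M\<close> is rewritten by its bracket relation here.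
      The mixed terms change places in the middle step, and the side of \<open>N\<close> is
      rewritten by its own bracket relation in the last one.\<close>
    have "rl y (rl x (t m n)) =
        ((t (m \<bullet>\<^bsub>M\<^esub> eL y \<bullet>\<^bsub>M\<^esub> eL x) n \<oplus>\<^bsub>tp.TG\<^esub> t (m \<bullet>\<^bsub>M\<^esub> eL (bracket L x y)) n)
          \<ominus>\<^bsub>tp.TG\<^esub> t (m \<bullet>\<^bsub>M\<^esub> eL x) (eL y \<odot>\<^bsub>N\<^esub> n))
        \<ominus>\<^bsub>tp.TG\<^esub> (t (m \<bullet>\<^bsub>M\<^esub> eL y) (eL x \<odot>\<^bsub>N\<^esub> n) \<ominus>\<^bsub>tp.TG\<^esub> t m (eL y \<odot>\<^bsub>N\<^esub> (eL x \<odot>\<^bsub>N\<^esub> n)))"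
      using x y mn by (simp add: ra rl act_closed diff[OF rl(1)] M_rels(2)[OF mn(1) x y] t_add bracket_closed)
    also have "\<dots> = ((t (m \<bullet>\<^bsub>M\<^esub> eL y \<bullet>\<^bsub>M\<^esub> eL x) n \<ominus>\<^bsub>tp.TG\<^esub> t (m \<bullet>\<^bsub>M\<^esub> eL y) (eL x \<odot>\<^bsub>N\<^esub> n))
        \<ominus>\<^bsub>tp.TG\<^esub> (t (m \<bullet>\<^bsub>M\<^esub> eL x) (eL y \<odot>\<^bsub>N\<^esub> n) \<ominus>\<^bsub>tp.TG\<^esub>
          (t m (eL y \<odot>\<^bsub>N\<^esub> (eL x \<odot>\<^bsub>N\<^esub> n)) \<oplus>\<^bsub>tp.TG\<^esub> t m (eL (bracket L x y) \<odot>\<^bsub>N\<^esub> n))))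
        \<oplus>\<^bsub>tp.TG\<^esub> (t (m \<bullet>\<^bsub>M\<^esub> eL (bracket L x y)) n \<ominus>\<^bsub>tp.TG\<^esub> t m (eL (bracket L x y) \<odot>\<^bsub>N\<^esub> n))"
      by (rule tp.TG.diff_identities(4)) (use x y mn in \<open>simp_all add: act_closed bracket_closed\<close>)
    also have "\<dots> = rl x (rl y (t m n)) \<oplus>\<^bsub>tp.TG\<^esub> rl (bracket L x y) (t m n)"
      using x y mn by (simp add: rl act_closed diff[OF rl(1)] N_rels(2)[OF mn(2) x y] t_add bracket_closed)
    finally show ?thesis .
  qed
  then show "rl y (rl x X) = rl x (rl y X) \<oplus>\<^bsub>tp.TG\<^esub> rl (bracket L x y) X"
    by (intro t_eqI[OF comp[OF rl(1)[OF x] rl(1)[OF y]] plus[OF comp[OF rl(1)[OF y] rl(1)[OF x]] rl(1)] _ X] bracket_closed x y)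
qed

text \<open>The action in \<open>lr_tensor\<close> is a choice, justified by
  \<open>action_exists\<close>. What is available about it afterwards is that it is a right module
  action and its values for generators of \<open>U\<close> on elementary tensors.\<close>

lemma P_spec:
  "right_module U P"
  "\<lbrakk>m \<in> carrier M; n \<in> carrier N; a \<in> carrier A\<rbrakk> \<Longrightarrow> t m n \<bullet>\<^bsub>P\<^esub> eA a = t (m \<bullet>\<^bsub>M\<^esub> eA a) n"
  "\<lbrakk>m \<in> carrier M; n \<in> carrier N; x \<in> carrier L\<rbrakk> \<Longrightarrow>
    t m n \<bullet>\<^bsub>P\<^esub> eL x = t (m \<bullet>\<^bsub>M\<^esub> eL x) n \<ominus>\<^bsub>tp.TG\<^esub> t m (eL x \<odot>\<^bsub>N\<^esub> n)"
  and P_sel [simp]: "carrier P = carrier tp.TG" "add P = add tp.TG" "\<zero>\<^bsub>P\<^esub> = \<zero>\<^bsub>tp.TG\<^esub>"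
proof -
  define Q where "Q act \<longleftrightarrow> right_module U (right_mod tp.TG act) \<and>
      (\<forall>m\<in>carrier M. \<forall>n\<in>carrier N.
         (\<forall>a\<in>carrier A. act (t m n) (eA a) = t (m \<bullet>\<^bsub>M\<^esub> eA a) n) \<and>
         (\<forall>x\<in>carrier L. act (t m n) (eL x) =
            t (m \<bullet>\<^bsub>M\<^esub> eL x) n \<ominus>\<^bsub>tp.TG\<^esub> t m (eL x \<odot>\<^bsub>N\<^esub> n)))" for act
  obtain act where "right_module U (right_mod tp.TG act)"
    "\<And>X a. \<lbrakk>X \<in> carrier tp.TG; a \<in> carrier A\<rbrakk> \<Longrightarrow> act X (eA a) = ra a X"
    "\<And>X x. \<lbrakk>X \<in> carrier tp.TG; x \<in> carrier L\<rbrakk> \<Longrightarrow> act X (eL x) = rl x X"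
    using action_exists by metis
  then have "Q act" unfolding Q_def by (simp add: ra rl)
  then have Q: "Q (SOME act. Q act)" by (rule someI[of Q])
  have P: "P = right_mod tp.TG (SOME act. Q act)"
    by (simp add: lr_tensor_def Let_def Q_def lr_tensor_group_def)
  show "right_module U P"
    "\<lbrakk>m \<in> carrier M; n \<in> carrier N; a \<in> carrier A\<rbrakk> \<Longrightarrow> t m n \<bullet>\<^bsub>P\<^esub> eA a = t (m \<bullet>\<^bsub>M\<^esub> eA a) n"
    "\<lbrakk>m \<in> carrier M; n \<in> carrier N; x \<in> carrier L\<rbrakk> \<Longrightarrow>
      t m n \<bullet>\<^bsub>P\<^esub> eL x = t (m \<bullet>\<^bsub>M\<^esub> eL x) n \<ominus>\<^bsub>tp.TG\<^esub> t m (eL x \<odot>\<^bsub>N\<^esub> n)"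
    using Q unfolding P Q_def by simp_all
  show "carrier P = carrier tp.TG" "add P = add tp.TG" "\<zero>\<^bsub>P\<^esub> = \<zero>\<^bsub>tp.TG\<^esub>"
    unfolding P by simp_all
qed

end

section \<open>The left module \<open>Hom\<^sub>A(M, S)\<close>\<close>

context lie_rinehart
begin

text \<open>Generators are split off on the left of \<open>u\<close>, and X(au) = (Xa)u moves them
  into the module element; the induction therefore needs \<open>X\<close> arbitrary, its hypothesis
  being applied at Xa.\<close>

lemma right_linearI:
  assumes "right_module U P" "right_module U Q" "g \<in> add_hom P Q"
    and eA: "\<And>X a. \<lbrakk>X \<in> carrier P; a \<in> carrier A\<rbrakk> \<Longrightarrow> g (X \<bullet>\<^bsub>P\<^esub> eA a) = g X \<bullet>\<^bsub>Q\<^esub> eA a"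
    and eL: "\<And>X x. \<lbrakk>X \<in> carrier P; x \<in> carrier L\<rbrakk> \<Longrightarrow> g (X \<bullet>\<^bsub>P\<^esub> eL x) = g X \<bullet>\<^bsub>Q\<^esub> eL x"
    and "u \<in> carrier U" "X \<in> carrier P"
  shows "g (X \<bullet>\<^bsub>P\<^esub> u) = g X \<bullet>\<^bsub>Q\<^esub> u"
proof -
  interpret P: right_module U P by fact
  interpret Q: right_module U Q by fact
  note g = add_hom_closed[OF assms(3)] add_hom_add[OF assms(3)]
  show ?thesis
    using assms(6,7)
  proof (induction arbitrary: X rule: env_induct)
    case (A a u)
    have "g (X \<bullet>\<^bsub>P\<^esub> (eA a \<otimes>\<^bsub>U\<^esub> u)) = g ((X \<bullet>\<^bsub>P\<^esub> eA a) \<bullet>\<^bsub>P\<^esub> u)"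
      using A by (simp add: P.rsmult_assoc)
    also have "\<dots> = g (X \<bullet>\<^bsub>P\<^esub> eA a) \<bullet>\<^bsub>Q\<^esub> u"
      using A by (simp add: P.rsmult_closed)
    finally show ?case using A by (simp add: eA Q.rsmult_assoc g)
  next
    case (L x u)
    have "g (X \<bullet>\<^bsub>P\<^esub> (eL x \<otimes>\<^bsub>U\<^esub> u)) = g ((X \<bullet>\<^bsub>P\<^esub> eL x) \<bullet>\<^bsub>P\<^esub> u)"
      using L by (simp add: P.rsmult_assoc)
    also have "\<dots> = g (X \<bullet>\<^bsub>P\<^esub> eL x) \<bullet>\<^bsub>Q\<^esub> u"
      using L by (simp add: P.rsmult_closed)
    finally show ?case using L by (simp add: eL Q.rsmult_assoc g)
  qed (simp_all add: P.rsmult_one Q.rsmult_one P.rsmult_add_right Q.rsmult_add_right P.rsmult_closed g)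
qed

text \<open>For left modules (au)X = a(uX): the generator that is split off acts last, so
  \<open>X\<close> stays fixed during the induction.\<close>

lemma left_linearI:
  assumes "left_module U P" "left_module U Q" "g \<in> add_hom P Q"
    and eA: "\<And>X a. \<lbrakk>X \<in> carrier P; a \<in> carrier A\<rbrakk> \<Longrightarrow> g (eA a \<odot>\<^bsub>P\<^esub> X) = eA a \<odot>\<^bsub>Q\<^esub> g X"
    and eL: "\<And>X x. \<lbrakk>X \<in> carrier P; x \<in> carrier L\<rbrakk> \<Longrightarrow> g (eL x \<odot>\<^bsub>P\<^esub> X) = eL x \<odot>\<^bsub>Q\<^esub> g X"
    and "u \<in> carrier U" "X \<in> carrier P"
  shows "g (u \<odot>\<^bsub>P\<^esub> X) = u \<odot>\<^bsub>Q\<^esub> g X"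
proof -
  interpret P: left_module U P by fact
  interpret Q: left_module U Q by fact
  note g = add_hom_closed[OF assms(3)] add_hom_add[OF assms(3)]
  show ?thesis
    using assms(6,7)
    by (induction rule: env_induct)
      (simp_all add: P.lsmult_one Q.lsmult_one P.lsmult_add_left Q.lsmult_add_left P.lsmult_closed
        P.lsmult_assoc Q.lsmult_assoc eA eL g)
qed

end

section \<open>The action of U on right A-linear maps\<close>

locale lr_hom_mod = lie_rinehart k A \<phi> L +
    M: right_module "env k A \<phi> L" M + S: right_module "env k A \<phi> L" S
  for k :: "'k ring" and A :: "'a ring" and \<phi> :: "'k \<Rightarrow> 'a" and L :: "('a, 'l) lie_rinehart"
    and M :: "(('k, 'a, 'l) env, 'm) rmodule" and S :: "(('k, 'a, 'l) env, 's) rmodule"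
begin

text \<open>Extensionality makes the module laws, which are equations between maps, follow from the
  values on \<open>carrier M\<close>.\<close>

definition "homs = {f \<in> add_hom M S \<inter> extensional (carrier M).
  \<forall>m\<in>carrier M. \<forall>a\<in>carrier A. f (m \<bullet>\<^bsub>M\<^esub> eA a) = f m \<bullet>\<^bsub>S\<^esub> eA a}"

definition hom_group :: "('m \<Rightarrow> 's) ring" where
  "hom_group = \<lparr>carrier = homs, mult = undefined, one = undefined,
     ring.zero = (\<lambda>m\<in>carrier M. \<zero>\<^bsub>S\<^esub>), add = (\<lambda>f g. \<lambda>m\<in>carrier M. f m \<oplus>\<^bsub>S\<^esub> g m)\<rparr>"

text \<open>The sign in \<open>hom_L\<close> makes evaluation \<open>M \<otimes>\<^sub>A Hom\<^sub>A(M, S) \<rightarrow> S\<close> a map of right \<open>U\<close>-modules.\<close>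

definition "hom_A a f = (\<lambda>m\<in>carrier M. f (m \<bullet>\<^bsub>M\<^esub> eA a))"
definition "hom_L x f = (\<lambda>m\<in>carrier M. f (m \<bullet>\<^bsub>M\<^esub> eL x) \<ominus>\<^bsub>S\<^esub> f m \<bullet>\<^bsub>S\<^esub> eL x)"

lemma homsD:
  assumes "f \<in> homs"
  shows "f \<in> add_hom M S" "m \<in> carrier M \<Longrightarrow> f m \<in> carrier S"
    "\<lbrakk>m \<in> carrier M; m' \<in> carrier M\<rbrakk> \<Longrightarrow> f (m \<oplus>\<^bsub>M\<^esub> m') = f m \<oplus>\<^bsub>S\<^esub> f m'"
    "\<lbrakk>m \<in> carrier M; a \<in> carrier A\<rbrakk> \<Longrightarrow> f (m \<bullet>\<^bsub>M\<^esub> eA a) = f m \<bullet>\<^bsub>S\<^esub> eA a"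
  using assms by (auto simp: homs_def add_hom_closed add_hom_add)

lemma restrict_homs:
  assumes "f \<in> add_hom M S"
    and "\<And>m a. \<lbrakk>m \<in> carrier M; a \<in> carrier A\<rbrakk> \<Longrightarrow> f (m \<bullet>\<^bsub>M\<^esub> eA a) = f m \<bullet>\<^bsub>S\<^esub> eA a"
  shows "restrict f (carrier M) \<in> homs"
  using assms M.abelian_group_axioms
  by (auto simp: homs_def M.rsmult_closed add_hom_def)

lemma homs_eqI:
  "\<lbrakk>f \<in> homs; g \<in> homs; \<And>m. m \<in> carrier M \<Longrightarrow> f m = g m\<rbrakk> \<Longrightarrow> f = g"
  by (auto simp: homs_def intro: extensionalityI)

lemma hom_group_sel [simp]:
  "carrier hom_group = homs"
  "m \<in> carrier M \<Longrightarrow> (f \<oplus>\<^bsub>hom_group\<^esub> g) m = f m \<oplus>\<^bsub>S\<^esub> g m"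
  "m \<in> carrier M \<Longrightarrow> \<zero>\<^bsub>hom_group\<^esub> m = \<zero>\<^bsub>S\<^esub>"
  by (simp_all add: hom_group_def)

lemma hom_apply [simp]:
  "m \<in> carrier M \<Longrightarrow> hom_A a f m = f (m \<bullet>\<^bsub>M\<^esub> eA a)"
  "m \<in> carrier M \<Longrightarrow> hom_L x f m = f (m \<bullet>\<^bsub>M\<^esub> eL x) \<ominus>\<^bsub>S\<^esub> f m \<bullet>\<^bsub>S\<^esub> eL x"
  by (simp_all add: hom_A_def hom_L_def)

lemma act_add_hom:
  "u \<in> carrier U \<Longrightarrow> (\<lambda>m. m \<bullet>\<^bsub>M\<^esub> u) \<in> add_hom M M" "u \<in> carrier U \<Longrightarrow> (\<lambda>m. m \<bullet>\<^bsub>S\<^esub> u) \<in> add_hom S S"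
  by (fact M.act_add_hom S.act_add_hom)+

lemma S_diff: "\<lbrakk>x \<in> carrier S; y \<in> carrier S; u \<in> carrier U\<rbrakk> \<Longrightarrow>
    (x \<ominus>\<^bsub>S\<^esub> y) \<bullet>\<^bsub>S\<^esub> u = x \<bullet>\<^bsub>S\<^esub> u \<ominus>\<^bsub>S\<^esub> y \<bullet>\<^bsub>S\<^esub> u"
  by (rule add_hom_diff[OF S.abelian_group_axioms S.abelian_group_axioms act_add_hom(2)])

lemmas M_rels = right_module_rels[OF M.right_module_axioms]
lemmas S_rels = right_module_rels[OF S.right_module_axioms]

lemma hom_group_abelian: "abelian_group hom_group"
proof -
  have add: "f \<oplus>\<^bsub>hom_group\<^esub> g \<in> homs" if "f \<in> homs" "g \<in> homs" for f g
    unfolding hom_group_def ring_record_simps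
    by (rule restrict_homs[OF add_hom_plus[OF S.abelian_group_axioms homsD(1)[OF that(1)] homsD(1)[OF that(2)]]])
      (use that in \<open>simp add: homsD S.rsmult_add_left\<close>)
  have zero: "\<zero>\<^bsub>hom_group\<^esub> \<in> homs"
    unfolding hom_group_def ring_record_simps
    by (rule restrict_homs)
      (use add_hom_zero[OF S.abelian_group_axioms S.abelian_group_axioms act_add_hom(2)]
        in \<open>simp_all add: add_hom_def\<close>)
  have minus: "(\<lambda>m\<in>carrier M. \<ominus>\<^bsub>S\<^esub> f m) \<in> homs" if "f \<in> homs" for f
    by (rule restrict_homs)
      (use that add_hom_minus[OF S.abelian_group_axioms S.abelian_group_axioms act_add_hom(2)]
        in \<open>auto intro!: add_homI simp: homsD S.minus_add\<close>)
  show ?thesis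
  proof (rule abelian_group_inverseI[where m = "\<lambda>f. \<lambda>m\<in>carrier M. \<ominus>\<^bsub>S\<^esub> f m"])
    fix f assume f: "f \<in> carrier hom_group"
    then show "(\<lambda>m\<in>carrier M. \<ominus>\<^bsub>S\<^esub> f m) \<in> carrier hom_group" by (simp add: minus)
    show "(\<lambda>m\<in>carrier M. \<ominus>\<^bsub>S\<^esub> f m) \<oplus>\<^bsub>hom_group\<^esub> f = \<zero>\<^bsub>hom_group\<^esub>"
      by (rule homs_eqI) (use f in \<open>simp_all add: add zero minus homsD S.l_neg\<close>)
    show "\<zero>\<^bsub>hom_group\<^esub> \<oplus>\<^bsub>hom_group\<^esub> f = f"
      by (rule homs_eqI) (use f in \<open>simp_all add: add zero homsD\<close>)
    fix g assume g: "g \<in> carrier hom_group"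
    show "f \<oplus>\<^bsub>hom_group\<^esub> g \<in> carrier hom_group" using f g by (simp add: add)
    show "f \<oplus>\<^bsub>hom_group\<^esub> g = g \<oplus>\<^bsub>hom_group\<^esub> f"
      by (rule homs_eqI) (use f g in \<open>simp_all add: add homsD S.a_comm\<close>)
    fix h assume h: "h \<in> carrier hom_group"
    show "f \<oplus>\<^bsub>hom_group\<^esub> g \<oplus>\<^bsub>hom_group\<^esub> h = f \<oplus>\<^bsub>hom_group\<^esub> (g \<oplus>\<^bsub>hom_group\<^esub> h)"
      by (rule homs_eqI) (use f g h in \<open>simp_all add: add homsD S.a_assoc\<close>)
  qed (simp add: zero)
qed

sublocale HG: abelian_group hom_group
  by (rule hom_group_abelian)

text \<open>Precomposition with the action of one element of \<open>A\<close> preserves right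
  A-linearity because \<open>A\<close> is commutative.\<close>

lemma hom_A_closed:
  assumes "f \<in> homs" "a \<in> carrier A"
  shows "hom_A a f \<in> homs"
  unfolding hom_A_def
proof (rule restrict_homs)
  show "(\<lambda>m. f (m \<bullet>\<^bsub>M\<^esub> eA a)) \<in> add_hom M S"
    by (rule add_hom_compose[OF act_add_hom(1) homsD(1)]) (use assms in simp_all)
  fix m b assume mb: "m \<in> carrier M" "b \<in> carrier A"
  have "eA b \<otimes>\<^bsub>U\<^esub> eA a = eA a \<otimes>\<^bsub>U\<^esub> eA b"
    using mb assms phi.S.m_comm[of a b] by (simp flip: ring_hom_mult[OF eA_hom])
  then have "f m \<bullet>\<^bsub>S\<^esub> eA b \<bullet>\<^bsub>S\<^esub> eA a = f m \<bullet>\<^bsub>S\<^esub> eA a \<bullet>\<^bsub>S\<^esub> eA b"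
    using mb assms by (simp add: homsD flip: S.rsmult_assoc)
  then show "f (m \<bullet>\<^bsub>M\<^esub> eA b \<bullet>\<^bsub>M\<^esub> eA a) = f (m \<bullet>\<^bsub>M\<^esub> eA a) \<bullet>\<^bsub>S\<^esub> eA b"
    using mb assms by (simp add: homsD M.rsmult_closed)
qed

text \<open>Each of the two terms fails to be right A-linear in m, and both fail by f(m) x(a) with
  x(a) the anchor; the defects cancel in the difference.\<close>

lemma hom_L_closed:
  assumes "f \<in> homs" "x \<in> carrier L"
  shows "hom_L x f \<in> homs"
  unfolding hom_L_def
proof (rule restrict_homs)
  show "(\<lambda>m. f (m \<bullet>\<^bsub>M\<^esub> eL x) \<ominus>\<^bsub>S\<^esub> f m \<bullet>\<^bsub>S\<^esub> eL x) \<in> add_hom M S"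
    by (rule add_hom_sub[OF S.abelian_group_axioms add_hom_compose[OF act_add_hom(1) homsD(1)]
          add_hom_compose[OF homsD(1) act_add_hom(2)]]) (use assms in simp_all)
  fix m a assume ma: "m \<in> carrier M" "a \<in> carrier A"
  have "f (m \<bullet>\<^bsub>M\<^esub> eL x) \<bullet>\<^bsub>S\<^esub> eA a = f (m \<bullet>\<^bsub>M\<^esub> eL x \<bullet>\<^bsub>M\<^esub> eA a)"
    using ma assms by (simp add: homsD M.rsmult_closed)
  also have "\<dots> = f (m \<bullet>\<^bsub>M\<^esub> eA a \<bullet>\<^bsub>M\<^esub> eL x) \<oplus>\<^bsub>S\<^esub> f m \<bullet>\<^bsub>S\<^esub> eA (anchor L x a)"
    using ma assms by (simp add: M_rels(1) homsD M.rsmult_closed)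
  finally show "f (m \<bullet>\<^bsub>M\<^esub> eA a \<bullet>\<^bsub>M\<^esub> eL x) \<ominus>\<^bsub>S\<^esub> f (m \<bullet>\<^bsub>M\<^esub> eA a) \<bullet>\<^bsub>S\<^esub> eL x =
      (f (m \<bullet>\<^bsub>M\<^esub> eL x) \<ominus>\<^bsub>S\<^esub> f m \<bullet>\<^bsub>S\<^esub> eL x) \<bullet>\<^bsub>S\<^esub> eA a"
    using ma assms
    by (simp add: homsD(2) homsD(4)[OF assms(1) ma] M.rsmult_closed S.rsmult_closed S_diff S_rels(1)
        S.diff_identities(1))
qed

lemma hom_A_add_hom: "a \<in> carrier A \<Longrightarrow> hom_A a \<in> add_hom hom_group hom_group"
  by (rule add_homI; (rule homs_eqI)?)
    (simp_all add: hom_A_closed HG.a_closed[simplified] M.rsmult_closed)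

lemma hom_L_add_hom: "x \<in> carrier L \<Longrightarrow> hom_L x \<in> add_hom hom_group hom_group"
  by (rule add_homI; (rule homs_eqI)?)
    (simp_all add: hom_L_closed HG.a_closed[simplified] M.rsmult_closed homsD S.rsmult_closed
      S.rsmult_add_left S.diff_identities(3))

lemma hom_action_exists:
  "\<exists>act. left_module U (left_mod hom_group act) \<and> (\<forall>f\<in>carrier hom_group.
     (\<forall>a\<in>carrier A. act (eA a) f = hom_A a f) \<and> (\<forall>x\<in>carrier L. act (eL x) f = hom_L x f))"
proof (rule left_module_exists[OF hom_group_abelian hom_A_add_hom hom_L_add_hom])
  note add = HG.a_closed[simplified]
  note cl = hom_A_closed hom_L_closed add homsD(2) M.rsmult_closed S.rsmult_closed
  fix f assume "f \<in> carrier hom_group"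
  then have f: "f \<in> homs" by simp
  show "hom_A \<one>\<^bsub>A\<^esub> f = f"
    by (rule homs_eqI) (use f in \<open>simp_all add: cl ring_hom_one[OF eA_hom] M.rsmult_one\<close>)
  {
    fix a b assume ab: "a \<in> carrier A" "b \<in> carrier A"
    show "hom_A (a \<oplus>\<^bsub>A\<^esub> b) f = hom_A a f \<oplus>\<^bsub>hom_group\<^esub> hom_A b f"
      by (rule homs_eqI)
        (use f ab in \<open>simp_all add: cl ring_hom_add[OF eA_hom] M.rsmult_add_right homsD(3)\<close>)
    show "hom_A (a \<otimes>\<^bsub>A\<^esub> b) f = hom_A a (hom_A b f)"
      by (rule homs_eqI) (use f ab in \<open>simp_all add: cl ring_hom_mult[OF eA_hom] M.rsmult_assoc\<close>)
  next
    fix x a assume xa: "x \<in> carrier L" "a \<in> carrier A"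
    show "hom_L x (hom_A a f) = hom_A a (hom_L x f) \<oplus>\<^bsub>hom_group\<^esub> hom_A (anchor L x a) f"
      by (rule homs_eqI)
        (use f xa in \<open>simp_all add: cl M_rels(1) homsD(3) S.diff_identities(2)\<close>)
  next
    fix a x assume xa: "a \<in> carrier A" "x \<in> carrier L"
    \<comment> \<open>In the second term, A-linearity of \<open>f\<close> turns f(m) a into
      f(ma).\<close>
    show "hom_L (a \<odot>\<^bsub>L\<^esub> x) f = hom_A a (hom_L x f)"
      by (rule homs_eqI)
        (use f xa in \<open>simp_all add: cl smult_closed M_rels(3) S_rels(3) homsD(4)[OF f]\<close>)
  next
    fix x y assume xy: "x \<in> carrier L" "y \<in> carrier L"
    show "hom_L (x \<oplus>\<^bsub>L\<^esub> y) f = hom_L x f \<oplus>\<^bsub>hom_group\<^esub> hom_L y f"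
      by (rule homs_eqI)
        (use f xy in \<open>simp_all add: cl add_hom_add[OF eL_hom] M.rsmult_add_right S.rsmult_add_right
           homsD(3) S.diff_identities(3)\<close>)
    show "hom_L x (hom_L y f) = hom_L y (hom_L x f) \<oplus>\<^bsub>hom_group\<^esub> hom_L (bracket L x y) f"
    proof (rule homs_eqI)
      fix m assume m: "m \<in> carrier M"
      \<comment> \<open>Precomposition reverses the order, so applying y and then x to
        \<open>f\<close> evaluates it at (mx)y, as a left action requires. The right action on
        \<open>S\<close> enters with a minus sign, which gives its bracket term the sign it has in
        \<open>hom_L (bracket L x y)\<close>.\<close>
      have "hom_L x (hom_L y f) m =
          (f (m \<bullet>\<^bsub>M\<^esub> eL x \<bullet>\<^bsub>M\<^esub> eL y) \<ominus>\<^bsub>S\<^esub> f (m \<bullet>\<^bsub>M\<^esub> eL x) \<bullet>\<^bsub>S\<^esub> eL y) \<ominus>\<^bsub>S\<^esub>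
          (f (m \<bullet>\<^bsub>M\<^esub> eL y) \<bullet>\<^bsub>S\<^esub> eL x \<ominus>\<^bsub>S\<^esub> f m \<bullet>\<^bsub>S\<^esub> eL y \<bullet>\<^bsub>S\<^esub> eL x)"
        using f xy m by (simp add: cl S_diff)
      also have "\<dots> = ((f (m \<bullet>\<^bsub>M\<^esub> eL y \<bullet>\<^bsub>M\<^esub> eL x) \<oplus>\<^bsub>S\<^esub> f (m \<bullet>\<^bsub>M\<^esub> eL (bracket L x y)))
            \<ominus>\<^bsub>S\<^esub> f (m \<bullet>\<^bsub>M\<^esub> eL x) \<bullet>\<^bsub>S\<^esub> eL y) \<ominus>\<^bsub>S\<^esub>
          (f (m \<bullet>\<^bsub>M\<^esub> eL y) \<bullet>\<^bsub>S\<^esub> eL x \<ominus>\<^bsub>S\<^esub> f m \<bullet>\<^bsub>S\<^esub> eL y \<bullet>\<^bsub>S\<^esub> eL x)"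
        using f xy m by (simp add: cl M_rels(2)[OF m xy] homsD(3) bracket_closed)
      also have "\<dots> = ((f (m \<bullet>\<^bsub>M\<^esub> eL y \<bullet>\<^bsub>M\<^esub> eL x) \<ominus>\<^bsub>S\<^esub> f (m \<bullet>\<^bsub>M\<^esub> eL y) \<bullet>\<^bsub>S\<^esub> eL x) \<ominus>\<^bsub>S\<^esub>
            (f (m \<bullet>\<^bsub>M\<^esub> eL x) \<bullet>\<^bsub>S\<^esub> eL y \<ominus>\<^bsub>S\<^esub>
              (f m \<bullet>\<^bsub>S\<^esub> eL y \<bullet>\<^bsub>S\<^esub> eL x \<oplus>\<^bsub>S\<^esub> f m \<bullet>\<^bsub>S\<^esub> eL (bracket L x y)))) \<oplus>\<^bsub>S\<^esub>
          (f (m \<bullet>\<^bsub>M\<^esub> eL (bracket L x y)) \<ominus>\<^bsub>S\<^esub> f m \<bullet>\<^bsub>S\<^esub> eL (bracket L x y))"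
        by (rule S.diff_identities(4)) (use f xy m in \<open>simp_all add: cl bracket_closed\<close>)
      also have "f m \<bullet>\<^bsub>S\<^esub> eL y \<bullet>\<^bsub>S\<^esub> eL x \<oplus>\<^bsub>S\<^esub> f m \<bullet>\<^bsub>S\<^esub> eL (bracket L x y) = f m \<bullet>\<^bsub>S\<^esub> eL x \<bullet>\<^bsub>S\<^esub> eL y"
        by (rule S_rels(2)[OF homsD(2)[OF f m] xy, symmetric])
      finally show "hom_L x (hom_L y f) m = (hom_L y (hom_L x f) \<oplus>\<^bsub>hom_group\<^esub> hom_L (bracket L x y) f) m"
        using f xy m by (simp add: cl bracket_closed S_diff)
    qed (use f xy in \<open>simp_all add: cl bracket_closed\<close>)
  }
qed

definition "hom_act = (SOME act. left_module U (left_mod hom_group act) \<and> (\<forall>f\<in>carrier hom_group.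
   (\<forall>a\<in>carrier A. act (eA a) f = hom_A a f) \<and> (\<forall>x\<in>carrier L. act (eL x) f = hom_L x f)))"

lemma hom_act_spec:
  "left_module U (left_mod hom_group hom_act)"
  "\<lbrakk>f \<in> homs; a \<in> carrier A\<rbrakk> \<Longrightarrow> hom_act (eA a) f = hom_A a f"
  "\<lbrakk>f \<in> homs; x \<in> carrier L\<rbrakk> \<Longrightarrow> hom_act (eL x) f = hom_L x f"
  using someI_ex[OF hom_action_exists, folded hom_act_def] by simp_all

end

section \<open>The isomorphism\<close>

locale lr_projection =
  L0: lie_rinehart k A \<phi> L0 + L: lie_rinehart k A \<phi> L +
  M: right_module "env k A \<phi> L" M + N: left_module "env k A \<phi> L0" N
  for k :: "'k ring" and A :: "'a ring" and \<phi> :: "'k \<Rightarrow> 'a"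
    and L0 :: "('a, 'l0) lie_rinehart" and L :: "('a, 'l) lie_rinehart"
    and M :: "(('k, 'a, 'l) env, 'm) rmodule" and N :: "(('k, 'a, 'l0) env, 'n) module" +
  fixes f :: "'l0 \<Rightarrow> 'l"
  assumes f: "f \<in> lie_rinehart_hom A L0 L"
begin

abbreviation "h \<equiv> env_map k A \<phi> L0 L f"
abbreviation "M0 \<equiv> restrict_right h M"
abbreviation "indN \<equiv> ind_left L0.U h L.U N"
abbreviation "source \<equiv> ind_right L0.U h L.U (lr_tensor k A \<phi> L0 M0 N)"

lemma f_closed [simp]: "x \<in> carrier L0 \<Longrightarrow> f x \<in> carrier L"
  using f by (auto simp: lie_rinehart_hom_def)

lemmas h_hom = env_map_spec(1)[OF L0.lie_rinehart_axioms L.lie_rinehart_axioms f]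

lemma h_gens [simp]:
  "a \<in> carrier A \<Longrightarrow> h (L0.eA a) = L.eA a" "x \<in> carrier L0 \<Longrightarrow> h (L0.eL x) = L.eL (f x)"
  by (rule env_map_spec[OF L0.lie_rinehart_axioms L.lie_rinehart_axioms f], assumption)+

lemma h_closed [simp]: "u \<in> carrier L0.U \<Longrightarrow> h u \<in> carrier L.U"
  by (rule ring_hom_closed[OF h_hom])

lemma U_one [simp]: "\<one>\<^bsub>L.U\<^esub> \<in> carrier L.U"
  by (rule ring.ring_simprules(6)[OF L.U_ring])

sublocale R0: lr_tensor_mod k A \<phi> L0 M0 N
  by (intro lr_tensor_mod.intro L0.lie_rinehart_axioms N.left_module_axioms
      restrict_right_module[OF L0.U_ring M.right_module_axioms h_hom])

sublocale J: ind_left_mod L0.U h L.U N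
  by (intro ind_left_mod.intro ind_left_mod_axioms.intro L0.U_ring L.U_ring N.left_module_axioms h_hom)

sublocale R: lr_tensor_mod k A \<phi> L M indN
  by (intro lr_tensor_mod.intro L.lie_rinehart_axioms M.right_module_axioms J.I_module)

sublocale I: ind_right_mod L0.U h L.U R0.P
  by (intro ind_right_mod.intro ind_right_mod_axioms.intro L0.U_ring L.U_ring R0.P_spec(1) h_hom)

sublocale H: lr_hom_mod k A \<phi> L M source
  by (intro lr_hom_mod.intro L.lie_rinehart_axioms M.right_module_axioms I.I_module)

sublocale Tgt: right_module L.U R.P
  by (rule R.P_spec(1))

lemma P_add_hom [simp]:
  "add_hom R0.P G = add_hom R0.tp.TG G" "add_hom G' R0.P = add_hom G' R0.tp.TG"
  "add_hom R.P G'' = add_hom R.tp.TG G''" "add_hom G''' R.P = add_hom G''' R.tp.TG"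
  by (simp_all add: add_hom_def)

lemma minus_sel [simp]:
  "x \<ominus>\<^bsub>R.P\<^esub> y = x \<ominus>\<^bsub>R.tp.TG\<^esub> y" "x'' \<ominus>\<^bsub>R0.P\<^esub> y'' = x'' \<ominus>\<^bsub>R0.tp.TG\<^esub> y''"
  "x' \<ominus>\<^bsub>source\<^esub> y' = x' \<ominus>\<^bsub>I.tp.TG\<^esub> y'"
  by (simp_all add: a_minus_def a_inv_def m_inv_def)

lemma R_t_add_hom: "m \<in> carrier M \<Longrightarrow> R.t m \<in> add_hom J.tp.TG R.tp.TG"
  using R.t_add_hom(2) by simp

section \<open>The maps \<sigma> and lam\<close>

definition "\<sigma> = tensor_lift R.P (\<lambda>m n. R.t m (J.e \<one>\<^bsub>L.U\<^esub> n))"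

lemma \<sigma>: "\<sigma> \<in> add_hom R0.tp.TG R.tp.TG"
  and \<sigma>_elem: "\<lbrakk>m \<in> carrier M; n \<in> carrier N\<rbrakk> \<Longrightarrow> \<sigma> (R0.t m n) = R.t m (J.e \<one>\<^bsub>L.U\<^esub> n)"
proof -
  have 1: "(\<lambda>m. R.t m (J.e \<one>\<^bsub>L.U\<^esub> n)) \<in> add_hom M0 R.P" if "n \<in> carrier N" for n
    using that by (simp add: R.t_add_hom(1))
  have 2: "(\<lambda>n. R.t m (J.e \<one>\<^bsub>L.U\<^esub> n)) \<in> add_hom N R.P" if "m \<in> carrier M0" for m
    using that add_hom_compose[OF J.e_add_hom(2)[OF U_one] R_t_add_hom[of m]] by simp
  \<comment> \<open>The element \<open>a\<close> crosses the outer tensor product, becomes a factor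
    next to 1 in U, and, being the image under \<open>h\<close> of an element of U0, crosses the
    inner tensor product to act on n.\<close>
  have 3: "R.t (m \<bullet>\<^bsub>M0\<^esub> L0.eA a) (J.e \<one>\<^bsub>L.U\<^esub> n) = R.t m (J.e \<one>\<^bsub>L.U\<^esub> (L0.eA a \<odot>\<^bsub>N\<^esub> n))"
    if "m \<in> carrier M0" "a \<in> carrier A" "n \<in> carrier N" for m a n
    using that R.t_balanced[of m a "J.e \<one>\<^bsub>L.U\<^esub> n"] J.act_props(2)[of "L.eA a" "\<one>\<^bsub>L.U\<^esub>" n]
      J.e_balanced[of "\<one>\<^bsub>L.U\<^esub>" "L0.eA a" n] by simp
  note lift = R0.t_lift[OF Tgt.abelian_group_axioms 1 2 3]
  show "\<sigma> \<in> add_hom R0.tp.TG R.tp.TG" unfolding \<sigma>_def using lift(1) by simp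
  show "\<lbrakk>m \<in> carrier M; n \<in> carrier N\<rbrakk> \<Longrightarrow> \<sigma> (R0.t m n) = R.t m (J.e \<one>\<^bsub>L.U\<^esub> n)"
    unfolding \<sigma>_def using lift(2) by simp
qed

lemma add_hom_P_act:
  "u \<in> carrier L.U \<Longrightarrow> (\<lambda>X. X \<bullet>\<^bsub>R.P\<^esub> u) \<in> add_hom R.tp.TG R.tp.TG"
  "u0 \<in> carrier L0.U \<Longrightarrow> (\<lambda>X. X \<bullet>\<^bsub>R0.P\<^esub> u0) \<in> add_hom R0.tp.TG R0.tp.TG"
  using right_module.act_add_hom[OF R.P_spec(1)] right_module.act_add_hom[OF R0.P_spec(1)] by simp_all

lemma \<sigma>_linear:
  assumes "u \<in> carrier L0.U" "X \<in> carrier R0.tp.TG"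
  shows "\<sigma> (X \<bullet>\<^bsub>R0.P\<^esub> u) = \<sigma> X \<bullet>\<^bsub>R.P\<^esub> h u"
proof -
  note \<sigma>d = add_hom_diff[OF R0.tp.TG_abelian_group R.tp.TG_abelian_group \<sigma>]
  note comp = add_hom_compose[OF add_hom_P_act(2) \<sigma>] add_hom_compose[OF \<sigma> add_hom_P_act(1)]
  have "\<sigma> (X \<bullet>\<^bsub>R0.P\<^esub> u) = \<sigma> X \<bullet>\<^bsub>restrict_right h R.P\<^esub> u"
  proof (rule L0.right_linearI[OF R0.P_spec(1) restrict_right_module[OF L0.U_ring R.P_spec(1) h_hom]])
    show "\<sigma> \<in> add_hom R0.P (restrict_right h R.P)"
      using \<sigma> by simp
  next
    fix X a assume X: "X \<in> carrier R0.P" and a: "a \<in> carrier A"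
    have "\<sigma> (X \<bullet>\<^bsub>R0.P\<^esub> L0.eA a) = \<sigma> X \<bullet>\<^bsub>R.P\<^esub> L.eA a"
      by (rule R0.t_eqI[OF comp])
        (use X a in \<open>simp_all add: R0.P_spec R.P_spec \<sigma>_elem M.rsmult_closed\<close>)
    then show "\<sigma> (X \<bullet>\<^bsub>R0.P\<^esub> L0.eA a) = \<sigma> X \<bullet>\<^bsub>restrict_right h R.P\<^esub> L0.eA a"
      using a by simp
  next
    fix X x assume X: "X \<in> carrier R0.P" and x: "x \<in> carrier L0"
    \<comment> \<open>\<open>L.eL (f x)\<close> is the image under \<open>h\<close> of a generator
      of U0, so acting on 1 \<otimes> n it crosses the inner tensor product and acts on n instead.
      This matches the subtracted terms of the two right actions.\<close>
    have e1: "R.t m (J.e \<one>\<^bsub>L.U\<^esub> (L0.eL x \<odot>\<^bsub>N\<^esub> n)) = R.t m (L.eL (f x) \<odot>\<^bsub>indN\<^esub> J.e \<one>\<^bsub>L.U\<^esub> n)"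
      if "m \<in> carrier M" "n \<in> carrier N" for m n
      using that x J.act_props(2)[of "L.eL (f x)" "\<one>\<^bsub>L.U\<^esub>" n]
        J.e_balanced[of "\<one>\<^bsub>L.U\<^esub>" "L0.eL x" n] by simp
    have "\<sigma> (X \<bullet>\<^bsub>R0.P\<^esub> L0.eL x) = \<sigma> X \<bullet>\<^bsub>R.P\<^esub> L.eL (f x)"
      by (rule R0.t_eqI[OF comp])
        (use X x in \<open>simp_all add: e1 R0.P_spec R.P_spec \<sigma>d \<sigma>_elem M.rsmult_closed N.lsmult_closed\<close>)
    then show "\<sigma> (X \<bullet>\<^bsub>R0.P\<^esub> L0.eL x) = \<sigma> X \<bullet>\<^bsub>restrict_right h R.P\<^esub> L0.eL x"
      using x by simp
  qed (use assms in simp_all)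
  then show ?thesis by simp
qed

definition "lam = tensor_lift R.P (\<lambda>p u. \<sigma> p \<bullet>\<^bsub>R.P\<^esub> u)"

text \<open>It is \<open>\<sigma>_linear\<close> that makes the pairing of p and u balanced over
  U0.\<close>

lemma lam: "lam \<in> add_hom I.tp.TG R.tp.TG"
  and lam_elem: "\<lbrakk>p \<in> carrier R0.tp.TG; u \<in> carrier L.U\<rbrakk> \<Longrightarrow> lam (I.e p u) = \<sigma> p \<bullet>\<^bsub>R.P\<^esub> u"
proof -
  note \<sigma>c = add_hom_closed[OF \<sigma>]
  have "I.tp.balanced R.P (\<lambda>p u. \<sigma> p \<bullet>\<^bsub>R.P\<^esub> u)"
    unfolding I.tp.balanced_def
  proof (intro conjI ballI)
    fix u assume "u \<in> carrier (left_mod L.U (\<lambda>r s. h r \<otimes>\<^bsub>L.U\<^esub> s))"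
    then show "(\<lambda>p. \<sigma> p \<bullet>\<^bsub>R.P\<^esub> u) \<in> add_hom R0.P R.P"
      by (simp add: add_hom_compose[OF \<sigma> add_hom_P_act(1)])
  next
    fix p assume p: "p \<in> carrier R0.P"
    then show "(\<lambda>u. \<sigma> p \<bullet>\<^bsub>R.P\<^esub> u) \<in> add_hom (left_mod L.U (\<lambda>r s. h r \<otimes>\<^bsub>L.U\<^esub> s)) R.P"
      using \<sigma>c Tgt.rsmult_closed Tgt.rsmult_add_right by (auto simp: add_hom_def simp del: P_add_hom)
    fix r u assume "r \<in> carrier L0.U" "u \<in> carrier (left_mod L.U (\<lambda>r s. h r \<otimes>\<^bsub>L.U\<^esub> s))"
    then show "\<sigma> (p \<bullet>\<^bsub>R0.P\<^esub> r) \<bullet>\<^bsub>R.P\<^esub> u = \<sigma> p \<bullet>\<^bsub>R.P\<^esub> (r \<odot>\<^bsub>left_mod L.U (\<lambda>r s. h r \<otimes>\<^bsub>L.U\<^esub> s)\<^esub> u)"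
      using p \<sigma>c by (simp add: \<sigma>_linear Tgt.rsmult_assoc)
  qed
  note lift = I.tp.tensor_lift_props[OF Tgt.abelian_group_axioms this]
  show "lam \<in> add_hom I.tp.TG R.tp.TG" unfolding lam_def using lift(1) by simp
  show "\<lbrakk>p \<in> carrier R0.tp.TG; u \<in> carrier L.U\<rbrakk> \<Longrightarrow> lam (I.e p u) = \<sigma> p \<bullet>\<^bsub>R.P\<^esub> u"
    unfolding lam_def using lift(2)[of p u] by (simp add: I.e_eq)
qed

lemma lam_linear:
  assumes "u \<in> carrier L.U" "Y \<in> carrier I.tp.TG"
  shows "lam (Y \<bullet>\<^bsub>source\<^esub> u) = lam Y \<bullet>\<^bsub>R.P\<^esub> u"
  by (rule I.tp.add_hom_eqI[OF add_hom_compose[OF I.act_props(1) lam] add_hom_compose[OF lam add_hom_P_act(1)] _ assms(2)])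
    (use assms in \<open>simp_all add: I.act_props(2) lam_elem add_hom_closed[OF \<sigma>] Tgt.rsmult_assoc flip: I.e_eq\<close>)

text \<open>The \<open>U\<^sub>0\<close>-linear map \<open>N \<rightarrow> Hom\<^sub>A(M, (M \<otimes>\<^sub>A N) \<otimes>\<^bsub>U\<^sub>0\<^esub> U)\<close>; its \<open>U\<close>-linear extension \<open>G\<close>
  to \<open>U \<otimes>\<^bsub>U\<^sub>0\<^esub> N\<close> is the adjoint of the inverse of \<open>\<lambda>\<close>.\<close>

definition "\<eta> n = (\<lambda>m\<in>carrier M. I.e (R0.t m n) \<one>\<^bsub>L.U\<^esub>)"

lemma \<eta>_apply [simp]: "m \<in> carrier M \<Longrightarrow> \<eta> n m = I.e (R0.t m n) \<one>\<^bsub>L.U\<^esub>"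
  by (simp add: \<eta>_def)

text \<open>An element of U0 acting on p crosses the tensor product and becomes a factor next to 1,
  where left and right multiplication agree; so it reappears as the right action of its image in
  U.\<close>

lemma e_gen:
  assumes "p \<in> carrier R0.tp.TG"
  shows "u \<in> carrier L0.U \<Longrightarrow> I.e (p \<bullet>\<^bsub>R0.P\<^esub> u) \<one>\<^bsub>L.U\<^esub> = I.e p \<one>\<^bsub>L.U\<^esub> \<bullet>\<^bsub>source\<^esub> h u"
  using assms I.e_balanced[of p u "\<one>\<^bsub>L.U\<^esub>"] I.act_props(2)[of "h u" p "\<one>\<^bsub>L.U\<^esub>"] by simp

lemma \<eta>_homs [simp]: "n \<in> carrier N \<Longrightarrow> \<eta> n \<in> H.homs"
  unfolding \<eta>_def
proof (rule H.restrict_homs)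
  assume n: "n \<in> carrier N"
  show "(\<lambda>m. I.e (R0.t m n) \<one>\<^bsub>L.U\<^esub>) \<in> add_hom M source"
    using add_hom_compose[OF R0.t_add_hom(1)[OF n] I.e_add_hom(1)[OF U_one, simplified]] by simp
  fix m a assume "m \<in> carrier M" "a \<in> carrier A"
  then show "I.e (R0.t (m \<bullet>\<^bsub>M\<^esub> L.eA a) n) \<one>\<^bsub>L.U\<^esub> = I.e (R0.t m n) \<one>\<^bsub>L.U\<^esub> \<bullet>\<^bsub>source\<^esub> L.eA a"
    using n e_gen[of "R0.t m n" "L0.eA a"] R0.P_spec(2)[of m n a] by simp
qed

abbreviation "HM \<equiv> left_mod H.hom_group H.hom_act"

sublocale HM: left_module L.U HM
  by (rule H.hom_act_spec(1))

lemma act_homs [simp]: "\<lbrakk>u \<in> carrier L.U; g \<in> H.homs\<rbrakk> \<Longrightarrow> H.hom_act u g \<in> H.homs"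
  using HM.lsmult_closed[of u g] by simp

lemma I_e_diff:
  "\<lbrakk>p \<in> carrier R0.tp.TG; q \<in> carrier R0.tp.TG\<rbrakk> \<Longrightarrow>
    I.e (p \<ominus>\<^bsub>R0.tp.TG\<^esub> q) \<one>\<^bsub>L.U\<^esub> = I.e p \<one>\<^bsub>L.U\<^esub> \<ominus>\<^bsub>I.tp.TG\<^esub> I.e q \<one>\<^bsub>L.U\<^esub>"
  by (rule add_hom_diff[OF R0.tp.TG_abelian_group I.tp.TG_abelian_group I.e_add_hom(1)[OF U_one, simplified]])

lemma \<eta>_add_hom: "\<eta> \<in> add_hom N H.hom_group"
proof (rule add_homI)
  fix n n' assume n: "n \<in> carrier N" "n' \<in> carrier N"
  then show "\<eta> n \<in> carrier H.hom_group" by simp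
  have "\<eta> n \<oplus>\<^bsub>H.hom_group\<^esub> \<eta> n' \<in> H.homs"
    using n H.HG.a_closed[of "\<eta> n" "\<eta> n'"] by simp
  then show "\<eta> (n \<oplus>\<^bsub>N\<^esub> n') = \<eta> n \<oplus>\<^bsub>H.hom_group\<^esub> \<eta> n'"
    by (intro H.homs_eqI)
      (use n add_hom_add[OF I.e_add_hom(1)[OF U_one]] in \<open>simp_all add: R0.t_add\<close>)
qed

text \<open>For a generator x of L0, the formula for (m \<otimes> n) x solved for m \<otimes> xn is
  precisely the formula of \<open>hom_L\<close>. For \<open>a\<close> the claim is the balancing
  relation over \<open>A\<close>.\<close>

lemma \<eta>_linear:
  assumes "u \<in> carrier L0.U" "n \<in> carrier N"
  shows "\<eta> (u \<odot>\<^bsub>N\<^esub> n) = H.hom_act (h u) (\<eta> n)"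
proof -
  have "\<eta> (u \<odot>\<^bsub>N\<^esub> n) = u \<odot>\<^bsub>restrict_left h HM\<^esub> \<eta> n"
  proof (rule L0.left_linearI[OF N.left_module_axioms restrict_left_module[OF L0.U_ring HM.left_module_axioms h_hom]])
    show "\<eta> \<in> add_hom N (restrict_left h HM)"
      using \<eta>_add_hom by simp
  next
    fix n a assume n: "n \<in> carrier N" and a: "a \<in> carrier A"
    have "\<eta> (L0.eA a \<odot>\<^bsub>N\<^esub> n) = H.hom_A a (\<eta> n)"
      by (rule H.homs_eqI)
        (use n a R0.t_balanced[of _ a n] in \<open>simp_all add: N.lsmult_closed H.hom_A_closed M.rsmult_closed\<close>)
    then show "\<eta> (L0.eA a \<odot>\<^bsub>N\<^esub> n) = L0.eA a \<odot>\<^bsub>restrict_left h HM\<^esub> \<eta> n"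
      using n a by (simp add: H.hom_act_spec)
  next
    fix n x assume n: "n \<in> carrier N" and x: "x \<in> carrier L0"
    have "\<eta> (L0.eL x \<odot>\<^bsub>N\<^esub> n) = H.hom_L (f x) (\<eta> n)"
    proof (rule H.homs_eqI)
      fix m assume m: "m \<in> carrier M"
      have "I.e (R0.t m n) \<one>\<^bsub>L.U\<^esub> \<bullet>\<^bsub>source\<^esub> L.eL (f x) = I.e (R0.t m n \<bullet>\<^bsub>R0.P\<^esub> L0.eL x) \<one>\<^bsub>L.U\<^esub>"
        using m n x e_gen[of "R0.t m n" "L0.eL x"] by simp
      also have "\<dots> = I.e (R0.t (m \<bullet>\<^bsub>M\<^esub> L.eL (f x)) n) \<one>\<^bsub>L.U\<^esub> \<ominus>\<^bsub>I.tp.TG\<^esub> I.e (R0.t m (L0.eL x \<odot>\<^bsub>N\<^esub> n)) \<one>\<^bsub>L.U\<^esub>"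
        using m n x by (simp add: R0.P_spec(3) I_e_diff M.rsmult_closed N.lsmult_closed)
      finally show "\<eta> (L0.eL x \<odot>\<^bsub>N\<^esub> n) m = H.hom_L (f x) (\<eta> n) m"
        using m n x by (simp add: M.rsmult_closed N.lsmult_closed I.tp.TG.diff_diff_cancel)
    qed (use n x in \<open>simp_all add: N.lsmult_closed H.hom_L_closed\<close>)
    then show "\<eta> (L0.eL x \<odot>\<^bsub>N\<^esub> n) = L0.eL x \<odot>\<^bsub>restrict_left h HM\<^esub> \<eta> n"
      using n x by (simp add: H.hom_act_spec)
  qed (use assms in simp_all)
  then show ?thesis by simp
qed

definition "G = tensor_lift H.hom_group (\<lambda>u n. H.hom_act u (\<eta> n))"

lemma hom_act_add_hom:
  "u \<in> carrier L.U \<Longrightarrow> H.hom_act u \<in> add_hom H.hom_group H.hom_group"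
  "g \<in> H.homs \<Longrightarrow> (\<lambda>u. H.hom_act u g) \<in> add_hom L.U H.hom_group"
  using HM.lsmult_add_right[of u] HM.lsmult_add_left[of _ _ g] by (auto intro!: add_homI)

lemma G: "G \<in> add_hom J.tp.TG H.hom_group"
  and G_elem: "\<lbrakk>u \<in> carrier L.U; n \<in> carrier N\<rbrakk> \<Longrightarrow> G (J.e u n) = H.hom_act u (\<eta> n)"
proof -
  have "J.tp.balanced H.hom_group (\<lambda>u n. H.hom_act u (\<eta> n))"
    unfolding J.tp.balanced_def
  proof (intro conjI ballI)
    fix n assume n: "n \<in> carrier N"
    then show "(\<lambda>u. H.hom_act u (\<eta> n)) \<in> add_hom (right_mod L.U (\<lambda>s r. s \<otimes>\<^bsub>L.U\<^esub> h r)) H.hom_group"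
      by (simp add: hom_act_add_hom)
  next
    fix u assume u: "u \<in> carrier (right_mod L.U (\<lambda>s r. s \<otimes>\<^bsub>L.U\<^esub> h r))"
    then show "(\<lambda>n. H.hom_act u (\<eta> n)) \<in> add_hom N H.hom_group"
      by (simp add: add_hom_compose[OF \<eta>_add_hom hom_act_add_hom(1)])
    fix r n assume "r \<in> carrier L0.U" "n \<in> carrier N"
    then show "H.hom_act (u \<bullet>\<^bsub>right_mod L.U (\<lambda>s r. s \<otimes>\<^bsub>L.U\<^esub> h r)\<^esub> r) (\<eta> n) = H.hom_act u (\<eta> (r \<odot>\<^bsub>N\<^esub> n))"
      using u HM.lsmult_assoc[of u "h r" "\<eta> n"] by (simp add: \<eta>_linear)
  qed
  note lift = J.tp.tensor_lift_props[OF H.hom_group_abelian this]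
  show "G \<in> add_hom J.tp.TG H.hom_group" unfolding G_def by (rule lift(1))
  show "\<lbrakk>u \<in> carrier L.U; n \<in> carrier N\<rbrakk> \<Longrightarrow> G (J.e u n) = H.hom_act u (\<eta> n)"
    unfolding G_def using lift(2)[of u n] by (simp add: J.e_eq)
qed

lemma G_homs [simp]: "x \<in> carrier J.tp.TG \<Longrightarrow> G x \<in> H.homs"
  using add_hom_closed[OF G] by simp

lemma G_linear:
  assumes "u \<in> carrier L.U" "x \<in> carrier J.tp.TG"
  shows "G (u \<odot>\<^bsub>indN\<^esub> x) = H.hom_act u (G x)"
  by (rule J.tp.add_hom_eqI[OF add_hom_compose[OF J.act_props(1) G] add_hom_compose[OF G hom_act_add_hom(1)] _ assms(2)])
    (use assms HM.lsmult_assoc[of u _ "\<eta> _"] in \<open>simp_all add: J.act_props(2) G_elem flip: J.e_eq\<close>)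

text \<open>The identity of \<open>M\<close> tensored with \<open>G\<close>, followed by evaluation
  of maps in Hom at elements of \<open>M\<close>.\<close>

definition "\<mu> = tensor_lift source (\<lambda>m x. G x m)"

lemma \<mu>: "\<mu> \<in> add_hom R.tp.TG I.tp.TG"
  and \<mu>_elem: "\<lbrakk>m \<in> carrier M; x \<in> carrier J.tp.TG\<rbrakk> \<Longrightarrow> \<mu> (R.t m x) = G x m"
proof -
  have 1: "(\<lambda>m. G x m) \<in> add_hom M source" if "x \<in> carrier indN" for x
    using H.homsD(1)[OF G_homs[of x]] that by simp
  have 2: "(\<lambda>x. G x m) \<in> add_hom indN source" if "m \<in> carrier M" for m
    using that H.homsD(2)[OF G_homs] by (auto intro!: add_homI simp: add_hom_add[OF G] simp del: I.add_hom_I)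
  have 3: "G x (m \<bullet>\<^bsub>M\<^esub> L.eA a) = G (L.eA a \<odot>\<^bsub>indN\<^esub> x) m"
    if "m \<in> carrier M" "a \<in> carrier A" "x \<in> carrier indN" for m a x
    using that by (simp add: G_linear H.hom_act_spec)
  note lift = R.t_lift[OF H.S.abelian_group_axioms 1 2 3]
  show "\<mu> \<in> add_hom R.tp.TG I.tp.TG" unfolding \<mu>_def using lift(1) by simp
  show "\<lbrakk>m \<in> carrier M; x \<in> carrier J.tp.TG\<rbrakk> \<Longrightarrow> \<mu> (R.t m x) = G x m"
    unfolding \<mu>_def using lift(2)[of m x] by simp
qed

lemma indN_closed: "\<lbrakk>u \<in> carrier L.U; x \<in> carrier J.tp.TG\<rbrakk> \<Longrightarrow> u \<odot>\<^bsub>indN\<^esub> x \<in> carrier J.tp.TG"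
  by (rule add_hom_closed[OF J.act_props(1)])

lemma \<mu>_linear:
  assumes "u \<in> carrier L.U" "X \<in> carrier R.tp.TG"
  shows "\<mu> (X \<bullet>\<^bsub>R.P\<^esub> u) = \<mu> X \<bullet>\<^bsub>source\<^esub> u"
proof (rule L.right_linearI[OF R.P_spec(1) I.I_module])
  note \<mu>d = add_hom_diff[OF R.tp.TG_abelian_group I.tp.TG_abelian_group \<mu>]
  note comp = add_hom_compose[OF add_hom_P_act(1) \<mu>] add_hom_compose[OF \<mu> I.act_props(1)]
  show "\<mu> \<in> add_hom R.P source" using \<mu> by simp
  fix X assume X: "X \<in> carrier R.P"
  show "\<mu> (X \<bullet>\<^bsub>R.P\<^esub> L.eA a) = \<mu> X \<bullet>\<^bsub>source\<^esub> L.eA a" if "a \<in> carrier A" for a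
    by (rule R.t_eqI[OF comp])
      (use X that in \<open>simp_all add: R.P_spec \<mu>_elem M.rsmult_closed H.homsD(4)[OF G_homs]\<close>)
  show "\<mu> (X \<bullet>\<^bsub>R.P\<^esub> L.eL x) = \<mu> X \<bullet>\<^bsub>source\<^esub> L.eL x" if x: "x \<in> carrier L" for x
  proof (rule R.t_eqI[OF comp])
    fix m y assume my: "m \<in> carrier M" "y \<in> carrier indN"
    have c: "G y m \<in> carrier I.tp.TG" "G y (m \<bullet>\<^bsub>M\<^esub> L.eL x) \<in> carrier I.tp.TG"
      using my x H.homsD(2)[OF G_homs[of y]] by (simp_all add: M.rsmult_closed)
    \<comment> \<open>With g = \<open>G y\<close>, the subtracted term is (x g)(m) = g(mx) - g(m) x,
      so that only g(m) x survives.\<close>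
    have "\<mu> (R.t m y \<bullet>\<^bsub>R.P\<^esub> L.eL x) = G y (m \<bullet>\<^bsub>M\<^esub> L.eL x) \<ominus>\<^bsub>I.tp.TG\<^esub> H.hom_L x (G y) m"
      using my x by (simp add: R.P_spec \<mu>d \<mu>_elem M.rsmult_closed indN_closed G_linear H.hom_act_spec)
    also have "\<dots> = G y m \<bullet>\<^bsub>source\<^esub> L.eL x"
      using my x c add_hom_closed[OF I.act_props(1), of "L.eL x" "G y m"] by (simp add: I.tp.TG.diff_diff_cancel)
    finally show "\<mu> (R.t m y \<bullet>\<^bsub>R.P\<^esub> L.eL x) = \<mu> (R.t m y) \<bullet>\<^bsub>source\<^esub> L.eL x"
      using my by (simp add: \<mu>_elem)
  qed (use X x in simp_all)
qed (use assms in simp_all)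

section \<open>The two composites are identities\<close>

lemma \<mu>_\<sigma>:
  assumes "p \<in> carrier R0.tp.TG"
  shows "\<mu> (\<sigma> p) = I.e p \<one>\<^bsub>L.U\<^esub>"
  by (rule R0.t_eqI[OF add_hom_compose[OF \<sigma> \<mu>] I.e_add_hom(1)[OF U_one, simplified] _ assms])
    (use HM.lsmult_one in \<open>simp_all add: \<sigma>_elem \<mu>_elem G_elem\<close>)

lemma \<mu>_lam:
  assumes "Y \<in> carrier I.tp.TG"
  shows "\<mu> (lam Y) = Y"
proof -
  have id: "(\<lambda>Y. Y) \<in> add_hom I.tp.TG I.tp.TG" by (simp add: add_hom_def)
  show ?thesis
    by (rule I.tp.add_hom_eqI[OF add_hom_compose[OF lam \<mu>] id _ assms])
      (simp_all add: lam_elem \<mu>_linear add_hom_closed[OF \<sigma>] \<mu>_\<sigma> I.act_props(2) flip: I.e_eq)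
qed

text \<open>This is \<open>lam\<close> after \<mu> on the elements m \<otimes> (u \<otimes> n). The
  induction needs m arbitrary, because a generator split off from u acts on Hom by changing the
  point of evaluation to ma or mx.\<close>

lemma lam_act_fn:
  assumes "u \<in> carrier L.U" "n \<in> carrier N" "m \<in> carrier M"
  shows "lam (H.hom_act u (\<eta> n) m) = R.t m (J.e u n)"
proof -
  note lamd = add_hom_diff[OF I.tp.TG_abelian_group R.tp.TG_abelian_group lam]
  note Hc = H.homsD(2)[OF act_homs[OF _ \<eta>_homs]]
  show ?thesis
    using assms(1,3)
  proof (induction arbitrary: m rule: L.env_induct)
    case one
    then show ?case
      using assms(2) HM.lsmult_one[of "\<eta> n"] Tgt.rsmult_one[of "R.t m (J.e \<one>\<^bsub>L.U\<^esub> n)"]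
      by (simp add: lam_elem \<sigma>_elem)
  next
    case (add u v)
    then show ?case
      using assms(2) HM.lsmult_add_left[of u v "\<eta> n"] Hc[of u n m] Hc[of v n m]
      by (simp add: add_hom_add[OF lam] add_hom_add[OF J.e_add_hom(1)] add_hom_add[OF R_t_add_hom])
  next
    case (A a u)
    have "H.hom_act (L.eA a \<otimes>\<^bsub>L.U\<^esub> u) (\<eta> n) m = H.hom_act u (\<eta> n) (m \<bullet>\<^bsub>M\<^esub> L.eA a)"
      using A assms(2) HM.lsmult_assoc[of "L.eA a" u "\<eta> n"] by (simp add: H.hom_act_spec)
    then show ?case
      using A assms(2) R.t_balanced[of m a "J.e u n"] by (simp add: M.rsmult_closed J.act_props(2))
  next
    case (L x u)
    have c: "H.hom_act u (\<eta> n) m \<in> carrier I.tp.TG" "H.hom_act u (\<eta> n) (m \<bullet>\<^bsub>M\<^esub> L.eL x) \<in> carrier I.tp.TG"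
      using L assms(2) Hc[of u n] by (simp_all add: M.rsmult_closed)
    have "H.hom_act (L.eL x \<otimes>\<^bsub>L.U\<^esub> u) (\<eta> n) m =
        H.hom_act u (\<eta> n) (m \<bullet>\<^bsub>M\<^esub> L.eL x) \<ominus>\<^bsub>I.tp.TG\<^esub> H.hom_act u (\<eta> n) m \<bullet>\<^bsub>source\<^esub> L.eL x"
      using L assms(2) HM.lsmult_assoc[of "L.eL x" u "\<eta> n"] by (simp add: H.hom_act_spec)
    \<comment> \<open>Linearity of \<open>lam\<close> and the induction hypothesis at m and at mx
      give mx \<otimes> y - (m \<otimes> y) x with y = u \<otimes> n; by the formula for the right
      action this is m \<otimes> xy.\<close>
    then have "lam (H.hom_act (L.eL x \<otimes>\<^bsub>L.U\<^esub> u) (\<eta> n) m) =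
        R.t (m \<bullet>\<^bsub>M\<^esub> L.eL x) (J.e u n) \<ominus>\<^bsub>R.tp.TG\<^esub> R.t m (J.e u n) \<bullet>\<^bsub>R.P\<^esub> L.eL x"
      using L c add_hom_closed[OF I.act_props(1), of "L.eL x"] by (simp add: lamd lam_linear M.rsmult_closed)
    also have "\<dots> = R.t m (L.eL x \<odot>\<^bsub>indN\<^esub> J.e u n)"
      using L assms(2) indN_closed[of "L.eL x" "J.e u n"]
      by (simp add: R.P_spec R.tp.TG.diff_diff_cancel M.rsmult_closed)
    finally show ?case
      using L assms(2) by (simp add: J.act_props(2))
  qed
qed

lemma lam_\<mu>:
  assumes "X \<in> carrier R.tp.TG"
  shows "lam (\<mu> X) = X"
proof -
  have id: "(\<lambda>X. X) \<in> add_hom R.tp.TG R.tp.TG" by (simp add: add_hom_def)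
  have *: "lam (G x m) = R.t m x" if m: "m \<in> carrier M" and x: "x \<in> carrier J.tp.TG" for m x
  proof -
    have "(\<lambda>x. lam (G x m)) \<in> add_hom J.tp.TG R.tp.TG"
      using m H.homsD(2)[OF G_homs, of _ m]
      by (auto intro!: add_homI simp: add_hom_add[OF G] add_hom_add[OF lam] add_hom_closed[OF lam])
    then show ?thesis
      by (rule J.tp.add_hom_eqI[OF _ R_t_add_hom[OF m] _ x])
        (use m in \<open>simp_all add: G_elem lam_act_fn flip: J.e_eq\<close>)
  qed
  show ?thesis
    by (rule R.t_eqI[OF add_hom_compose[OF \<mu> lam] id _ assms]) (simp add: \<mu>_elem *)
qed

lemma lam_iso: "lam \<in> right_module_iso L.U source R.P"
proof -
  have "bij_betw lam (carrier I.tp.TG) (carrier R.tp.TG)"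
    by (rule bij_betw_byWitness[of _ \<mu>])
      (auto simp: \<mu>_lam lam_\<mu> add_hom_closed[OF lam] add_hom_closed[OF \<mu>])
  then show ?thesis
    using add_hom_closed[OF lam] add_hom_add[OF lam] lam_linear
    by (simp add: right_module_iso_def right_module_hom_def)
qed

lemma \<sigma>_hom: "\<sigma> \<in> right_module_hom L0.U R0.P (restrict_right h R.P)"
  using add_hom_closed[OF \<sigma>] add_hom_add[OF \<sigma>] \<sigma>_linear
  by (simp add: right_module_hom_def)

end

theorem mainTheorem4:
  fixes k :: "'k ring" and A :: "'a ring" and \<phi> :: "'k \<Rightarrow> 'a"
    and L0 :: "('a, 'l0) lie_rinehart" and L :: "('a, 'l) lie_rinehart" and f :: "'l0 \<Rightarrow> 'l"
    and M :: "(('k, 'a, 'l) env, 'm) rmodule" and N :: "(('k, 'a, 'l0) env, 'n) module"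
  assumes "cring k" and "cring A" and "\<phi> \<in> ring_hom k A"
    and "lie_rinehart k A \<phi> L0" and "lie_rinehart k A \<phi> L"
    and "f \<in> lie_rinehart_hom A L0 L"
    and "right_module (env k A \<phi> L) M"
    and "left_module (env k A \<phi> L0) N"
  shows "let U0 = env k A \<phi> L0; U = env k A \<phi> L; h = env_map k A \<phi> L0 L f;
             M0 = restrict_right h M;
             P = lr_tensor k A \<phi> L0 M0 N;
             indN = ind_left U0 h U N;
             source = ind_right U0 h U P;
             target = lr_tensor k A \<phi> L M indN;
             \<sigma> = tensor_lift target
                   (\<lambda>m n. lr_tensor_elem k A \<phi> L M indN m (ind_left_elem U0 h U N \<one>\<^bsub>U\<^esub> n));
             lam = tensor_lift target (\<lambda>p u. \<sigma> p \<bullet>\<^bsub>target\<^esub> u)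
         in right_module U0 P \<and> right_module U source \<and> right_module U target \<and>
            \<sigma> \<in> right_module_hom U0 P (restrict_right h target) \<and>
            (\<forall>m\<in>carrier M. \<forall>n\<in>carrier N.
               \<sigma> (lr_tensor_elem k A \<phi> L0 M0 N m n) =
                 lr_tensor_elem k A \<phi> L M indN m (ind_left_elem U0 h U N \<one>\<^bsub>U\<^esub> n)) \<and>
            (\<forall>p\<in>carrier P. \<forall>u\<in>carrier U.
               lam (ind_right_elem U0 h U P p u) = \<sigma> p \<bullet>\<^bsub>target\<^esub> u) \<and>
            lam \<in> right_module_iso U source target"
proof -
  interpret lr_projection k A \<phi> L0 L M N f
    by (intro lr_projection.intro lr_projection_axioms.intro assms)
  show ?thesis
    unfolding Let_def
    using R0.P_spec(1) I.I_module R.P_spec(1) \<sigma>_hom \<sigma>_elem lam_elem lam_iso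
    unfolding \<sigma>_def lam_def by simp
qed

end
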